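(* Let $E,E_1,E_2\subset[1,2]$ be nonempty with upper Minkowski dimensions $\beta,\beta_1,\beta_2$ respectively. (i) Suppose $m$ is $a$-admissible up to order $1$ with $2a>d+\beta$. If $2a\le2d+\beta$, then $$\mathcal{A}_{m,E}:L^p\times L^q\to L^2$$ is bounded for $\frac{2d}{2a-\beta}<p,q\le2$ with $\frac1p+\frac1q<\frac12+\frac{2a-\beta}{2d}$. If $2a>2d+\beta$, the same boundedness holds for $1<p,q\le2$ with $\frac1p+\frac1q<\frac32$. (ii) Suppose $m$ is $a$-admissible up to order $2$ with $2a>d+\beta_1+\beta_2$. If $2a\le2d+\beta_1+\beta_2$, then $$\mathcal{A}^{(2)}_{m,E_1,E_2}:L^p\times L^q\to L^2$$ is bounded for $\frac{2d}{2a-\beta_1-\beta_2}<p,q\le2$ with $\frac1p+\frac1q<\frac12+\frac{2a-\beta_1-\beta_2}{2d}$. If $2a>2d+\beta_1+\beta_2$, then $\mathcal{A}^{(2)}_{m,E_1,E_2}:L^p\times L^q\to L^2$ is bounded for $1<p,q\le2$ with $\frac1p+\frac1q<\frac32$.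
   Context: All functions are on $\mathbb{R}^d$, $d\ge1$, and operators are initially defined for $f,g\in C_0^\infty(\mathbb{R}^d)$. The Fourier transform is $\hat f(\xi)=\int f(x)e^{-2\pi i x\cdot\xi}\,dx$. Admissible multipliers: for $k\ge 0$, a bounded function $m:\mathbb{R}^{2d}\to\mathbb{C}$ is $a$-admissible up to order $k$ if $m\in C^k(\mathbb{R}^{2d})$, $a>\frac d2$, and $|\partial^\alpha m(\xi,\eta)|\lesssim_\alpha (1+|\xi|+|\eta|)^{-a}$ for all multi-indices $\alpha$ with $|\alpha|\le k$ and all $\xi,\eta\in\mathbb{R}^d$. Define $$T_{m_{t_1,t_2}}(f,g)(x)=\int_{\mathbb{R}^{2d}}\hat f(\xi)\hat g(\eta)m(t_1\xi,t_2\eta)e^{2\pi ix\cdot(\xi+\eta)}\,d\xi d\eta,\qquad T_{m_t}=T_{m_{t,t}},$$ $$\mathcal{A}_{m,E}(f,g)(x)=\sup_{t\in E}|T_{m_t}(f,g)(x)|,\qquad\mathcal{A}^{(2)}_{m,E_1,E_2}(f,g)(x)=\sup_{t_1\in E_1,\,t_2\in E_2}|T_{m_{t_1,t_2}}(f,g)(x)|.$$ Boundedness $L^p\times L^q\to L^r$ of an operator $\mathcal{B}$ means $\|\mathcal{B}(f,g)\|_{L^r}\le C\|f\|_{L^p}\|g\|_{L^q}$ with $C$ independent of $f,g$. Upper Minkowski dimension: $\dim_M(E)=\limsup_{\delta\to0}\frac{\log N(E,\delta)}{\log(1/\delta)}$, where $N(E,\delta)$ is the minimal number of closed intervals of length $\delta$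 needed to cover $E$. *)

theory Defs
  imports "HOL-Analysis.Analysis"
begin

section \<open>Smoothness and admissible multipliers\<close>

definition partial_deriv ::
  "'b \<Rightarrow> ('b::euclidean_space \<Rightarrow> complex) \<Rightarrow> 'b \<Rightarrow> complex" where
  "partial_deriv b f x = vector_derivative (\<lambda>s. f (x + s *\<^sub>R b)) (at 0)"

primrec C_k :: "nat \<Rightarrow> ('b::euclidean_space \<Rightarrow> complex) \<Rightarrow> bool" where
  "C_k 0 f \<longleftrightarrow> continuous_on UNIV f"
| "C_k (Suc k) f \<longleftrightarrow> continuous_on UNIV f \<and>
     (\<forall>b\<in>Basis. (\<forall>x. (\<lambda>s. f (x + s *\<^sub>R b)) differentiable (at 0)) \<and> C_k k (partial_deriv b f))"

definition test_functions :: "('b::euclidean_space \<Rightarrow> complex) set" where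
  "test_functions = {f. (\<forall>k. C_k k f) \<and> compact (closure {x. f x \<noteq> 0})}"

text \<open>A multi-index of order \<open>n\<close> is represented by a list of \<open>n\<close> coordinate directions, the
  multiplicities of the directions being the entries of the multi-index; the derivatives are taken
  successively along the list. For a function of class \<open>C_k k\<close> and \<open>n \<le> k\<close>, the order of the list
  does not matter, by symmetry of mixed partial derivatives.

  Multipliers live on \<open>'a \<times> 'a\<close>, which plays the role of the space of dimension \<open>2d\<close>,
  where \<open>d = DIM('a)\<close>.\<close>

definition admissible ::
  "real \<Rightarrow> nat \<Rightarrow> ('a::euclidean_space \<times> 'a \<Rightarrow> complex) \<Rightarrow> bool" where
  "admissible a k m \<longleftrightarrow>
     bounded (range m) \<and> C_k k m \<and> a > real DIM('a) / 2 \<and>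
     (\<forall>bs. set bs \<subseteq> Basis \<and> length bs \<le> k \<longrightarrow>
        (\<exists>C. \<forall>\<xi> \<eta>. norm (fold partial_deriv bs m (\<xi>, \<eta>)) \<le> C * (1 + norm \<xi> + norm \<eta>) powr (-a)))"


section \<open>Bilinear multiplier operators and their maximal functions\<close>

definition fourier :: "('a::euclidean_space \<Rightarrow> complex) \<Rightarrow> 'a \<Rightarrow> complex" where
  "fourier f \<xi> = (LINT x|lborel. f x * exp (- 2 * of_real pi * \<i> * of_real (x \<bullet> \<xi>)))"

definition bilinear_mult ::
  "('a::euclidean_space \<times> 'a \<Rightarrow> complex) \<Rightarrow> real \<Rightarrow> real \<Rightarrow>
   ('a \<Rightarrow> complex) \<Rightarrow> ('a \<Rightarrow> complex) \<Rightarrow> 'a \<Rightarrow> complex" where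
  "bilinear_mult m t1 t2 f g x =
     (LINT (\<xi>, \<eta>)|lborel. fourier f \<xi> * fourier g \<eta> * m (t1 *\<^sub>R \<xi>, t2 *\<^sub>R \<eta>)
        * exp (2 * of_real pi * \<i> * of_real (x \<bullet> (\<xi> + \<eta>))))"

definition maximal_op ::
  "('a::euclidean_space \<times> 'a \<Rightarrow> complex) \<Rightarrow> real set \<Rightarrow>
   ('a \<Rightarrow> complex) \<Rightarrow> ('a \<Rightarrow> complex) \<Rightarrow> 'a \<Rightarrow> ennreal" where
  "maximal_op m E f g x = (SUP t\<in>E. ennreal (norm (bilinear_mult m t t f g x)))"

definition biparam_maximal_op ::
  "('a::euclidean_space \<times> 'a \<Rightarrow> complex) \<Rightarrow> real set \<Rightarrow> real set \<Rightarrow>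
   ('a \<Rightarrow> complex) \<Rightarrow> ('a \<Rightarrow> complex) \<Rightarrow> 'a \<Rightarrow> ennreal" where
  "biparam_maximal_op m E1 E2 f g x =
     (SUP t1\<in>E1. SUP t2\<in>E2. ennreal (norm (bilinear_mult m t1 t2 f g x)))"


section \<open>Boundedness between Lebesgue spaces\<close>

text \<open>Real powers of extended nonnegative numbers; only used with positive exponents.\<close>

definition ennreal_powr :: "ennreal \<Rightarrow> real \<Rightarrow> ennreal" where
  "ennreal_powr u p = (if u = \<infinity> then \<infinity> else ennreal (enn2real u powr p))"

definition Lp_norm :: "real \<Rightarrow> ('a::euclidean_space \<Rightarrow> ennreal) \<Rightarrow> ennreal" where
  "Lp_norm p u = ennreal_powr (\<integral>\<^sup>+ x. ennreal_powr (u x) p \<partial>lborel) (1 / p)"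

text \<open>Since \<^const>\<open>nn_integral\<close> of a nonmeasurable function is only a lower integral,
  measurability of the output is required explicitly.\<close>

definition bounded_Lp_Lq_Lr ::
  "real \<Rightarrow> real \<Rightarrow> real \<Rightarrow>
   (('a::euclidean_space \<Rightarrow> complex) \<Rightarrow> ('a \<Rightarrow> complex) \<Rightarrow> 'a \<Rightarrow> ennreal) \<Rightarrow> bool" where
  "bounded_Lp_Lq_Lr p q r B \<longleftrightarrow>
     (\<exists>C::real. \<forall>f\<in>test_functions. \<forall>g\<in>test_functions.
        B f g \<in> borel_measurable lborel \<and>
        Lp_norm r (B f g) \<le> ennreal C * Lp_norm p (\<lambda>x. ennreal (norm (f x)))
                                       * Lp_norm q (\<lambda>x. ennreal (norm (g x))))"


section \<open>Upper Minkowski dimension\<close>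

text \<open>Meaningful for bounded \<open>E\<close> and \<open>\<delta> > 0\<close>, when a finite cover exists. The finite set \<open>A\<close>
  consists of the left endpoints of the covering intervals.\<close>

definition covering_number :: "real set \<Rightarrow> real \<Rightarrow> nat" where
  "covering_number E \<delta> = (LEAST n. \<exists>A. finite A \<and> card A = n \<and> E \<subseteq> (\<Union>a\<in>A. {a..a + \<delta>}))"

definition upper_minkowski_dim :: "real set \<Rightarrow> ereal" where
  "upper_minkowski_dim E =
     Limsup (at_right 0) (\<lambda>\<delta>. ereal (ln (real (covering_number E \<delta>)) / ln (1 / \<delta>)))"

end

theory Submission
  imports Defs "HOL-Probability.Characteristic_Functions"
begin

text \<open>Only absolute values of the multiplier matter. By Plancherel and Cauchy-Schwarz, a bilinear
  multiplier of size \<open>(1 + |\<xi>| + |\<eta>|)\<^sup>-\<^sup>b\<close> satisfies the \<open>L\<^sup>2\<close> bound as soon as the transforms of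
  \<open>f\<close> and \<open>g\<close> lie in \<open>L\<^sup>2\<close> with weights \<open>(1 + |\<xi>|)\<^sup>-\<^sup>\<sigma>\<close>, where \<open>\<sigma> > d (1/p - 1/2)\<close> suffices for
  \<open>f \<in> L\<^sup>p\<close>; summing up, one needs \<open>1/p + 1/q < 1/2 + b/d\<close>. The suprema are treated by dyadic chaining:
  an increment of the multiplier in \<open>t\<close> at scale \<open>2\<^sup>-\<^sup>k\<close> gains \<open>min 1 ((1 + |\<xi>| + |\<eta>|) 2\<^sup>-\<^sup>k)\<close>, which is
  at most the \<open>\<theta>\<close>-th power of the second argument for \<open>0 \<le> \<theta> \<le> 1\<close>. The about \<open>2\<^sup>k\<^sup>\<beta>\<close> increments of level
  \<open>k\<close> are square-summed, which is affordable when \<open>\<theta> > \<beta>/2\<close>. Hence \<open>b\<close> may be any number below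
  \<open>a - \<beta>/2\<close>, respectively \<open>a - (\<beta>\<^sub>1 + \<beta>\<^sub>2)/2\<close>.\<close>

text \<open>The 1/2 in the exponent condition comes from the output side. Both frequencies feed the
  single output frequency \<zeta> = \<xi> + \<eta>, so after the shear to (\<xi>, \<zeta>) the
  operator is the transform of an integral over \<xi>. Cauchy-Schwarz in \<xi> at fixed \<zeta> uses
  up a square-integrable weight, that is, slightly more than d/2 of the decay b; what is left is
  divided between f and g. The obstacle is a supremum over an uncountable set inside an L^2 norm.
  The triangle inequality over the levels of a chain is replaced by Cauchy-Schwarz with weights r^k,
  r > 1, so that only squares of increments remain and these can be integrated one by one. If level
  k has about 2^(2 \<gamma> k) cells and each increment gains 2^(-\<theta> k), the loss r^k is
  harmless as soon as r < 2^(2 (\<theta> - \<gamma>)). With two parameters the chains are nested.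
  The gains must multiply over both levels, which requires mixed second differences of the
  multiplier; this is the reason for two derivatives in the second half of the theorem.\<close>

section \<open>Characters and elementary properties of the Fourier transform\<close>

definition echar :: "real \<Rightarrow> complex" where
  "echar s = cis (2 * pi * s)"

lemma norm_echar [simp]: "norm (echar s) = 1"
  by (simp add: echar_def)

lemma echar_add: "echar (s + t) = echar s * echar t"
  by (simp add: echar_def cis_mult algebra_simps)

lemma cnj_echar: "cnj (echar s) = echar (- s)"
  by (simp add: echar_def cis_cnj)

lemma continuous_on_echar [continuous_intros]:
  "continuous_on A f \<Longrightarrow> continuous_on A (\<lambda>x. echar (f x))"
  unfolding echar_def by (intro continuous_intros)

lemma borel_measurable_echar [measurable]:
  "f \<in> borel_measurable M \<Longrightarrow> (\<lambda>x. echar (f x)) \<in> borel_measurable M"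
proof -
  have "echar \<in> borel_measurable borel"
    using continuous_on_echar[OF continuous_on_id] by (auto intro: borel_measurable_continuous_onI)
  then show "f \<in> borel_measurable M \<Longrightarrow> ?thesis"
    by (rule measurable_compose_rev)
qed

lemma borel_measurable_cnj [measurable (raw)]:
  "f \<in> borel_measurable M \<Longrightarrow> (\<lambda>x. cnj (f x)) \<in> borel_measurable M"
  by (rule measurable_compose[of f M borel cnj])
     (auto intro!: borel_measurable_continuous_onI continuous_intros)

lemma fourier_echar: "fourier f \<xi> = (LINT x|lborel. f x * echar (- (x \<bullet> \<xi>)))"
  unfolding fourier_def echar_def cis_conv_exp by (simp add: algebra_simps)

lemma integrable_mult_echar:
  fixes f :: "'a::euclidean_space \<Rightarrow> complex"
  assumes "integrable lborel f" "g \<in> borel_measurable lborel"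
  shows "integrable lborel (\<lambda>x. f x * echar (g x))"
  using assms by (intro Bochner_Integration.integrable_bound[OF assms(1)]) (auto simp: norm_mult)

lemma norm_fourier_le: "norm (fourier f \<xi>) \<le> (LINT x|lborel. norm (f x))"
  unfolding fourier_echar
  by (rule order_trans[OF integral_norm_bound]) (simp add: norm_mult)

lemma borel_measurable_fourier [measurable]:
  assumes [measurable]: "f \<in> borel_measurable borel"
  shows "fourier f \<in> borel_measurable borel"
proof -
  have "(\<lambda>\<xi>. LINT x|lborel. f x * echar (- (x \<bullet> \<xi>))) \<in> borel_measurable lborel"
    by (rule lborel.borel_measurable_lebesgue_integral) measurable
  then show ?thesis by (simp add: fourier_echar[abs_def])
qed

text \<open>True without integrability because the Bochner integral of a non-integrable function is
  0 by convention.\<close>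

lemma norm_integral_le_nn_integral:
  fixes f :: "'x \<Rightarrow> 'b::{banach, second_countable_topology}"
  shows "ennreal (norm (integral\<^sup>L M f)) \<le> (\<integral>\<^sup>+x. ennreal (norm (f x)) \<partial>M)"
  by (cases "integrable M f") (auto simp: integral_norm_bound_ennreal not_integrable_integral_eq)

subsection \<open>Integrals over products\<close>

text \<open>\<open>lborel\<close> is the image of the product of one-dimensional Lebesgue measures
  under the coordinate map, so Fubini for finite products applies. It reduces Gaussian transforms to
  one dimension.\<close>

lemma integrable_lborel_prod:
  fixes f :: "'a::euclidean_space \<Rightarrow> real \<Rightarrow> complex"
  assumes "\<And>b. b \<in> Basis \<Longrightarrow> integrable lborel (f b)"
  shows "integrable lborel (\<lambda>x. \<Prod>b\<in>Basis. f b (x \<bullet> b))"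
    and "(LINT x|lborel. (\<Prod>b\<in>Basis. f b (x \<bullet> b))) = (\<Prod>b\<in>Basis. (LINT x|lborel. f b x))"
proof -
  interpret P: product_sigma_finite "\<lambda>_::'a. lborel :: real measure"
    by (simp add: product_sigma_finite_def lborel.sigma_finite_measure_axioms)
  have [measurable]: "\<And>b. b \<in> Basis \<Longrightarrow> f b \<in> borel_measurable borel"
    using assms borel_measurable_integrable by fastforce
  have eq: "(\<lambda>y. \<Prod>b\<in>Basis. f b ((\<Sum>i\<in>Basis. y i *\<^sub>R i) \<bullet> b)) = (\<lambda>y. \<Prod>b\<in>Basis. f b (y b))"
    by (intro ext prod.cong) auto
  show "integrable lborel (\<lambda>x. \<Prod>b\<in>Basis. f b (x \<bullet> b))"
    by (subst lborel_eq, subst integrable_distr_eq)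
      (auto simp: eq intro!: P.product_integrable_prod assms)
  show "(LINT x|lborel. (\<Prod>b\<in>Basis. f b (x \<bullet> b))) = (\<Prod>b\<in>Basis. (LINT x|lborel. f b x))"
    by (subst lborel_eq, subst integral_distr)
      (auto simp: eq intro!: P.product_integral_prod assms)
qed

lemma integrable_lborel_tensor:
  fixes f :: "'a::euclidean_space \<Rightarrow> complex" and g :: "'b::euclidean_space \<Rightarrow> complex"
  assumes f: "integrable lborel f" and g: "integrable lborel g"
  shows "integrable lborel (\<lambda>z. f (fst z) * g (snd z))"
    and "(LINT z|lborel. f (fst z) * g (snd z)) = (LINT x|lborel. f x) * (LINT y|lborel. g y)"
proof -
  have [measurable]: "f \<in> borel_measurable borel" "g \<in> borel_measurable borel"
    using f g borel_measurable_integrable by fastforce+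
  have "integrable (lborel \<Otimes>\<^sub>M lborel) (\<lambda>(x, y). f x * g y)"
    using f g by (intro lborel_pair.Fubini_integrable) (auto simp: norm_mult)
  then have I: "integrable (lborel \<Otimes>\<^sub>M lborel) (\<lambda>z. f (fst z) * g (snd z))"
    by (simp only: case_prod_unfold)
  then show "integrable lborel (\<lambda>z. f (fst z) * g (snd z))"
    by (simp add: lborel_prod)
  have "(LINT z|(lborel \<Otimes>\<^sub>M lborel). f (fst z) * g (snd z)) = (LINT x|lborel. LINT y|lborel. f x * g y)"
    using lborel_pair.integral_fst'[OF I] by simp
  then show "(LINT z|lborel. f (fst z) * g (snd z)) = (LINT x|lborel. f x) * (LINT y|lborel. g y)"
    by (simp add: lborel_prod)
qed

lemma nn_integral_lborel_translate:
  fixes c :: "'a::euclidean_space"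
  assumes [measurable]: "f \<in> borel_measurable borel"
  shows "(\<integral>\<^sup>+x. f (x + c) \<partial>lborel) = (\<integral>\<^sup>+x. f x \<partial>lborel)"
proof -
  have "(\<integral>\<^sup>+x. f x \<partial>lborel) = (\<integral>\<^sup>+x. f x \<partial>distr lborel borel ((+) c))"
    by (simp only: lborel_distr_plus)
  also have "\<dots> = (\<integral>\<^sup>+x. f (x + c) \<partial>lborel)"
    by (subst nn_integral_distr) (auto simp: add.commute)
  finally show ?thesis by simp
qed

lemma lborel_distr_uminus_euclidean:
  "distr lborel borel uminus = (lborel :: 'a::euclidean_space measure)"
  by (subst lborel_affine[of "-1" 0]) (auto simp: density_1 one_ennreal_def[symmetric])

lemma nn_integral_lborel_uminus:
  fixes f :: "'a::euclidean_space \<Rightarrow> ennreal"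
  assumes [measurable]: "f \<in> borel_measurable borel"
  shows "(\<integral>\<^sup>+x. f (- x) \<partial>lborel) = (\<integral>\<^sup>+x. f x \<partial>lborel)"
proof -
  have "(\<integral>\<^sup>+x. f x \<partial>lborel) = (\<integral>\<^sup>+x. f x \<partial>distr lborel borel uminus)"
    by (simp only: lborel_distr_uminus_euclidean)
  also have "\<dots> = (\<integral>\<^sup>+x. f (- x) \<partial>lborel)"
    by (subst nn_integral_distr) auto
  finally show ?thesis by simp
qed

lemma nn_integral_lborel_fst:
  assumes [measurable]: "f \<in> borel_measurable borel"
  shows "(\<integral>\<^sup>+z. f z \<partial>lborel) = (\<integral>\<^sup>+x. \<integral>\<^sup>+y. f (x, y) \<partial>lborel \<partial>lborel)"
  by (subst lborel_prod[symmetric], rule lborel.nn_integral_fst[symmetric]) (simp add: lborel_prod)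

lemma nn_integral_lborel_snd:
  assumes [measurable]: "f \<in> borel_measurable borel"
  shows "(\<integral>\<^sup>+z. f z \<partial>lborel) = (\<integral>\<^sup>+y. \<integral>\<^sup>+x. f (x, y) \<partial>lborel \<partial>lborel)"
  by (subst lborel_prod[symmetric], rule lborel_pair.nn_integral_snd[symmetric]) (simp add: lborel_prod)

subsection \<open>Plancherel's inequality\<close>

text \<open>After scaling by \<open>s\<close> this is the characteristic function of the standard
  normal distribution. The result is written as a normal density so that its total mass is known to
  be 1.\<close>

lemma fourier_gaussian_real:
  fixes s y :: real
  assumes s: "s > 0"
  shows "integrable lborel (\<lambda>x. of_real (exp (- (s * x)\<^sup>2 / 2)) * echar (- (x * y)))"
    and "(LINT x|lborel. of_real (exp (- (s * x)\<^sup>2 / 2)) * echar (- (x * y)))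
           = complex_of_real (normal_density 0 (s / (2 * pi)) y)"
proof -
  \<comment> \<open>The frequency absorbs the factor 2 pi of the transform convention and the
    scaling x -> s x.\<close>
  define t where "t = - (2 * pi * y / s)"
  define h where "h = (\<lambda>x. std_normal_density x *\<^sub>R iexp (t * x))"
  have hm [measurable]: "h \<in> borel_measurable borel" unfolding h_def by measurable
  have h: "integrable lborel h"
    by (rule Bochner_Integration.integrable_bound[OF integrable_normal_density[of 1 0]])
       (auto simp: h_def)
  have eq: "h (0 + s * x) = (1 / sqrt (2 * pi)) *\<^sub>R (of_real (exp (- (s * x)\<^sup>2 / 2)) * echar (- (x * y)))" for x
    using s unfolding h_def std_normal_density_def t_def echar_def cis_conv_exp
    by (simp add: scaleR_conv_of_real algebra_simps)
  from lborel_integrable_real_affine[OF h, of s 0] s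
  have "integrable lborel (\<lambda>x. (1 / sqrt (2 * pi)) *\<^sub>R (of_real (exp (- (s * x)\<^sup>2 / 2)) * echar (- (x * y))))"
    unfolding eq by simp
  from integrable_scaleR_right[OF this, of "sqrt (2 * pi)"]
  show "integrable lborel (\<lambda>x. of_real (exp (- (s * x)\<^sup>2 / 2)) * echar (- (x * y)))" by simp
  have "(LINT x|lborel. h x) = char std_normal_distribution t"
    unfolding char_def h_def by (subst integral_density) auto
  also have "\<dots> = of_real (exp (- t\<^sup>2 / 2))"
    by (simp add: char_std_normal_distribution)
  finally have 1: "(LINT x|lborel. h x) = of_real (exp (- t\<^sup>2 / 2))" .
  have "(LINT x|lborel. h x) = \<bar>s\<bar> *\<^sub>R (LINT x|lborel. h (0 + s * x))"
    using s by (intro lborel_integral_real_affine) simp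
  then have 2: "of_real (exp (- t\<^sup>2 / 2)) = (s / sqrt (2 * pi)) *\<^sub>R
      (LINT x|lborel. of_real (exp (- (s * x)\<^sup>2 / 2)) * echar (- (x * y)))"
    unfolding eq 1 using s by simp
  have "(LINT x|lborel. of_real (exp (- (s * x)\<^sup>2 / 2)) * echar (- (x * y)))
      = (sqrt (2 * pi) / s) *\<^sub>R complex_of_real (exp (- t\<^sup>2 / 2))"
    unfolding 2 using s by simp
  also have "\<dots> = of_real (sqrt (2 * pi) / s * exp (- t\<^sup>2 / 2))"
    by (simp add: scaleR_conv_of_real)
  also have "sqrt (2 * pi) / s * exp (- t\<^sup>2 / 2) = normal_density 0 (s / (2 * pi)) y"
  proof -
    have "sqrt (2 * pi * (s / (2 * pi))\<^sup>2) = sqrt (2 * pi) * (s / (2 * pi))"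
      using s by (simp add: real_sqrt_mult)
    also have "\<dots> = s / sqrt (2 * pi)"
      by (metis (no_types, opaque_lifting) mult.commute pi_ge_zero real_div_sqrt times_divide_eq_left times_divide_eq_right
          divide_divide_eq_right mult_nonneg_nonneg zero_le_numeral)
    finally show ?thesis
      using s unfolding normal_density_def t_def by (simp add: field_simps power2_eq_square)
  qed
  finally show "(LINT x|lborel. of_real (exp (- (s * x)\<^sup>2 / 2)) * echar (- (x * y)))
           = complex_of_real (normal_density 0 (s / (2 * pi)) y)" .
qed

lemma echar_sum: "finite A \<Longrightarrow> echar (sum f A) = (\<Prod>a\<in>A. echar (f a))"
  by (induction A rule: finite_induct) (auto simp: echar_add, simp add: echar_def)

text \<open>This is exp(- s^2 |x|^2 / 2), kept as a product over coordinates so that its transform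
  factorises.\<close>

definition gauss_weight :: "real \<Rightarrow> 'a::euclidean_space \<Rightarrow> real" where
  "gauss_weight s x = (\<Prod>b\<in>Basis. exp (- (s * (x \<bullet> b))\<^sup>2 / 2))"

text \<open>The Fourier transform of \<open>gauss_weight s\<close>: an even probability
  density.\<close>

definition gauss_kernel :: "real \<Rightarrow> 'a::euclidean_space \<Rightarrow> real" where
  "gauss_kernel s y = (\<Prod>b\<in>Basis. normal_density 0 (s / (2 * pi)) (y \<bullet> b))"

lemma fourier_gauss_weight:
  fixes y :: "'a::euclidean_space"
  assumes s: "s > 0"
  shows "integrable lborel (\<lambda>x. of_real (gauss_weight s x) * echar (- (x \<bullet> y)))"
    and "(LINT x|lborel. of_real (gauss_weight s x) * echar (- (x \<bullet> y))) = complex_of_real (gauss_kernel s y)"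
proof -
  have eq: "of_real (gauss_weight s x) * echar (- (x \<bullet> y)) =
     (\<Prod>b\<in>Basis. (\<lambda>t. of_real (exp (- (s * t)\<^sup>2 / 2)) * echar (- (t * (y \<bullet> b)))) (x \<bullet> b))" for x
    unfolding gauss_weight_def
    by (subst euclidean_inner) (simp add: sum_negf[symmetric] echar_sum prod.distrib)
  show "integrable lborel (\<lambda>x. of_real (gauss_weight s x) * echar (- (x \<bullet> y)))"
    unfolding eq by (rule integrable_lborel_prod(1)) (rule fourier_gaussian_real(1)[OF s])
  show "(LINT x|lborel. of_real (gauss_weight s x) * echar (- (x \<bullet> y))) = complex_of_real (gauss_kernel s y)"
    unfolding eq
    by (subst integrable_lborel_prod(2))
       (use fourier_gaussian_real[OF s] in \<open>auto simp: gauss_kernel_def\<close>)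
qed

lemma gauss_weight_bounds: "0 \<le> gauss_weight s x" "gauss_weight s x \<le> 1"
  by (auto simp: gauss_weight_def intro!: prod_nonneg prod_le_1)

lemma gauss_weight_measurable [measurable]: "gauss_weight s \<in> borel_measurable borel"
  unfolding gauss_weight_def[abs_def] by measurable

lemma gauss_kernel_nonneg: "0 \<le> gauss_kernel s x"
  by (auto simp: gauss_kernel_def intro!: prod_nonneg)

lemma gauss_kernel_measurable [measurable]: "gauss_kernel s \<in> borel_measurable borel"
  unfolding gauss_kernel_def[abs_def] by measurable

lemma gauss_kernel_minus: "gauss_kernel s (- x) = gauss_kernel s x"
  by (simp add: gauss_kernel_def normal_density_def)

lemma nn_integral_gauss_kernel:
  assumes "s > 0"
  shows "(\<integral>\<^sup>+x. ennreal (gauss_kernel s x) \<partial>lborel) = 1"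
proof -
  have 1: "(\<integral>\<^sup>+x. ennreal (normal_density 0 (s / (2 * pi)) x) \<partial>lborel) = 1"
    using assms by (subst nn_integral_eq_integral) auto
  show ?thesis
    unfolding gauss_kernel_def
    by (subst prod_ennreal[symmetric])
       (auto simp: nn_integral_lborel_prod[where f = "\<lambda>_ t. ennreal (normal_density 0 (s / (2 * pi)) t)"] 1)
qed

lemma gauss_weight_tendsto: "(\<lambda>n. gauss_weight (1 / real (Suc n)) x) \<longlonglongrightarrow> 1"
proof -
  have "(\<lambda>n. gauss_weight (1 / real (Suc n)) x) \<longlonglongrightarrow> (\<Prod>b\<in>(Basis::'a set). exp (- (0 * (x \<bullet> b))\<^sup>2 / 2))"
    unfolding gauss_weight_def by (intro tendsto_intros LIMSEQ_Suc[OF lim_1_over_n]) auto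
  then show ?thesis by simp
qed

text \<open>The Gaussian makes the triple integral absolutely convergent. Fubini then turns the left
  side into the quadratic form with kernel \<open>gauss_kernel s (u - v)\<close>, and a kernel that
  is even, nonnegative and of mass 1 has norm at most 1 on L^2.\<close>

lemma weighted_plancherel:
  fixes F :: "'a::euclidean_space \<Rightarrow> complex"
  assumes F: "integrable lborel F" and s: "s > 0"
  shows "(\<integral>\<^sup>+x. ennreal (gauss_weight s x * (norm (fourier F x))\<^sup>2) \<partial>lborel)
           \<le> (\<integral>\<^sup>+x. ennreal ((norm (F x))\<^sup>2) \<partial>lborel)"
proof -
  have Fm [measurable]: "F \<in> borel_measurable borel"
    using F borel_measurable_integrable by fastforce
  define H where "H = (\<lambda>w::'a \<times> 'a. F (fst w) * cnj (F (snd w)))"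
  have Hm [measurable]: "H \<in> borel_measurable (borel \<Otimes>\<^sub>M borel)" unfolding H_def borel_prod[symmetric] by measurable
  have H: "integrable lborel H" unfolding H_def
    by (rule integrable_lborel_tensor(1)) (use F in auto)
  \<comment> \<open>Modulus squared as one integral over pairs (u, v); the two phases merge into one
    character of u - v.\<close>
  have FF: "complex_of_real ((norm (fourier F x))\<^sup>2)
     = (LINT w|lborel. H w * echar (- (x \<bullet> (fst w - snd w))))" for x
  proof -
    have "complex_of_real ((norm (fourier F x))\<^sup>2) = fourier F x * cnj (fourier F x)"
      by (rule complex_norm_square)
    also have "cnj (fourier F x) = (LINT v|lborel. cnj (F v * echar (- (v \<bullet> x))))"
      unfolding fourier_echar by (simp only: Bochner_Integration.integral_cnj)
    also have "fourier F x * \<dots> = (LINT w|lborel. (F (fst w) * echar (- (fst w \<bullet> x))) * cnj (F (snd w) * echar (- (snd w \<bullet> x))))"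
      unfolding fourier_echar
      by (rule integrable_lborel_tensor(2)[symmetric])
         (intro integrable_mult_echar F Bochner_Integration.integrable_cnj; measurable)+
    also have "\<dots> = (LINT w|lborel. H w * echar (- (x \<bullet> (fst w - snd w))))"
      by (intro Bochner_Integration.integral_cong)
         (auto simp: H_def cnj_echar inner_diff_right inner_commute echar_add[of _ "- _", symmetric]
            echar_add algebra_simps)
    finally show ?thesis .
  qed
  have Gi: "integrable lborel (\<lambda>x::'a. complex_of_real (gauss_weight s x))"
    using fourier_gauss_weight(1)[OF s, of 0] by (simp add: echar_def)
  \<comment> \<open>Characters have modulus 1, so the tensor product of the Gaussian with
    \<open>H\<close> is a majorant; this licenses the exchange of integrals below.\<close>
  have I: "integrable (lborel \<Otimes>\<^sub>M lborel)
      (\<lambda>(x, w). of_real (gauss_weight s x) * (H w * echar (- (x \<bullet> (fst w - snd w)))))"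
  proof (rule Bochner_Integration.integrable_bound)
    show "integrable (lborel \<Otimes>\<^sub>M lborel) (\<lambda>z :: 'a \<times> ('a \<times> 'a). complex_of_real (gauss_weight s (fst z)) * H (snd z))"
      using integrable_lborel_tensor(1)[OF Gi H] by (simp add: lborel_prod)
    show "(\<lambda>(x, w). of_real (gauss_weight s x) * (H w * echar (- (x \<bullet> (fst w - snd w)))))
        \<in> borel_measurable (lborel \<Otimes>\<^sub>M lborel)"
      unfolding lborel_prod case_prod_unfold measurable_lborel2 borel_prod[symmetric] by measurable
  qed (auto simp: norm_mult)
  have Fx: "(LINT w|lborel. of_real (gauss_weight s x) * (H w * echar (- (x \<bullet> (fst w - snd w)))))
      = complex_of_real (gauss_weight s x * (norm (fourier F x))\<^sup>2)" for x
    by (subst Bochner_Integration.integral_mult_right_zero) (simp only: FF[symmetric] of_real_mult)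
  have "integrable lborel (\<lambda>x. LINT w|lborel. of_real (gauss_weight s x) * (H w * echar (- (x \<bullet> (fst w - snd w)))))"
    using lborel_pair.integrable_fst[OF I] .
  then have Gabs: "integrable lborel (\<lambda>x. gauss_weight s x * (norm (fourier F x))\<^sup>2)"
    unfolding Fx by (simp only: complex_of_real_integrable_eq)
  have "complex_of_real (LINT x|lborel. gauss_weight s x * (norm (fourier F x))\<^sup>2)
      = (LINT x|lborel. LINT w|lborel. of_real (gauss_weight s x) * (H w * echar (- (x \<bullet> (fst w - snd w)))))"
    unfolding Fx by (simp only: Bochner_Integration.integral_complex_of_real)
  also have "\<dots> = (LINT w|lborel. LINT x|lborel. of_real (gauss_weight s x) * (H w * echar (- (x \<bullet> (fst w - snd w)))))"
    by (rule lborel_pair.Fubini_integral[OF I, symmetric])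
  also have "\<dots> = (LINT w|lborel. H w * of_real (gauss_kernel s (fst w - snd w)))"
  proof (intro Bochner_Integration.integral_cong refl)
    fix w :: "'a \<times> 'a"
    have "(LINT x|lborel. of_real (gauss_weight s x) * (H w * echar (- (x \<bullet> (fst w - snd w)))))
       = (LINT x|lborel. H w * (of_real (gauss_weight s x) * echar (- (x \<bullet> (fst w - snd w)))))"
      by (simp add: mult_ac)
    also have "\<dots> = H w * of_real (gauss_kernel s (fst w - snd w))"
      by (subst integral_mult_right_zero) (simp add: fourier_gauss_weight[OF s])
    finally show "(LINT x|lborel. of_real (gauss_weight s x) * (H w * echar (- (x \<bullet> (fst w - snd w)))))
       = H w * of_real (gauss_kernel s (fst w - snd w))" .
  qed
  finally have eq: "complex_of_real (LINT x|lborel. gauss_weight s x * (norm (fourier F x))\<^sup>2)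
     = (LINT w|lborel. H w * of_real (gauss_kernel s (fst w - snd w)))" .
  have half: "(\<integral>\<^sup>+v. ennreal ((norm (F u))\<^sup>2 / 2 * gauss_kernel s (u - v)) \<partial>lborel) = ennreal ((norm (F u))\<^sup>2 / 2)" for u
  proof -
    have "(\<integral>\<^sup>+v. ennreal (gauss_kernel s (u - v)) \<partial>lborel) = (\<integral>\<^sup>+v. ennreal (gauss_kernel s (v + (- u))) \<partial>lborel)"
      by (metis (no_types) gauss_kernel_minus minus_diff_eq diff_conv_add_uminus)
    also have "\<dots> = 1"
      by (subst nn_integral_lborel_translate) (auto simp: nn_integral_gauss_kernel[OF s])
    finally have 1: "(\<integral>\<^sup>+v. ennreal (gauss_kernel s (u - v)) \<partial>lborel) = 1" .
    have "(\<integral>\<^sup>+v. ennreal ((norm (F u))\<^sup>2 / 2 * gauss_kernel s (u - v)) \<partial>lborel)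
       = (\<integral>\<^sup>+v. ennreal ((norm (F u))\<^sup>2 / 2) * ennreal (gauss_kernel s (u - v)) \<partial>lborel)"
      by (intro nn_integral_cong ennreal_mult) (auto simp: gauss_kernel_nonneg)
    also have "\<dots> = ennreal ((norm (F u))\<^sup>2 / 2)"
      by (subst nn_integral_cmult) (simp_all add: 1)
    finally show ?thesis .
  qed
  have "(\<integral>\<^sup>+x. ennreal (gauss_weight s x * (norm (fourier F x))\<^sup>2) \<partial>lborel)
      = ennreal (LINT x|lborel. gauss_weight s x * (norm (fourier F x))\<^sup>2)"
    using Gabs by (intro nn_integral_eq_integral) (auto simp: gauss_weight_bounds)
  also have "\<dots> \<le> ennreal (norm (LINT w|lborel. H w * of_real (gauss_kernel s (fst w - snd w))))"
    unfolding eq[symmetric] by (intro ennreal_leI) simp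
  also have "\<dots> \<le> (\<integral>\<^sup>+w. ennreal (norm (H w * of_real (gauss_kernel s (fst w - snd w)))) \<partial>lborel)"
    by (rule norm_integral_le_nn_integral)
  \<comment> \<open>The Schur test in its simplest form, a b \<le> a^2/2 + b^2/2. In the second
    summand the kernel argument is reversed, so that \<open>half\<close> integrates out the other
    variable in both summands.\<close>
  also have "\<dots> \<le> (\<integral>\<^sup>+w. ennreal ((norm (F (fst w)))\<^sup>2 / 2 * gauss_kernel s (fst w - snd w))
                     + ennreal ((norm (F (snd w)))\<^sup>2 / 2 * gauss_kernel s (snd w - fst w)) \<partial>lborel)"
  proof (intro nn_integral_mono)
    fix w :: "'a \<times> 'a"
    have k: "gauss_kernel s (snd w - fst w) = gauss_kernel s (fst w - snd w)"
      by (metis gauss_kernel_minus minus_diff_eq)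
    have "norm (F (fst w)) * norm (F (snd w)) \<le> (norm (F (fst w)))\<^sup>2 / 2 + (norm (F (snd w)))\<^sup>2 / 2"
      using sum_squares_bound[of "norm (F (fst w))" "norm (F (snd w))"] by simp
    from mult_right_mono[OF this gauss_kernel_nonneg[of s "fst w - snd w"]]
    show "ennreal (norm (H w * of_real (gauss_kernel s (fst w - snd w))))
       \<le> ennreal ((norm (F (fst w)))\<^sup>2 / 2 * gauss_kernel s (fst w - snd w))
          + ennreal ((norm (F (snd w)))\<^sup>2 / 2 * gauss_kernel s (snd w - fst w))"
      unfolding k
      by (subst ennreal_plus[symmetric])
         (simp_all add: gauss_kernel_nonneg H_def norm_mult distrib_right ennreal_leI del: ennreal_plus)
  qed
  also have "\<dots> = (\<integral>\<^sup>+w. ennreal ((norm (F (fst w)))\<^sup>2 / 2 * gauss_kernel s (fst w - snd w)) \<partial>lborel)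
      + (\<integral>\<^sup>+w. ennreal ((norm (F (snd w)))\<^sup>2 / 2 * gauss_kernel s (snd w - fst w)) \<partial>lborel)"
    by (rule nn_integral_add) (simp_all add: borel_prod[symmetric])
  also have "(\<integral>\<^sup>+w. ennreal ((norm (F (fst w)))\<^sup>2 / 2 * gauss_kernel s (fst w - snd w)) \<partial>lborel)
      = (\<integral>\<^sup>+u. ennreal ((norm (F u))\<^sup>2 / 2) \<partial>lborel)"
    by (subst nn_integral_lborel_fst; (simp only: fst_conv snd_conv half)?) (simp add: borel_prod[symmetric])
  also have "(\<integral>\<^sup>+w. ennreal ((norm (F (snd w)))\<^sup>2 / 2 * gauss_kernel s (snd w - fst w)) \<partial>lborel)
      = (\<integral>\<^sup>+u. ennreal ((norm (F u))\<^sup>2 / 2) \<partial>lborel)"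
    by (subst nn_integral_lborel_snd; (simp only: fst_conv snd_conv half)?) (simp add: borel_prod[symmetric])
  also have "(\<integral>\<^sup>+u. ennreal ((norm (F u))\<^sup>2 / 2) \<partial>lborel) + (\<integral>\<^sup>+u. ennreal ((norm (F u))\<^sup>2 / 2) \<partial>lborel)
      = (\<integral>\<^sup>+u. ennreal ((norm (F u))\<^sup>2 / 2) + ennreal ((norm (F u))\<^sup>2 / 2) \<partial>lborel)"
    by (rule nn_integral_add[symmetric]) auto
  also have "\<dots> = (\<integral>\<^sup>+x. ennreal ((norm (F x))\<^sup>2) \<partial>lborel)"
    by (subst ennreal_plus[symmetric]) (simp_all del: ennreal_plus)
  finally show ?thesis .
qed

text \<open>Fatou along s = 1/(n+1), where the Gaussian weight tends to 1 pointwise. The right side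
  may be infinite. The inequality suffices because every later use is an upper bound.\<close>

theorem plancherel_le:
  fixes F :: "'a::euclidean_space \<Rightarrow> complex"
  assumes F: "integrable lborel F"
  shows "(\<integral>\<^sup>+x. ennreal ((norm (fourier F x))\<^sup>2) \<partial>lborel) \<le> (\<integral>\<^sup>+x. ennreal ((norm (F x))\<^sup>2) \<partial>lborel)"
proof -
  have Fm [measurable]: "F \<in> borel_measurable borel"
    using F borel_measurable_integrable by fastforce
  have lim: "(\<lambda>n. ennreal (gauss_weight (1 / real (Suc n)) x * (norm (fourier F x))\<^sup>2))
      \<longlonglongrightarrow> ennreal ((norm (fourier F x))\<^sup>2)" for x
    using tendsto_mult[OF gauss_weight_tendsto[of x] tendsto_const[of "(norm (fourier F x))\<^sup>2"]]
    by (intro tendsto_ennrealI) simp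
  have "(\<integral>\<^sup>+x. ennreal ((norm (fourier F x))\<^sup>2) \<partial>lborel)
     = (\<integral>\<^sup>+x. liminf (\<lambda>n. ennreal (gauss_weight (1 / real (Suc n)) x * (norm (fourier F x))\<^sup>2)) \<partial>lborel)"
    by (intro nn_integral_cong lim_imp_Liminf[symmetric] lim) simp
  also have "\<dots> \<le> liminf (\<lambda>n. \<integral>\<^sup>+x. ennreal (gauss_weight (1 / real (Suc n)) x * (norm (fourier F x))\<^sup>2) \<partial>lborel)"
    by (rule nn_integral_liminf) simp
  also have "\<dots> \<le> liminf (\<lambda>n. \<integral>\<^sup>+x. ennreal ((norm (F x))\<^sup>2) \<partial>lborel)"
    by (intro Liminf_mono always_eventually allI weighted_plancherel[OF F]) simp
  also have "\<dots> = (\<integral>\<^sup>+x. ennreal ((norm (F x))\<^sup>2) \<partial>lborel)"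
    by (simp add: Liminf_const)
  finally show ?thesis .
qed

subsection \<open>Weighted estimates for Fourier transforms\<close>

lemma nn_integral_weight_real:
  fixes r :: real
  assumes "r > 1"
  shows "(\<integral>\<^sup>+t. ennreal ((1 + \<bar>t\<bar>) powr (- r)) \<partial>lborel) < \<infinity>"
proof -
  define F where "F = (\<lambda>t::real. (1 + t) powr (1 - r) / (1 - r))"
  have "(\<integral>\<^sup>+t. ennreal ((1 + \<bar>t\<bar>) powr (- r)) * indicator {0..} t \<partial>lborel) = ennreal (0 - F 0)"
  proof (rule nn_integral_FTC_atLeast)
    show "(F has_real_derivative (1 + \<bar>x\<bar>) powr (- r)) (at x)" if "0 \<le> x" for x
      unfolding F_def using that assms
      by (auto intro!: derivative_eq_intros)
    show "(F \<longlongrightarrow> 0) at_top"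
    proof -
      have "((\<lambda>t::real. (1 + t) powr (1 - r)) \<longlongrightarrow> 0) at_top"
        using assms by (intro tendsto_neg_powr filterlim_tendsto_add_at_top[OF tendsto_const] filterlim_ident) auto
      from tendsto_divide[OF this tendsto_const[of "1 - r"]] assms
      show ?thesis unfolding F_def by simp
    qed
  qed auto
  then have fin: "(\<integral>\<^sup>+t. ennreal ((1 + \<bar>t\<bar>) powr (- r)) * indicator {0..} t \<partial>lborel) < \<infinity>"
    by simp
  have "(\<integral>\<^sup>+t. ennreal ((1 + \<bar>t\<bar>) powr (- r)) * indicator {0..} (- t) \<partial>lborel)
      = (\<integral>\<^sup>+t. (\<lambda>t. ennreal ((1 + \<bar>t\<bar>) powr (- r)) * indicator {0..} t) (- t) \<partial>lborel)"
    by simp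
  also have "\<dots> = (\<integral>\<^sup>+t. ennreal ((1 + \<bar>t\<bar>) powr (- r)) * indicator {0..} t \<partial>lborel)"
    by (rule nn_integral_lborel_uminus) simp
  finally have fin': "(\<integral>\<^sup>+t. ennreal ((1 + \<bar>t\<bar>) powr (- r)) * indicator {0..} (- t) \<partial>lborel) < \<infinity>"
    using fin by simp
  have "(\<integral>\<^sup>+t. ennreal ((1 + \<bar>t\<bar>) powr (- r)) \<partial>lborel)
      \<le> (\<integral>\<^sup>+t. ennreal ((1 + \<bar>t\<bar>) powr (- r)) * indicator {0..} t
           + ennreal ((1 + \<bar>t\<bar>) powr (- r)) * indicator {0..} (- t) \<partial>lborel)"
    by (intro nn_integral_mono) (auto split: split_indicator)
  also have "\<dots> < \<infinity>"
    using fin fin' by (subst nn_integral_add) auto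
  finally show ?thesis .
qed

text \<open>Each coordinate satisfies 1 + |x_b| \<le> 1 + |x|, so giving every coordinate the equal
  share s/d > 1 of the exponent bounds the weight by a product of integrable functions of one
  variable.\<close>

lemma nn_integral_weight:
  fixes s :: real
  assumes "s > DIM('a::euclidean_space)"
  shows "(\<integral>\<^sup>+x. ennreal ((1 + norm (x::'a)) powr (- s)) \<partial>lborel) < \<infinity>"
proof -
  define r where "r = s / DIM('a)"
  have d: "real DIM('a) > 0" by simp
  have r: "r > 1" using assms d by (simp add: r_def field_simps)
  have s: "s > 0" using assms d by linarith
  have "(\<integral>\<^sup>+x. ennreal ((1 + norm (x::'a)) powr (- s)) \<partial>lborel)
     \<le> (\<integral>\<^sup>+x. (\<Prod>b\<in>Basis. ennreal ((1 + \<bar>(x::'a) \<bullet> b\<bar>) powr (- r))) \<partial>lborel)"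
  proof (intro nn_integral_mono)
    fix x :: 'a
    have "(1 + norm x) powr (- s) = (\<Prod>b\<in>(Basis::'a set). (1 + norm x) powr (- r))"
    proof -
      have "real DIM('a) * r = s" by (simp add: r_def)
      moreover have "1 + norm x > 0" by (simp add: add_pos_nonneg)
      ultimately show ?thesis by (simp add: powr_power)
    qed
    also have "\<dots> \<le> (\<Prod>b\<in>(Basis::'a set). (1 + \<bar>x \<bullet> b\<bar>) powr (- r))"
      using r by (intro prod_mono) (auto intro!: powr_mono2' Basis_le_norm)
    finally show "ennreal ((1 + norm x) powr (- s)) \<le> (\<Prod>b\<in>Basis. ennreal ((1 + \<bar>x \<bullet> b\<bar>) powr (- r)))"
      by (subst prod_ennreal) (auto intro!: ennreal_leI)
  qed
  also have "\<dots> = (\<Prod>b\<in>(Basis::'a set). (\<integral>\<^sup>+t. ennreal ((1 + \<bar>t\<bar>) powr (- r)) \<partial>lborel))"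
    by (rule nn_integral_lborel_prod) auto
  also have "\<dots> < \<infinity>"
    using nn_integral_weight_real[OF r] by (auto simp: power_less_top_ennreal)
  finally show ?thesis .
qed

lemma borel_measurable_indicator_cball [measurable]:
  fixes x :: "'a::euclidean_space"
  shows "indicator (cball x r) \<in> borel_measurable borel"
  by (intro borel_measurable_indicator) simp

lemma fourier_add:
  assumes "integrable lborel f" "integrable lborel g"
  shows "fourier (\<lambda>x. f x + g x) \<xi> = fourier f \<xi> + fourier g \<xi>"
  unfolding fourier_echar distrib_right
  by (intro Bochner_Integration.integral_add integrable_mult_echar assms) measurable

text \<open>The function is split at the height \<open>l\<close> with \<open>l powr p = A * R powr d\<close>: the transform of
  the large part is bounded pointwise and integrated over the ball, the small part is handled by
  Plancherel. This replaces the Hausdorff-Young inequality.\<close>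

lemma fourier_L2_ball:
  fixes f :: "'a::euclidean_space \<Rightarrow> complex"
  assumes f: "integrable lborel f" and fp: "integrable lborel (\<lambda>x. norm (f x) powr p)"
    and p: "1 \<le> p" "p \<le> 2" and R: "R > 0"
  defines "A \<equiv> (LINT x|lborel. norm (f x) powr p)" and "c \<equiv> unit_ball_vol (real DIM('a))"
  shows "(\<integral>\<^sup>+\<xi>. ennreal ((norm (fourier f \<xi>))\<^sup>2) * indicator (cball 0 R) \<xi> \<partial>lborel)
     \<le> ennreal (2 * (c + 1) * A powr (2 / p) * R powr (DIM('a) * (2 / p - 1)))"
proof (cases "A = 0")
  \<comment> \<open>Here the splitting height would be 0; \<open>f\<close> vanishes almost
    everywhere and so does its transform.\<close>
  case True
  have "AE x in lborel. norm (f x) powr p = 0"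
    using True fp unfolding A_def by (subst (asm) integral_nonneg_eq_0_iff_AE) auto
  then have "AE x in lborel. f x = 0" by simp
  then have "(LINT x|lborel. f x * echar (- (x \<bullet> \<xi>))) = 0" for \<xi>
    by (intro integral_eq_zero_AE) auto
  then show ?thesis by (simp add: fourier_echar)
next
  case False
  have fm [measurable]: "f \<in> borel_measurable borel"
    using f borel_measurable_integrable by fastforce
  have A: "A > 0" using False unfolding A_def by (simp add: less_le)
  define d where "d = real DIM('a)"
  have c: "c \<ge> 0" unfolding c_def by simp
  define l where "l = (A * R powr d) powr (1 / p)"
  have l: "l > 0" using A R by (simp add: l_def)
  have lp: "l powr p = A * R powr d" using p A R by (simp add: l_def powr_powr)
  define f1 where "f1 = (\<lambda>x. if norm (f x) > l then f x else 0)"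
  define f2 where "f2 = (\<lambda>x. if norm (f x) > l then 0 else f x)"
  have [measurable]: "f1 \<in> borel_measurable borel" "f2 \<in> borel_measurable borel"
    unfolding f1_def f2_def by measurable
  have f1: "integrable lborel f1"
    by (rule Bochner_Integration.integrable_bound[OF f]) (auto simp: f1_def)
  have f2: "integrable lborel f2"
    by (rule Bochner_Integration.integrable_bound[OF f]) (auto simp: f2_def)
  have sum: "fourier f \<xi> = fourier f1 \<xi> + fourier f2 \<xi>" for \<xi>
    by (subst fourier_add[OF f1 f2, symmetric]) (auto simp: f1_def f2_def intro!: arg_cong[of _ _ "\<lambda>f. fourier f \<xi>"])
  \<comment> \<open>Bound for the squared L^2 norm of the small part, where |f|^2 \<le> l^(2-p)
    |f|^p.\<close>
  define D where "D = l powr (2 - p) * A"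
  have D: "D \<ge> 0" using A by (simp add: D_def)
  have Deq: "D = A powr (2 / p) * R powr (DIM('a) * (2 / p - 1))"
  proof -
    have "l powr (2 - p) = (A * R powr d) powr (2 / p - 1)"
      using p unfolding l_def by (simp add: powr_powr field_simps)
    also have "\<dots> = A powr (2 / p - 1) * R powr (d * (2 / p - 1))"
      using A R by (simp add: powr_mult powr_powr)
    finally show ?thesis
      using A by (simp add: D_def d_def powr_diff)
  qed
  have N1: "(LINT x|lborel. norm (f1 x)) \<le> l powr (1 - p) * A"
  proof -
    have "norm (f1 x) \<le> l powr (1 - p) * norm (f x) powr p" for x
    proof (cases "norm (f x) > l")
      case True
      then have "norm (f x) = norm (f x) powr (1 - p) * norm (f x) powr p"
        using l by (simp add: powr_add[symmetric])
      also have "\<dots> \<le> l powr (1 - p) * norm (f x) powr p"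
        using True l p by (intro mult_right_mono powr_mono2') auto
      finally show ?thesis using True by (simp add: f1_def)
    qed (simp add: f1_def)
    then have "(LINT x|lborel. norm (f1 x)) \<le> (LINT x|lborel. l powr (1 - p) * norm (f x) powr p)"
      using f1 fp by (intro integral_mono) auto
    then show ?thesis by (simp add: A_def)
  qed
  have N2: "(\<integral>\<^sup>+x. ennreal ((norm (fourier f2 x))\<^sup>2) \<partial>lborel) \<le> ennreal D"
  proof -
    have "(norm (f2 x))\<^sup>2 \<le> l powr (2 - p) * norm (f x) powr p" for x
    proof (cases "norm (f x) > l \<or> f x = 0")
      case False
      then have "(norm (f x))\<^sup>2 = norm (f x) powr (2 - p) * norm (f x) powr p"
        by (simp add: powr_add[symmetric] powr_numeral)
      also have "\<dots> \<le> l powr (2 - p) * norm (f x) powr p"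
        using False p by (intro mult_right_mono powr_mono2) auto
      finally show ?thesis using False by (simp add: f2_def)
    qed (auto simp: f2_def)
    then have "(\<integral>\<^sup>+x. ennreal ((norm (f2 x))\<^sup>2) \<partial>lborel)
        \<le> (\<integral>\<^sup>+x. ennreal (l powr (2 - p) * norm (f x) powr p) \<partial>lborel)"
      by (intro nn_integral_mono ennreal_leI)
    also have "\<dots> = ennreal (LINT x|lborel. l powr (2 - p) * norm (f x) powr p)"
      using fp by (intro nn_integral_eq_integral) auto
    also have "\<dots> = ennreal D" by (simp add: A_def D_def)
    finally show ?thesis using plancherel_le[OF f2] by (rule order_trans[rotated])
  qed
  \<comment> \<open>This identity is the reason for the choice of \<open>l\<close>: up to the volume
    constant the large part, integrated over the ball, contributes exactly as much as the small
    part.\<close>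
  have N1': "(l powr (1 - p) * A)\<^sup>2 * R powr d = D"
  proof -
    have "(l powr (1 - p) * A)\<^sup>2 * R powr d = l powr (2 * (1 - p)) * A * (A * R powr d)"
      by (simp add: power_mult_distrib powr_power power2_eq_square mult_ac powr_add[symmetric])
    also have "\<dots> = l powr (2 * (1 - p)) * l powr p * A" by (simp add: lp)
    also have "\<dots> = D" by (simp add: D_def powr_add[symmetric])
    finally show ?thesis .
  qed
  have "(\<integral>\<^sup>+\<xi>. ennreal ((norm (fourier f \<xi>))\<^sup>2) * indicator (cball 0 R) \<xi> \<partial>lborel)
     \<le> (\<integral>\<^sup>+\<xi>. ennreal (2 * (l powr (1 - p) * A)\<^sup>2) * indicator (cball 0 R) \<xi>
            + 2 * ennreal ((norm (fourier f2 \<xi>))\<^sup>2) \<partial>lborel)"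
  proof (intro nn_integral_mono)
    fix \<xi> :: 'a
    have "(norm (fourier f \<xi>))\<^sup>2 \<le> (norm (fourier f1 \<xi>) + norm (fourier f2 \<xi>))\<^sup>2"
      unfolding sum by (intro power_mono norm_triangle_ineq) auto
    also have "\<dots> \<le> 2 * (norm (fourier f1 \<xi>))\<^sup>2 + 2 * (norm (fourier f2 \<xi>))\<^sup>2"
      using sum_squares_bound[of "norm (fourier f1 \<xi>)" "norm (fourier f2 \<xi>)"]
      by (simp add: power2_sum)
    also have "(norm (fourier f1 \<xi>))\<^sup>2 \<le> (l powr (1 - p) * A)\<^sup>2"
      using order_trans[OF norm_fourier_le N1] by (intro power_mono) auto
    finally have "ennreal ((norm (fourier f \<xi>))\<^sup>2)
        \<le> ennreal (2 * (l powr (1 - p) * A)\<^sup>2 + 2 * (norm (fourier f2 \<xi>))\<^sup>2)"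
      by (intro ennreal_leI) simp
    also have "\<dots> = ennreal (2 * (l powr (1 - p) * A)\<^sup>2) + 2 * ennreal ((norm (fourier f2 \<xi>))\<^sup>2)"
      by (subst ennreal_plus) (auto simp: ennreal_mult)
    finally show "ennreal ((norm (fourier f \<xi>))\<^sup>2) * indicator (cball 0 R) \<xi>
       \<le> ennreal (2 * (l powr (1 - p) * A)\<^sup>2) * indicator (cball 0 R) \<xi>
            + 2 * ennreal ((norm (fourier f2 \<xi>))\<^sup>2)"
      by (auto split: split_indicator)
  qed
  also have "\<dots> = (\<integral>\<^sup>+\<xi>. ennreal (2 * (l powr (1 - p) * A)\<^sup>2) * indicator (cball (0::'a) R) \<xi> \<partial>lborel)
      + (\<integral>\<^sup>+\<xi>. 2 * ennreal ((norm (fourier f2 \<xi>))\<^sup>2) \<partial>lborel)"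
    by (rule nn_integral_add) measurable
  also have "(\<integral>\<^sup>+\<xi>. 2 * ennreal ((norm (fourier f2 \<xi>))\<^sup>2) \<partial>lborel)
      = 2 * (\<integral>\<^sup>+\<xi>. ennreal ((norm (fourier f2 \<xi>))\<^sup>2) \<partial>lborel)"
    by (rule nn_integral_cmult) measurable
  also have "(\<integral>\<^sup>+\<xi>. ennreal (2 * (l powr (1 - p) * A)\<^sup>2) * indicator (cball (0::'a) R) \<xi> \<partial>lborel)
      = ennreal (2 * (l powr (1 - p) * A)\<^sup>2) * emeasure lborel (cball (0::'a) R)"
    by (rule nn_integral_cmult_indicator) simp
  also have "emeasure lborel (cball (0::'a) R) = ennreal (c * R powr d)"
    using R by (simp add: emeasure_cball c_def d_def powr_realpow)
  also have "ennreal (2 * (l powr (1 - p) * A)\<^sup>2) * ennreal (c * R powr d) = ennreal (2 * c * D)"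
    unfolding N1'[symmetric] using c R by (subst ennreal_mult[symmetric]) (auto simp: mult_ac)
  also have "ennreal (2 * c * D) + 2 * (\<integral>\<^sup>+\<xi>. ennreal ((norm (fourier f2 \<xi>))\<^sup>2) \<partial>lborel)
      \<le> ennreal (2 * c * D) + 2 * ennreal D"
    by (intro add_left_mono mult_left_mono N2) auto
  also have "\<dots> = ennreal (2 * (c + 1) * D)"
    using c D by (subst ennreal_numeral[symmetric], subst ennreal_mult[symmetric], simp, simp,
      subst ennreal_plus[symmetric]) (auto simp: algebra_simps simp del: ennreal_plus)
  finally show ?thesis unfolding Deq by (simp add: mult_ac)
qed

text \<open>Decompose dyadically in 1 + |\<xi>|. The shell of index j costs at most the ball
  estimate at radius 2^(j+1), growing like 2^(e j), while the squared weight gains 2^(-2 \<sigma>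
  j); the condition on \<sigma> says e < 2 \<sigma>, so the series is geometric.\<close>

lemma fourier_weighted_L2:
  fixes p \<sigma> :: real
  assumes p: "1 \<le> p" "p \<le> 2" and \<sigma>: "\<sigma> > DIM('a::euclidean_space) * (1 / p - 1 / 2)"
  obtains C where "C \<ge> 0" and
    "\<And>f :: 'a \<Rightarrow> complex. integrable lborel f \<Longrightarrow> integrable lborel (\<lambda>x. norm (f x) powr p) \<Longrightarrow>
       (\<integral>\<^sup>+\<xi>. ennreal ((norm (fourier f \<xi>) * (1 + norm \<xi>) powr (- \<sigma>))\<^sup>2) \<partial>lborel)
         \<le> ennreal (C * (LINT x|lborel. norm (f x) powr p) powr (2 / p))"
proof -
  define d where "d = real DIM('a)"
  define e where "e = d * (2 / p - 1)"
  have e: "e \<ge> 0" using p by (simp add: e_def d_def field_simps)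
  have "e = 2 * (d * (1 / p - 1 / 2))" by (simp add: e_def algebra_simps)
  with \<sigma> have es: "e < 2 * \<sigma>" unfolding d_def by linarith
  have \<sigma>0: "\<sigma> > 0" using e es by linarith
  \<comment> \<open>The constant of \<open>fourier_L2_ball\<close>, times 2^e because the shell of
    index j lies in the ball of radius 2^(j+1).\<close>
  define c where "c = 2 * (unit_ball_vol (real DIM('a)) + 1) * 2 powr e"
  have c: "c \<ge> 0" unfolding c_def by simp
  define q where "q = 2 powr (e - 2 * \<sigma>)"
  have q: "0 < q" "q < 1"
    using es powr_less_mono[of "e - 2 * \<sigma>" 0 2] by (auto simp: q_def)
  have "(\<integral>\<^sup>+\<xi>. ennreal ((norm (fourier f \<xi>) * (1 + norm \<xi>) powr (- \<sigma>))\<^sup>2) \<partial>lborel)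
         \<le> ennreal (c * (1 / (1 - q)) * (LINT x|lborel. norm (f x) powr p) powr (2 / p))"
    if f: "integrable lborel f" and fp: "integrable lborel (\<lambda>x. norm (f x) powr p)"
    for f :: "'a \<Rightarrow> complex"
  proof -
    have fm [measurable]: "f \<in> borel_measurable borel"
      using f borel_measurable_integrable by fastforce
    define A where "A = (LINT x|lborel. norm (f x) powr p) powr (2 / p)"
    have A: "A \<ge> 0" by (simp add: A_def)
    \<comment> \<open>A whole ball instead of a shell: it only increases the sum, and the ball
      estimate applies directly.\<close>
    define g where "g = (\<lambda>j \<xi>. ennreal ((2 powr j) powr (- 2 * \<sigma>)) * (ennreal ((norm (fourier f \<xi>))\<^sup>2) * indicator (cball 0 (2 powr (real j + 1))) \<xi>))"
    have "(\<integral>\<^sup>+\<xi>. ennreal ((norm (fourier f \<xi>) * (1 + norm \<xi>) powr (- \<sigma>))\<^sup>2) \<partial>lborel)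
        \<le> (\<integral>\<^sup>+\<xi>. (\<Sum>j. g j \<xi>) \<partial>lborel)"
    proof (intro nn_integral_mono)
      fix \<xi> :: 'a
      define j where "j = nat \<lfloor>log 2 (1 + norm \<xi>)\<rfloor>"
      have w: "1 + norm \<xi> > 0" by (simp add: add_pos_nonneg)
      have lg: "log 2 (1 + norm \<xi>) \<ge> 0" using w by (subst zero_le_log_cancel_iff) auto
      have j: "real j \<le> log 2 (1 + norm \<xi>)" "log 2 (1 + norm \<xi>) < real j + 1"
        using lg unfolding j_def by linarith+
      have j1: "2 powr real j \<le> 1 + norm \<xi>" using j(1) w by (simp add: le_log_iff)
      have j2: "1 + norm \<xi> < 2 powr (real j + 1)" using j(2) w by (simp add: log_less_iff)
      have "(1 + norm \<xi>) powr (- 2 * \<sigma>) \<le> (2 powr j) powr (- 2 * \<sigma>)"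
        using j1 \<sigma>0 by (intro powr_mono2') auto
      moreover have "((1 + norm \<xi>) powr (- \<sigma>))\<^sup>2 = (1 + norm \<xi>) powr (- 2 * \<sigma>)"
        using w by (simp add: powr_power mult.commute)
      ultimately have "ennreal ((norm (fourier f \<xi>) * (1 + norm \<xi>) powr (- \<sigma>))\<^sup>2)
          \<le> ennreal ((2 powr j) powr (- 2 * \<sigma>) * (norm (fourier f \<xi>))\<^sup>2)"
        by (intro ennreal_leI) (simp add: power_mult_distrib mult.commute mult_left_mono)
      also have "\<dots> = g j \<xi>"
        using j2 by (simp add: g_def ennreal_mult)
      also have "\<dots> \<le> (\<Sum>j. g j \<xi>)"
        using sum_le_suminf[of "\<lambda>j. g j \<xi>" "{j}"] by simp
      finally show "ennreal ((norm (fourier f \<xi>) * (1 + norm \<xi>) powr (- \<sigma>))\<^sup>2) \<le> (\<Sum>j. g j \<xi>)" .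
    qed
    also have "\<dots> = (\<Sum>j. \<integral>\<^sup>+\<xi>. g j \<xi> \<partial>lborel)"
      unfolding g_def by (rule nn_integral_suminf) measurable
    also have "\<dots> \<le> (\<Sum>j. ennreal (c * A * q ^ j))"
    proof (intro suminf_le)
      fix j :: nat
      have "(\<integral>\<^sup>+\<xi>. g j \<xi> \<partial>lborel) = ennreal ((2 powr j) powr (- 2 * \<sigma>)) *
          (\<integral>\<^sup>+\<xi>. (ennreal ((norm (fourier f \<xi>))\<^sup>2) * indicator (cball 0 (2 powr (real j + 1))) \<xi>) \<partial>lborel)"
        unfolding g_def by (rule nn_integral_cmult) measurable
      also have "\<dots> \<le> ennreal ((2 powr j) powr (- 2 * \<sigma>)) *
          ennreal (2 * (unit_ball_vol (real DIM('a)) + 1) * A * (2 powr (real j + 1)) powr (DIM('a) * (2 / p - 1)))"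
        unfolding A_def by (intro mult_left_mono fourier_L2_ball f fp p) auto
      also have "\<dots> = ennreal ((2 powr j) powr (- 2 * \<sigma>) * (2 * (unit_ball_vol (real DIM('a)) + 1) * A * (2 powr (real j + 1)) powr e))"
        unfolding e_def d_def by (rule ennreal_mult[symmetric]) (auto simp: A)
      also have "(2 powr j) powr (- 2 * \<sigma>) * (2 * (unit_ball_vol (real DIM('a)) + 1) * A * (2 powr (real j + 1)) powr e) = c * A * q ^ j"
      proof -
        have "(2 powr real j) powr (- 2 * \<sigma>) * (2 powr (real j + 1)) powr e = 2 powr e * q ^ j"
          by (simp add: q_def powr_powr powr_power powr_add[symmetric] algebra_simps)
        then show ?thesis by (simp add: c_def)
      qed
      finally show "(\<integral>\<^sup>+\<xi>. g j \<xi> \<partial>lborel) \<le> ennreal (c * A * q ^ j)" .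
    qed auto
    also have "\<dots> = ennreal (\<Sum>j. c * A * q ^ j)"
      using c A q by (intro suminf_ennreal2) (auto intro!: summable_mult)
    also have "(\<Sum>j. c * A * q ^ j) = c * (1 / (1 - q)) * A"
      using q by (subst suminf_mult) (auto simp: suminf_geometric)
    finally show ?thesis by (simp add: A_def)
  qed
  moreover have "c * (1 / (1 - q)) \<ge> 0" using c q by simp
  ultimately show ?thesis using that by blast
qed

subsection \<open>The bilinear multiplier estimate\<close>

text \<open>Takes the two transforms and an arbitrary multiplier, because the increments met in
  chaining are not dilates of a single symbol.\<close>

definition bilinear_op ::
  "('a::euclidean_space \<times> 'a \<Rightarrow> complex) \<Rightarrow> ('a \<Rightarrow> complex) \<Rightarrow> ('a \<Rightarrow> complex) \<Rightarrow> 'a \<Rightarrow> complex" where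
  "bilinear_op M F G x = (LINT z|lborel. F (fst z) * G (snd z) * M z * echar (x \<bullet> (fst z + snd z)))"

lemma bilinear_mult_eq:
  "bilinear_mult m t1 t2 f g x =
     bilinear_op (\<lambda>z. m (t1 *\<^sub>R fst z, t2 *\<^sub>R snd z)) (fourier f) (fourier g) x"
  unfolding bilinear_mult_def bilinear_op_def echar_def cis_conv_exp
  by (simp add: case_prod_unfold algebra_simps)

text \<open>On each slice with fixed first component the shear is a translation.\<close>

lemma lborel_distr_shear:
  "distr lborel borel (\<lambda>z. (fst z, fst z + snd z)) = (lborel :: ('a::euclidean_space \<times> 'a) measure)"
proof (rule measure_eqI)
  have T [measurable]: "(\<lambda>z::'a \<times> 'a. (fst z, fst z + snd z)) \<in> borel \<rightarrow>\<^sub>M borel"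
    by (intro borel_measurable_continuous_onI continuous_intros)
  fix A :: "('a \<times> 'a) set"
  assume "A \<in> sets (distr lborel borel (\<lambda>z. (fst z, fst z + snd z)))"
  then have A [measurable]: "A \<in> sets borel" by simp
  have Am: "indicator A \<in> borel_measurable (borel :: ('a \<times> 'a) measure)" by measurable
  have "emeasure (distr lborel borel (\<lambda>z. (fst z, fst z + snd z))) A
      = (\<integral>\<^sup>+z. indicator A z \<partial>distr lborel borel (\<lambda>z::'a \<times> 'a. (fst z, fst z + snd z)))"
    by simp
  also have "\<dots> = (\<integral>\<^sup>+z. indicator A (fst z, fst z + snd z) \<partial>lborel)"
    by (subst nn_integral_distr) auto
  also have "\<dots> = (\<integral>\<^sup>+x. \<integral>\<^sup>+y. indicator A (x, y + x) \<partial>lborel \<partial>lborel)"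
    by (subst nn_integral_lborel_fst) (auto simp: add.commute intro!: measurable_compose[OF T Am])
  also have "\<dots> = (\<integral>\<^sup>+x. \<integral>\<^sup>+y. indicator A (x, y) \<partial>lborel \<partial>lborel)"
  proof (rule nn_integral_cong)
    fix x :: 'a
    have "(\<lambda>y. indicator A (x, y) :: ennreal) \<in> borel_measurable borel"
      by (rule measurable_compose[OF _ Am]) (intro borel_measurable_continuous_onI continuous_intros)
    from nn_integral_lborel_translate[OF this, of x]
    show "(\<integral>\<^sup>+y. indicator A (x, y + x) \<partial>lborel) = (\<integral>\<^sup>+y. indicator A (x, y) \<partial>lborel)" .
  qed
  also have "\<dots> = (\<integral>\<^sup>+z. indicator A z \<partial>lborel)"
    by (rule nn_integral_lborel_fst[symmetric]) (rule Am)
  finally show "emeasure (distr lborel borel (\<lambda>z. (fst z, fst z + snd z))) A = emeasure lborel A"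
    by simp
qed simp

text \<open>Split the exponent into three shares and drop a nonnegative term from each base. The
  surplus share goes to \<open>x\<close>, the variable in which Cauchy-Schwarz is applied
  later.\<close>

lemma weight_product_le:
  fixes x y b \<sigma>1 \<sigma>2 :: real
  assumes "x \<ge> 0" "y \<ge> 0" "\<sigma>1 \<ge> 0" "\<sigma>2 \<ge> 0" "b \<ge> \<sigma>1 + \<sigma>2"
  shows "(1 + x + y) powr (- b) \<le> (1 + x) powr (- \<sigma>1) * (1 + y) powr (- \<sigma>2) * (1 + x) powr (- (b - \<sigma>1 - \<sigma>2))"
proof -
  have "(1 + x + y) powr (- b) = (1 + x + y) powr (- \<sigma>1) * (1 + x + y) powr (- \<sigma>2) * (1 + x + y) powr (- (b - \<sigma>1 - \<sigma>2))"
    using assms by (simp add: powr_add[symmetric])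
  also have "\<dots> \<le> (1 + x) powr (- \<sigma>1) * (1 + y) powr (- \<sigma>2) * (1 + x) powr (- (b - \<sigma>1 - \<sigma>2))"
    using assms by (intro mult_mono powr_mono2') auto
  finally show ?thesis .
qed

text \<open>In the sheared variables the output is the Fourier transform of \<open>H\<close>, the
  integral over \<xi> at fixed \<zeta> = \<xi> + \<eta>. Plancherel removes the transform,
  Cauchy-Schwarz in \<xi> isolates the surplus weight, and the remaining double integral is a
  convolution of squares, which factorises.\<close>

lemma bilinear_op_L2:
  fixes F G :: "'a::euclidean_space \<Rightarrow> complex" and M :: "'a \<times> 'a \<Rightarrow> complex"
  assumes F: "integrable lborel F" and G: "integrable lborel G"
    and M [measurable]: "M \<in> borel_measurable borel"
    and B: "\<And>z. norm (M z) \<le> B * (1 + norm (fst z) + norm (snd z)) powr (- b)"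
    and \<sigma>: "\<sigma>1 \<ge> 0" "\<sigma>2 \<ge> 0" "b \<ge> \<sigma>1 + \<sigma>2"
  shows "(\<integral>\<^sup>+x. ennreal ((norm (bilinear_op M F G x))\<^sup>2) \<partial>lborel)
     \<le> ennreal (B\<^sup>2) * (\<integral>\<^sup>+\<xi>. ennreal ((1 + norm (\<xi>::'a)) powr (- 2 * (b - \<sigma>1 - \<sigma>2))) \<partial>lborel) *
        ((\<integral>\<^sup>+\<xi>. ennreal ((norm (F \<xi>) * (1 + norm \<xi>) powr (- \<sigma>1))\<^sup>2) \<partial>lborel) *
         (\<integral>\<^sup>+\<xi>. ennreal ((norm (G \<xi>) * (1 + norm \<xi>) powr (- \<sigma>2))\<^sup>2) \<partial>lborel))"
proof -
  have Fm [measurable]: "F \<in> borel_measurable borel" and Gm [measurable]: "G \<in> borel_measurable borel"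
    using F G borel_measurable_integrable by fastforce+
  have M2 [measurable]: "M \<in> borel_measurable (borel \<Otimes>\<^sub>M borel)" using M by (simp add: borel_prod)
  have B0: "B \<ge> 0" using order_trans[OF norm_ge_zero B[of 0]] by simp
  have Mb: "norm (M z) \<le> B" for z
  proof -
    have "(1 + norm (fst z) + norm (snd z)) powr (- b) \<le> 1 powr (- b)"
      using \<sigma> by (intro powr_mono2') auto
    from mult_left_mono[OF this B0] B[of z] show ?thesis by simp
  qed
  define K where "K = (\<lambda>z::'a \<times> 'a. F (fst z) * G (snd z) * M z)"
  \<comment> \<open>The integrand \<open>K\<close> in the coordinates (\<xi>, \<xi> +
    \<eta>).\<close>
  define h where "h = (\<lambda>w::'a \<times> 'a. F (fst w) * G (snd w - fst w) * M (fst w, snd w - fst w))"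
  have hm [measurable]: "h \<in> borel_measurable (borel \<Otimes>\<^sub>M borel)" unfolding h_def by measurable
  have hm' [measurable]: "h \<in> borel_measurable borel" using hm by (simp add: borel_prod)
  have Km [measurable]: "K \<in> borel_measurable borel" unfolding K_def borel_prod[symmetric] by measurable
  have T [measurable]: "(\<lambda>z::'a \<times> 'a. (fst z, fst z + snd z)) \<in> borel \<rightarrow>\<^sub>M borel"
    by (intro borel_measurable_continuous_onI continuous_intros)
  have K: "integrable lborel K"
  proof (rule Bochner_Integration.integrable_bound)
    show "integrable lborel (\<lambda>z::'a \<times> 'a. of_real B * (F (fst z) * G (snd z)))"
      by (intro integrable_mult_right integrable_lborel_tensor F G)
    show "AE z in lborel. norm (K z) \<le> norm (of_real B * (F (fst z) * G (snd z)))"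
      using Mb B0 by (intro AE_I2) (simp add: K_def norm_mult mult.commute mult_left_mono mult_right_mono)
  qed simp
  have hT: "h (fst z, fst z + snd z) = K z" for z by (simp add: h_def K_def)
  have h: "integrable lborel h"
  proof -
    have "integrable (distr lborel borel (\<lambda>z::'a \<times> 'a. (fst z, fst z + snd z))) h"
      by (subst integrable_distr_eq) (auto simp: hT K)
    then show ?thesis by (simp only: lborel_distr_shear)
  qed
  have h': "integrable (lborel \<Otimes>\<^sub>M lborel) (\<lambda>(\<xi>, \<zeta>). h (\<xi>, \<zeta>))"
    using h by (simp add: lborel_prod)
  define H where "H = (\<lambda>\<zeta>. LINT \<xi>|lborel. h (\<xi>, \<zeta>))"
  have H: "integrable lborel H"
    unfolding H_def using lborel_pair.integrable_snd[OF h'] by simp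
  have Hm [measurable]: "H \<in> borel_measurable borel"
    using H borel_measurable_integrable by fastforce
  \<comment> \<open>The minus sign turns the forward transform into the inverse one; reflection
    preserves the L^2 norm.\<close>
  have W: "bilinear_op M F G x = fourier H (- x)" for x
  proof -
    define k where "k = (\<lambda>w::'a \<times> 'a. h w * echar (x \<bullet> snd w))"
    have km [measurable]: "k \<in> borel_measurable borel" unfolding k_def borel_prod[symmetric] by measurable
    have k: "integrable lborel k" unfolding k_def
      by (rule integrable_mult_echar[OF h]) (simp add: borel_prod[symmetric])
    have "bilinear_op M F G x = (LINT z|lborel. k (fst z, fst z + snd z))"
      unfolding bilinear_op_def k_def hT by (simp add: K_def)
    also have "\<dots> = (LINT z|distr lborel borel (\<lambda>z::'a \<times> 'a. (fst z, fst z + snd z)). k z)"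
      by (subst integral_distr) auto
    also have "\<dots> = (LINT z|(lborel \<Otimes>\<^sub>M lborel). k z)"
      by (simp only: lborel_distr_shear lborel_prod)
    also have "\<dots> = (LINT \<zeta>|lborel. LINT \<xi>|lborel. k (\<xi>, \<zeta>))"
      using lborel_pair.integral_snd[of "\<lambda>x y. k (x, y)"] k by (simp add: lborel_prod)
    also have "\<dots> = fourier H (- x)"
      unfolding fourier_echar H_def k_def by (simp add: inner_commute)
    finally show ?thesis .
  qed
  define u where "u = (\<lambda>\<xi>::'a. ennreal (norm (F \<xi>) * (1 + norm \<xi>) powr (- \<sigma>1)))"
  define v where "v = (\<lambda>\<xi>::'a. ennreal (norm (G \<xi>) * (1 + norm \<xi>) powr (- \<sigma>2)))"
  define w where "w = (\<lambda>\<xi>::'a. ennreal (B * (1 + norm \<xi>) powr (- (b - \<sigma>1 - \<sigma>2))))"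
  have [measurable]: "u \<in> borel_measurable borel" "v \<in> borel_measurable borel" "w \<in> borel_measurable borel"
    unfolding u_def v_def w_def by measurable
  have hle: "ennreal (norm (h (\<xi>, \<zeta>))) \<le> (u \<xi> * v (\<zeta> - \<xi>)) * w \<xi>" for \<xi> \<zeta>
  proof -
    have "norm (h (\<xi>, \<zeta>)) \<le> norm (F \<xi>) * norm (G (\<zeta> - \<xi>)) * (B * (1 + norm \<xi> + norm (\<zeta> - \<xi>)) powr (- b))"
      using B[of "(\<xi>, \<zeta> - \<xi>)"] by (simp add: h_def norm_mult mult_left_mono)
    also have "\<dots> \<le> norm (F \<xi>) * norm (G (\<zeta> - \<xi>)) * (B * ((1 + norm \<xi>) powr (- \<sigma>1) * (1 + norm (\<zeta> - \<xi>)) powr (- \<sigma>2) * (1 + norm \<xi>) powr (- (b - \<sigma>1 - \<sigma>2))))"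
      using B0 \<sigma> by (intro mult_left_mono weight_product_le) auto
    also have "\<dots> = (norm (F \<xi>) * (1 + norm \<xi>) powr (- \<sigma>1)) * (norm (G (\<zeta> - \<xi>)) * (1 + norm (\<zeta> - \<xi>)) powr (- \<sigma>2)) * (B * (1 + norm \<xi>) powr (- (b - \<sigma>1 - \<sigma>2)))"
      by (simp add: mult_ac)
    finally show ?thesis
      unfolding u_def v_def w_def using B0 by (simp add: ennreal_mult[symmetric] ennreal_leI)
  qed
  define Q where "Q = (\<integral>\<^sup>+\<xi>. (w \<xi>)\<^sup>2 \<partial>lborel)"
  \<comment> \<open>The factor \<open>w\<close> depends on \<xi> alone, so its square integral
    \<open>Q\<close> is the same for every \<zeta> and leaves the outer integral.\<close>
  have H2: "ennreal ((norm (H \<zeta>))\<^sup>2) \<le> (\<integral>\<^sup>+\<xi>. (u \<xi> * v (\<zeta> - \<xi>))\<^sup>2 \<partial>lborel) * Q" for \<zeta>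
  proof -
    have "ennreal (norm (H \<zeta>)) \<le> (\<integral>\<^sup>+\<xi>. ennreal (norm (h (\<xi>, \<zeta>))) \<partial>lborel)"
      unfolding H_def by (rule norm_integral_le_nn_integral)
    also have "\<dots> \<le> (\<integral>\<^sup>+\<xi>. (u \<xi> * v (\<zeta> - \<xi>)) * w \<xi> \<partial>lborel)"
      by (intro nn_integral_mono hle)
    finally have "(ennreal (norm (H \<zeta>)))\<^sup>2 \<le> (\<integral>\<^sup>+\<xi>. (u \<xi> * v (\<zeta> - \<xi>)) * w \<xi> \<partial>lborel)\<^sup>2"
      by (rule power_mono) simp
    also have "\<dots> \<le> (\<integral>\<^sup>+\<xi>. (u \<xi> * v (\<zeta> - \<xi>))\<^sup>2 \<partial>lborel) * Q"
      unfolding Q_def by (rule Cauchy_Schwarz_nn_integral) measurable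
    finally show ?thesis by (simp add: ennreal_power)
  qed
  have "(\<integral>\<^sup>+x. ennreal ((norm (bilinear_op M F G x))\<^sup>2) \<partial>lborel)
      = (\<integral>\<^sup>+x. ennreal ((norm (fourier H x))\<^sup>2) \<partial>lborel)"
    unfolding W by (rule nn_integral_lborel_uminus) simp
  also have "\<dots> \<le> (\<integral>\<^sup>+\<zeta>. ennreal ((norm (H \<zeta>))\<^sup>2) \<partial>lborel)"
    by (rule plancherel_le[OF H])
  also have "\<dots> \<le> (\<integral>\<^sup>+\<zeta>. (\<integral>\<^sup>+\<xi>. (u \<xi> * v (\<zeta> - \<xi>))\<^sup>2 \<partial>lborel) * Q \<partial>lborel)"
    by (intro nn_integral_mono H2)
  also have "\<dots> = (\<integral>\<^sup>+\<zeta>. (\<integral>\<^sup>+\<xi>. (u \<xi> * v (\<zeta> - \<xi>))\<^sup>2 \<partial>lborel) \<partial>lborel) * Q"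
    by (rule nn_integral_multc) measurable
  also have "(\<integral>\<^sup>+\<zeta>. (\<integral>\<^sup>+\<xi>. (u \<xi> * v (\<zeta> - \<xi>))\<^sup>2 \<partial>lborel) \<partial>lborel)
      = (\<integral>\<^sup>+\<xi>. (\<integral>\<^sup>+\<zeta>. (u \<xi> * v (\<zeta> - \<xi>))\<^sup>2 \<partial>lborel) \<partial>lborel)"
    by (rule lborel_pair.Fubini') measurable
  also have "\<dots> = (\<integral>\<^sup>+\<xi>. (u \<xi>)\<^sup>2 * (\<integral>\<^sup>+\<zeta>. (v \<zeta>)\<^sup>2 \<partial>lborel) \<partial>lborel)"
  proof (intro nn_integral_cong)
    fix \<xi> :: 'a
    have "(\<integral>\<^sup>+\<zeta>. (u \<xi> * v (\<zeta> - \<xi>))\<^sup>2 \<partial>lborel) = (u \<xi>)\<^sup>2 * (\<integral>\<^sup>+\<zeta>. (v (\<zeta> - \<xi>))\<^sup>2 \<partial>lborel)"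
      unfolding power_mult_distrib by (rule nn_integral_cmult) measurable
    also have "(\<integral>\<^sup>+\<zeta>. (v (\<zeta> - \<xi>))\<^sup>2 \<partial>lborel) = (\<integral>\<^sup>+\<zeta>. (v \<zeta>)\<^sup>2 \<partial>lborel)"
      using nn_integral_lborel_translate[of "\<lambda>\<zeta>. (v \<zeta>)\<^sup>2" "- \<xi>"] by simp
    finally show "(\<integral>\<^sup>+\<zeta>. (u \<xi> * v (\<zeta> - \<xi>))\<^sup>2 \<partial>lborel) = (u \<xi>)\<^sup>2 * (\<integral>\<^sup>+\<zeta>. (v \<zeta>)\<^sup>2 \<partial>lborel)" .
  qed
  also have "\<dots> = (\<integral>\<^sup>+\<xi>. (u \<xi>)\<^sup>2 \<partial>lborel) * (\<integral>\<^sup>+\<zeta>. (v \<zeta>)\<^sup>2 \<partial>lborel)"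
    by (rule nn_integral_multc) measurable
  also have "Q = ennreal (B\<^sup>2) * (\<integral>\<^sup>+\<xi>. ennreal ((1 + norm (\<xi>::'a)) powr (- 2 * (b - \<sigma>1 - \<sigma>2))) \<partial>lborel)"
  proof -
    have "(w \<xi>)\<^sup>2 = ennreal (B\<^sup>2) * ennreal ((1 + norm \<xi>) powr (- 2 * (b - \<sigma>1 - \<sigma>2)))" for \<xi>
    proof -
      have "1 + norm \<xi> > 0" by (simp add: add_pos_nonneg)
      then have "((1 + norm \<xi>) powr (- (b - \<sigma>1 - \<sigma>2)))\<^sup>2 = (1 + norm \<xi>) powr (- 2 * (b - \<sigma>1 - \<sigma>2))"
        by (simp add: powr_power algebra_simps)
      then show ?thesis
        unfolding w_def using B0 by (simp add: ennreal_power power_mult_distrib ennreal_mult)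
    qed
    then show ?thesis unfolding Q_def by (subst nn_integral_cmult[symmetric]) auto
  qed
  finally show ?thesis
    unfolding u_def v_def by (simp add: ennreal_power mult_ac)
qed

subsection \<open>Fourier transforms of test functions\<close>

lemma integral_lborel_translate:
  fixes f :: "'a::euclidean_space \<Rightarrow> complex"
  assumes [measurable]: "f \<in> borel_measurable borel"
  shows "(LINT x|lborel. f (x + c)) = (LINT x|lborel. f x)"
proof -
  have "(LINT x|lborel. f x) = (LINT x|distr lborel borel ((+) c). f x)"
    by (simp only: lborel_distr_plus)
  also have "\<dots> = (LINT x|lborel. f (x + c))"
    by (subst integral_distr) (auto simp: add.commute)
  finally show ?thesis by simp
qed

section \<open>Derivatives along coordinate lines\<close>

lemma vector_derivative_quotient_tendsto:
  assumes "(f has_vector_derivative D) (at 0)"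
  shows "((\<lambda>t. (f t - f 0) /\<^sub>R t) \<longlongrightarrow> D) (at 0)"
proof -
  have "((\<lambda>h. norm (f (0 + h) - f 0 - h *\<^sub>R D) / norm h) \<longlongrightarrow> 0) (at 0)"
    using assms unfolding has_vector_derivative_def has_derivative_at by blast
  have quot: "norm (f (0 + h) - f 0 - h *\<^sub>R D) / norm h = norm ((f h - f 0) /\<^sub>R h - D)" if "h \<noteq> 0" for h :: real
  proof -
    have "(f h - f 0) /\<^sub>R h - D = (f h - f 0 - h *\<^sub>R D) /\<^sub>R h"
      using that by (simp add: scaleR_diff_right)
    then show ?thesis by (simp add: divide_inverse mult.commute)
  qed
  from \<open>((\<lambda>h. norm (f (0 + h) - f 0 - h *\<^sub>R D) / norm h) \<longlongrightarrow> 0) (at 0)\<close>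
  have "((\<lambda>h. norm ((f h - f 0) /\<^sub>R h - D)) \<longlongrightarrow> 0) (at 0)"
    by (rule Lim_transform_eventually[OF _ eventually_mono[OF eventually_neq_at_within]]) (rule quot)
  then have "((\<lambda>h. (f h - f 0) /\<^sub>R h - D) \<longlongrightarrow> 0) (at 0)"
    by (rule tendsto_norm_zero_cancel)
  then show ?thesis by (rule LIM_zero_cancel)
qed

text \<open>\<open>partial_deriv\<close> records derivatives at parameter 0 only; changing the base
  point to x + t b carries them to any parameter on the line.\<close>

lemma partial_deriv_has_vector_derivative:
  assumes "\<And>x. (\<lambda>s. f (x + s *\<^sub>R b)) differentiable (at 0)"
  shows "((\<lambda>s. f (x + s *\<^sub>R b)) has_vector_derivative partial_deriv b f (x + t *\<^sub>R b)) (at t)"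
proof -
  have "((\<lambda>s. f ((x + t *\<^sub>R b) + s *\<^sub>R b)) has_vector_derivative partial_deriv b f (x + t *\<^sub>R b)) (at (t - t))"
    unfolding partial_deriv_def using assms[of "x + t *\<^sub>R b"] by (simp add: vector_derivative_works)
  moreover have shift: "((\<lambda>s. s - t) has_vector_derivative 1 - 0) (at t)"
    by (intro has_vector_derivative_diff has_vector_derivative_id has_vector_derivative_const)
  ultimately have "((\<lambda>s. f ((x + t *\<^sub>R b) + (s - t) *\<^sub>R b)) has_vector_derivative partial_deriv b f (x + t *\<^sub>R b)) (at t)"
    using vector_diff_chain_at[of "\<lambda>s. s - t" 1 t "\<lambda>s. f ((x + t *\<^sub>R b) + s *\<^sub>R b)"]
      shift by (simp add: o_def)
  then show ?thesis by (simp add: algebra_simps)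
qed

lemma partial_deriv_bound:
  fixes f :: "'a::euclidean_space \<Rightarrow> complex"
  assumes d: "\<And>x. (\<lambda>s. f (x + s *\<^sub>R b)) differentiable (at 0)"
    and B: "\<And>s. s \<in> closed_segment t1 t2 \<Longrightarrow> norm (partial_deriv b f (x + s *\<^sub>R b)) \<le> B"
  shows "norm (f (x + t2 *\<^sub>R b) - f (x + t1 *\<^sub>R b)) \<le> B * \<bar>t2 - t1\<bar>"
proof -
  have "norm (f (x + t2 *\<^sub>R b) - f (x + t1 *\<^sub>R b)) \<le> B * norm (t2 - t1)"
  proof (rule differentiable_bound[where S = "closed_segment t1 t2"
        and f' = "\<lambda>s h. h *\<^sub>R partial_deriv b f (x + s *\<^sub>R b)"])
    show "((\<lambda>s. f (x + s *\<^sub>R b)) has_derivative (\<lambda>h. h *\<^sub>R partial_deriv b f (x + s *\<^sub>R b))) (at s within closed_segment t1 t2)" for s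
      using partial_deriv_has_vector_derivative[OF d, of x s]
      by (auto simp: has_vector_derivative_def intro: has_derivative_at_withinI)
    show "onorm (\<lambda>h. h *\<^sub>R partial_deriv b f (x + s *\<^sub>R b)) \<le> B" if "s \<in> closed_segment t1 t2" for s
      using B[OF that] by (intro onorm_le) (simp add: mult.commute[of B] mult_left_mono)
  qed auto
  then show ?thesis by simp
qed

section \<open>Test functions and the decay of their transforms\<close>

lemma test_function_continuous:
  assumes "f \<in> test_functions"
  shows "continuous_on UNIV f"
proof -
  have "C_k 0 f" using assms unfolding test_functions_def by blast
  then show ?thesis by simp
qed

lemma test_function_compact: "f \<in> test_functions \<Longrightarrow> compact (closure {x. f x \<noteq> 0})"
  by (simp add: test_functions_def)

lemma integrable_compact_support:
  fixes f :: "'a::euclidean_space \<Rightarrow> 'b::{banach, second_countable_topology}"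
  assumes "continuous_on UNIV f" "compact K" "\<And>x. x \<notin> K \<Longrightarrow> f x = 0"
  shows "integrable lborel f"
proof -
  have "integrable lborel (\<lambda>x. indicator K x *\<^sub>R f x)"
    using assms by (intro borel_integrable_compact continuous_on_subset[OF assms(1)]) auto
  moreover have "(\<lambda>x. indicator K x *\<^sub>R f x) = f"
    using assms(3) by (auto simp: indicator_def fun_eq_iff)
  ultimately show ?thesis by simp
qed

lemma test_function_eq_0:
  assumes "x \<notin> closure {x. f x \<noteq> 0}"
  shows "f x = 0"
proof (rule ccontr)
  assume "f x \<noteq> 0"
  then have "x \<in> {x. f x \<noteq> 0}" by simp
  with assms closure_subset show False by (metis subsetD)
qed

lemma test_function_integrable:
  assumes "f \<in> test_functions"
  shows "integrable lborel f"
  by (rule integrable_compact_support[OF test_function_continuous[OF assms] test_function_compact[OF assms]])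
     (rule test_function_eq_0)

lemma test_function_powr_integrable:
  assumes "f \<in> test_functions" "p > 0"
  shows "integrable lborel (\<lambda>x. norm (f x) powr p)"
proof (rule integrable_compact_support[OF _ test_function_compact[OF assms(1)]])
  show "continuous_on UNIV (\<lambda>x. norm (f x) powr p)"
    using assms by (intro continuous_on_powr' continuous_intros test_function_continuous) auto
  show "norm (f x) powr p = 0" if "x \<notin> closure {x. f x \<noteq> 0}" for x
    using test_function_eq_0[OF that] by simp
qed

text \<open>The support cannot grow: off the closed support \<open>f\<close> vanishes on an open
  set, hence so does its derivative.\<close>

lemma test_function_partial_deriv:
  assumes f: "f \<in> test_functions" and b: "b \<in> Basis"
  shows "partial_deriv b f \<in> test_functions"
proof -
  define S where "S = closure {x. f x \<noteq> 0}"
  have "C_k k (partial_deriv b f)" for k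
    using f b C_k.simps(2)[of k f] by (auto simp: test_functions_def)
  moreover have "{x. partial_deriv b f x \<noteq> 0} \<subseteq> S"
  proof clarify
    fix x assume x: "partial_deriv b f x \<noteq> 0"
    show "x \<in> S"
    proof (rule ccontr)
      assume "x \<notin> S"
      then have o: "x \<in> - S" "open (- S)" by (auto simp: S_def)
      have "open ((\<lambda>s::real. x + s *\<^sub>R b) -` (- S))"
        by (intro open_vimage o continuous_intros)
      then have "((\<lambda>s. f (x + s *\<^sub>R b)) has_vector_derivative 0) (at 0)"
        by (rule has_vector_derivative_transform_within_open[OF has_vector_derivative_const[of 0]])
           (use o in \<open>auto simp: S_def intro: test_function_eq_0[of _ f]\<close>)
      then have "partial_deriv b f x = 0"
        unfolding partial_deriv_def by (rule vector_derivative_at)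
      with x show False by simp
    qed
  qed
  then have "closure {x. partial_deriv b f x \<noteq> 0} \<subseteq> S"
    unfolding S_def by (intro closure_minimal) auto
  then have "compact (closure {x. partial_deriv b f x \<noteq> 0})"
    using test_function_compact[OF f] unfolding S_def
    by (metis closed_closure compact_Int_closed inf.absorb_iff2)
  ultimately show ?thesis by (simp add: test_functions_def)
qed

lemma test_function_differentiable:
  assumes f: "f \<in> test_functions" and b: "b \<in> Basis"
  shows "(\<lambda>s. f (x + s *\<^sub>R b)) differentiable (at 0)"
proof -
  have "C_k (Suc 0) f" using f unfolding test_functions_def by blast
  then show ?thesis using b by simp
qed

lemma test_function_bounded:
  assumes "f \<in> test_functions"
  obtains L where "L \<ge> 0" "\<And>x. norm (f x) \<le> L"
proof -
  have "compact (f ` closure {x. f x \<noteq> 0})"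
    using assms by (intro compact_continuous_image test_function_compact)
      (auto intro: continuous_on_subset[OF test_function_continuous])
  then obtain L where L: "\<And>x. x \<in> closure {x. f x \<noteq> 0} \<Longrightarrow> norm (f x) \<le> L"
    by (meson bounded_iff compact_imp_bounded imageI)
  have "norm (f x) \<le> max L 0" for x
    using L[of x] test_function_eq_0[of x f] by (cases "x \<in> closure {x. f x \<noteq> 0}") auto
  then show ?thesis using that[of "max L 0"] by auto
qed

text \<open>Proved with difference quotients instead of integration by parts: translation invariance
  gives the transform of the quotient as (e(s \<xi>.b) - 1)/s times that of \<open>f\<close>, and
  both sides converge as s -> 0, the left one by dominated convergence.\<close>

lemma fourier_partial_deriv:
  assumes f: "f \<in> test_functions" and b: "b \<in> Basis"
  shows "fourier (partial_deriv b f) \<xi> = 2 * pi * \<i> * (\<xi> \<bullet> b) * fourier f \<xi>"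
proof -
  define g where "g = partial_deriv b f"
  have gt: "g \<in> test_functions" unfolding g_def by (rule test_function_partial_deriv[OF f b])
  have [measurable]: "f \<in> borel_measurable borel" "g \<in> borel_measurable borel"
    using test_function_continuous f gt by (auto intro: borel_measurable_continuous_onI)
  obtain L where L: "L \<ge> 0" "\<And>x. norm (g x) \<le> L" using test_function_bounded[OF gt] by blast
  obtain R where R: "\<And>x. f x \<noteq> 0 \<Longrightarrow> norm x \<le> R"
    using test_function_compact[OF f] by (metis (mono_tags, lifting) bounded_iff closure_subset compact_imp_bounded mem_Collect_eq subsetD)
  define s where "s = (\<lambda>n. 1 / real (Suc n))"
  have s: "s n > 0" "s n \<le> 1" for n by (auto simp: s_def)
  have slim: "s \<longlonglongrightarrow> 0" unfolding s_def by (rule LIMSEQ_Suc[OF lim_1_over_n])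
  have slim': "filterlim s (at 0) sequentially"
    using slim s by (auto simp: filterlim_at less_imp_neq[THEN not_sym] intro!: always_eventually)
  define D where "D = (\<lambda>n x. (f (x + s n *\<^sub>R b) - f x) / s n)"
  have Dlim: "(\<lambda>n. D n x) \<longlonglongrightarrow> g x" for x
  proof -
    have "((\<lambda>t. f (x + t *\<^sub>R b)) has_vector_derivative g x) (at 0)"
      using partial_deriv_has_vector_derivative[OF test_function_differentiable[OF f b], of x 0]
      by (simp add: g_def)
    then have "((\<lambda>t. (f (x + t *\<^sub>R b) - f x) /\<^sub>R t) \<longlongrightarrow> g x) (at 0)"
      by (auto dest: vector_derivative_quotient_tendsto)
    from filterlim_compose[OF this slim']
    show ?thesis by (simp add: D_def scaleR_conv_of_real divide_inverse mult.commute)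
  qed
  \<comment> \<open>\<open>L\<close> comes from the mean value inequality. Since 0 < s n \<le> 1 and
    basis vectors have norm 1, the shifted support still lies in the ball of radius R + 1.\<close>
  have Dbound: "norm (D n x) \<le> L * indicator (cball 0 (R + 1)) x" for n x
  proof (cases "norm x \<le> R + 1")
    case True
    have "norm (f (x + s n *\<^sub>R b) - f (x + 0 *\<^sub>R b)) \<le> L * \<bar>s n - 0\<bar>"
      by (rule partial_deriv_bound[OF test_function_differentiable[OF f b]])
         (use L in \<open>auto simp: g_def\<close>)
    then show ?thesis using s[of n] True by (simp add: D_def norm_divide field_simps)
  next
    case False
    have "norm x \<le> norm (x + s n *\<^sub>R b) + norm (s n *\<^sub>R b)"
      by (metis add_diff_cancel_right' norm_triangle_ineq4)
    also have "norm (s n *\<^sub>R b) \<le> 1" using s[of n] b by simp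
    finally have "f (x + s n *\<^sub>R b) = 0" "f x = 0"
      using False R[of x] R[of "x + s n *\<^sub>R b"] by auto
    then show ?thesis using L by (simp add: D_def)
  qed
  have lim1: "(\<lambda>n. LINT x|lborel. D n x * echar (- (x \<bullet> \<xi>))) \<longlonglongrightarrow> (LINT x|lborel. g x * echar (- (x \<bullet> \<xi>)))"
  proof (rule integral_dominated_convergence[where w = "\<lambda>x. L * indicator (cball 0 (R + 1)) x"])
    show "integrable lborel (\<lambda>x. L * indicator (cball 0 (R + 1)) x)"
      using emeasure_lborel_cball_finite[of 0 "R + 1"] by (intro integrable_mult_right) (auto simp: less_top)
    show "AE x in lborel. (\<lambda>n. D n x * echar (- (x \<bullet> \<xi>))) \<longlonglongrightarrow> g x * echar (- (x \<bullet> \<xi>))"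
      by (intro AE_I2 tendsto_mult Dlim tendsto_const)
    show "AE x in lborel. norm (D n x * echar (- (x \<bullet> \<xi>))) \<le> L * indicator (cball 0 (R + 1)) x" for n
      using Dbound by (simp add: norm_mult)
    show "(\<lambda>x. D n x * echar (- (x \<bullet> \<xi>))) \<in> borel_measurable lborel" for n
      unfolding D_def by measurable
  qed measurable
  have eq: "(LINT x|lborel. D n x * echar (- (x \<bullet> \<xi>))) = (echar (s n * (\<xi> \<bullet> b)) - 1) / s n * fourier f \<xi>" for n
  proof -
    have sh: "(\<lambda>x. f (x + s n *\<^sub>R b) * echar (- (x \<bullet> \<xi>)))
       = (\<lambda>x. echar (s n * (\<xi> \<bullet> b)) * (\<lambda>x. f x * echar (- (x \<bullet> \<xi>))) (x + s n *\<^sub>R b))"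
      by (auto simp: fun_eq_iff echar_add[symmetric] inner_add_left inner_commute[of b] mult.left_commute)
    have int: "integrable lborel (\<lambda>x. f x * echar (- (x \<bullet> \<xi>)))"
      by (rule integrable_mult_echar[OF test_function_integrable[OF f]]) measurable
    have "(LINT x|lborel. f (x + s n *\<^sub>R b) * echar (- (x \<bullet> \<xi>))) = echar (s n * (\<xi> \<bullet> b)) * fourier f \<xi>"
      unfolding sh fourier_echar
      by (subst Bochner_Integration.integral_mult_right_zero, subst integral_lborel_translate) simp_all
    moreover have "integrable lborel (\<lambda>x. f (x + s n *\<^sub>R b) * echar (- (x \<bullet> \<xi>)))"
    proof -
      have "integrable (distr lborel borel ((+) (s n *\<^sub>R b))) (\<lambda>x. f x * echar (- (x \<bullet> \<xi>)))"
        using int by (simp only: lborel_distr_plus)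
      then have "integrable lborel (\<lambda>x. (\<lambda>x. f x * echar (- (x \<bullet> \<xi>))) (x + s n *\<^sub>R b))"
        by (subst (asm) integrable_distr_eq) (auto simp: add.commute)
      then show ?thesis unfolding sh by (rule integrable_mult_right)
    qed
    moreover have "(LINT x|lborel. D n x * echar (- (x \<bullet> \<xi>)))
       = (LINT x|lborel. (f (x + s n *\<^sub>R b) * echar (- (x \<bullet> \<xi>)) - f x * echar (- (x \<bullet> \<xi>))) / s n)"
      by (simp add: D_def algebra_simps diff_divide_distrib)
    ultimately show ?thesis
      using int by (simp add: fourier_echar algebra_simps diff_divide_distrib)
  qed
  have "((\<lambda>t. echar (t * (\<xi> \<bullet> b))) has_vector_derivative (2 * pi * (\<xi> \<bullet> b)) *\<^sub>R (\<i> * cis (2 * pi * (0 * (\<xi> \<bullet> b))))) (at 0)"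
    unfolding echar_def has_vector_derivative_def
    by (auto intro!: derivative_eq_intros simp: scaleR_conv_of_real mult_ac)
  then have "((\<lambda>t. (echar (t * (\<xi> \<bullet> b)) - 1) /\<^sub>R t) \<longlongrightarrow> 2 * pi * \<i> * (\<xi> \<bullet> b)) (at 0)"
    using vector_derivative_quotient_tendsto[of "\<lambda>t. echar (t * (\<xi> \<bullet> b))"]
    by (simp add: echar_def scaleR_conv_of_real mult_ac)
  from filterlim_compose[OF this slim']
  have "(\<lambda>n. (echar (s n * (\<xi> \<bullet> b)) - 1) / s n) \<longlonglongrightarrow> 2 * pi * \<i> * (\<xi> \<bullet> b)"
    by (simp add: scaleR_conv_of_real divide_inverse mult.commute)
  then have "(\<lambda>n. (echar (s n * (\<xi> \<bullet> b)) - 1) / s n * fourier f \<xi>) \<longlonglongrightarrow> 2 * pi * \<i> * (\<xi> \<bullet> b) * fourier f \<xi>"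
    by (intro tendsto_intros)
  with lim1 show ?thesis
    unfolding eq fourier_echar[symmetric] g_def by (rule LIMSEQ_unique)
qed

text \<open>Two derivatives in direction \<open>b\<close> buy one factor (1 + |\<xi>.b|)^2, which is
  integrable once inverted. The induction must range over all test functions because the step
  applies it to the second derivative of \<open>f\<close>.\<close>

lemma fourier_test_function_decay:
  assumes "finite B" "B \<subseteq> Basis" "f \<in> test_functions"
  shows "\<exists>C. \<forall>\<xi>. norm (fourier f \<xi>) * (\<Prod>b\<in>B. (1 + \<bar>\<xi> \<bullet> b\<bar>)\<^sup>2) \<le> C"
  using assms
proof (induction B arbitrary: f rule: finite_induct)
  case empty
  then show ?case by (intro exI[of _ "LINT x|lborel. norm (f x)"]) (simp add: norm_fourier_le)
next
  case (insert b B)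
  have b: "b \<in> Basis" using insert by auto
  define h where "h = partial_deriv b (partial_deriv b f)"
  have h: "h \<in> test_functions" unfolding h_def by (intro test_function_partial_deriv insert b)
  obtain C1 where C1: "\<And>\<xi>. norm (fourier f \<xi>) * (\<Prod>b\<in>B. (1 + \<bar>\<xi> \<bullet> b\<bar>)\<^sup>2) \<le> C1"
    using insert.IH[of f] insert.prems by auto
  obtain C2 where C2: "\<And>\<xi>. norm (fourier h \<xi>) * (\<Prod>b\<in>B. (1 + \<bar>\<xi> \<bullet> b\<bar>)\<^sup>2) \<le> C2"
    using insert.IH[of h] insert.prems h by auto
  have "norm (fourier f \<xi>) * (\<Prod>b\<in>insert b B. (1 + \<bar>\<xi> \<bullet> b\<bar>)\<^sup>2) \<le> 2 * C1 + 2 * C2" for \<xi>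
  proof -
    define P where "P = (\<Prod>b\<in>B. (1 + \<bar>\<xi> \<bullet> b\<bar>)\<^sup>2)"
    have P: "P \<ge> 0" unfolding P_def by (intro prod_nonneg) auto
    have "fourier h \<xi> = (2 * pi * \<i> * (\<xi> \<bullet> b)) * (2 * pi * \<i> * (\<xi> \<bullet> b)) * fourier f \<xi>"
      unfolding h_def using test_function_partial_deriv[OF insert.prems(2) b] insert.prems b
      by (simp add: fourier_partial_deriv)
    then have "norm (fourier h \<xi>) = (2 * pi)\<^sup>2 * (\<xi> \<bullet> b)\<^sup>2 * norm (fourier f \<xi>)"
      by (simp add: norm_mult power2_eq_square abs_mult_self_eq mult_ac)
    moreover have "1 \<le> (2 * pi)\<^sup>2"
      using pi_ge_two by (intro one_le_power) linarith
    ultimately have "(\<xi> \<bullet> b)\<^sup>2 * norm (fourier f \<xi>) \<le> norm (fourier h \<xi>)"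
      using mult_right_mono[of 1 "(2 * pi)\<^sup>2" "(\<xi> \<bullet> b)\<^sup>2 * norm (fourier f \<xi>)"] by (simp add: mult.assoc)
    from mult_right_mono[OF this P] have 1: "(\<xi> \<bullet> b)\<^sup>2 * norm (fourier f \<xi>) * P \<le> C2"
      using C2[of \<xi>] unfolding P_def by linarith
    \<comment> \<open>The 2 is charged to \<open>f\<close> itself, the quadratic term to its second
      derivative.\<close>
    have "(1 + \<bar>\<xi> \<bullet> b\<bar>)\<^sup>2 \<le> 2 + 2 * (\<xi> \<bullet> b)\<^sup>2"
      using sum_squares_bound[of 1 "\<bar>\<xi> \<bullet> b\<bar>"] by (simp add: power2_sum)
    then have "norm (fourier f \<xi>) * P * (1 + \<bar>\<xi> \<bullet> b\<bar>)\<^sup>2 \<le> norm (fourier f \<xi>) * P * (2 + 2 * (\<xi> \<bullet> b)\<^sup>2)"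
      using P by (intro mult_left_mono) auto
    also have "\<dots> \<le> 2 * C1 + 2 * C2"
      using 1 C1[of \<xi>] unfolding P_def[symmetric] by (simp add: algebra_simps)
    finally show ?thesis using insert.hyps by (simp add: P_def mult_ac)
  qed
  then show ?case by blast
qed

text \<open>Makes \<open>bilinear_op\<close> an absolutely convergent integral for every bounded
  measurable multiplier, hence continuous in x and linear in the multiplier.\<close>

lemma fourier_test_function_integrable:
  fixes f :: "'a::euclidean_space \<Rightarrow> complex"
  assumes f: "f \<in> test_functions"
  shows "integrable lborel (fourier f)"
proof -
  have [measurable]: "f \<in> borel_measurable borel"
    using test_function_continuous f by (auto intro: borel_measurable_continuous_onI)
  obtain C where C: "\<And>\<xi>. norm (fourier f \<xi>) * (\<Prod>b\<in>Basis. (1 + \<bar>\<xi> \<bullet> b\<bar>)\<^sup>2) \<le> C"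
    using fourier_test_function_decay[OF finite_Basis order_refl f] by blast
  have C0: "C \<ge> 0" by (rule order_trans[OF _ C[of 0]]) (auto intro!: mult_nonneg_nonneg prod_nonneg)
  have "(\<integral>\<^sup>+\<xi>. ennreal (norm (fourier f \<xi>)) \<partial>lborel)
     \<le> (\<integral>\<^sup>+\<xi>. ennreal C * (\<Prod>b\<in>Basis. ennreal ((1 + \<bar>\<xi> \<bullet> b\<bar>) powr (- 2))) \<partial>(lborel :: 'a measure))"
  proof (intro nn_integral_mono)
    fix \<xi> :: 'a
    have pos: "(\<Prod>b\<in>(Basis::'a set). (1 + \<bar>\<xi> \<bullet> b\<bar>)\<^sup>2) > 0"
      by (intro prod_pos) (simp add: add_pos_nonneg)
    have "(1 + \<bar>\<xi> \<bullet> b\<bar>) powr (- 2) = inverse ((1 + \<bar>\<xi> \<bullet> b\<bar>)\<^sup>2)" for b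
      by (simp add: powr_minus add_pos_nonneg powr_numeral)
    then have eq: "(\<Prod>b\<in>(Basis::'a set). (1 + \<bar>\<xi> \<bullet> b\<bar>) powr (- 2)) = inverse (\<Prod>b\<in>(Basis::'a set). (1 + \<bar>\<xi> \<bullet> b\<bar>)\<^sup>2)"
      by (simp only: prod_inversef[symmetric] comp_def)
    have "norm (fourier f \<xi>) \<le> C * (\<Prod>b\<in>(Basis::'a set). (1 + \<bar>\<xi> \<bullet> b\<bar>) powr (- 2))"
      unfolding eq using C[of \<xi>] pos by (simp add: field_simps)
    then show "ennreal (norm (fourier f \<xi>)) \<le> ennreal C * (\<Prod>b\<in>Basis. ennreal ((1 + \<bar>\<xi> \<bullet> b\<bar>) powr (- 2)))"
      using C0 by (subst prod_ennreal) (auto simp: ennreal_mult[symmetric] prod_nonneg intro!: ennreal_leI)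
  qed
  also have "\<dots> = ennreal C * (\<integral>\<^sup>+\<xi>. (\<Prod>b\<in>Basis. ennreal ((1 + \<bar>\<xi> \<bullet> b\<bar>) powr (- 2))) \<partial>(lborel :: 'a measure))"
    by (rule nn_integral_cmult) measurable
  also have "\<dots> = ennreal C * (\<Prod>b\<in>(Basis::'a set). (\<integral>\<^sup>+t. ennreal ((1 + \<bar>t\<bar>) powr (- 2)) \<partial>lborel))"
    by (subst nn_integral_lborel_prod) auto
  also have "\<dots> < \<infinity>"
    using nn_integral_weight_real[of 2] by (auto simp: power_less_top_ennreal ennreal_mult_less_top)
  finally show ?thesis by (simp add: integrable_iff_bounded)
qed

subsection \<open>Differences of multipliers along dilations\<close>

text \<open>The closed coordinate box with opposite corners \<open>x\<close> and
  \<open>y\<close>.\<close>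

definition coord_between :: "'a::euclidean_space \<Rightarrow> 'a \<Rightarrow> 'a \<Rightarrow> bool" where
  "coord_between x y z \<longleftrightarrow> (\<forall>b\<in>Basis. min (x \<bullet> b) (y \<bullet> b) \<le> z \<bullet> b \<and> z \<bullet> b \<le> max (x \<bullet> b) (y \<bullet> b))"

text \<open>Walk from \<open>x\<close> to \<open>y\<close> along edges of the box. In the induction,
  \<open>B\<close> is the set of coordinates already switched to their values at \<open>y\<close>;
  each new edge costs one application of the one-dimensional mean value inequality.\<close>

lemma coord_path_bound:
  fixes f :: "'a::euclidean_space \<Rightarrow> complex"
  assumes d: "\<And>b x. b \<in> Basis \<Longrightarrow> (\<lambda>s. f (x + s *\<^sub>R b)) differentiable (at 0)"
    and L: "\<And>b z. b \<in> Basis \<Longrightarrow> coord_between x y z \<Longrightarrow> norm (partial_deriv b f z) \<le> L"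
  shows "norm (f y - f x) \<le> L * (\<Sum>b\<in>Basis. \<bar>(y - x) \<bullet> b\<bar>)"
proof -
  have "norm (f (x + (\<Sum>b\<in>B. ((y - x) \<bullet> b) *\<^sub>R b)) - f x) \<le> L * (\<Sum>b\<in>B. \<bar>(y - x) \<bullet> b\<bar>)"
    if "finite B" "B \<subseteq> Basis" for B
    using that
  proof (induction B rule: finite_induct)
    case (insert b B)
    define X where "X = x + (\<Sum>b\<in>B. ((y - x) \<bullet> b) *\<^sub>R b)"
    define h where "h = (y - x) \<bullet> b"
    have b: "b \<in> Basis" and B: "B \<subseteq> Basis" using insert by auto
    have X: "X \<bullet> c = (if c \<in> B then y \<bullet> c else x \<bullet> c)" if "c \<in> Basis" for c
    proof -
      have "(\<Sum>b\<in>B. ((y - x) \<bullet> b) *\<^sub>R b) \<bullet> c = (\<Sum>b\<in>B. if b = c then (y - x) \<bullet> c else 0)"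
        unfolding inner_sum_left using B that
        by (intro sum.cong refl) (auto simp: inner_Basis)
      also have "\<dots> = (if c \<in> B then (y - x) \<bullet> c else 0)"
        using insert.hyps by simp
      finally show ?thesis by (simp add: X_def inner_add_left inner_diff_left)
    qed
    have "norm (f (X + h *\<^sub>R b) - f (X + 0 *\<^sub>R b)) \<le> L * \<bar>h - 0\<bar>"
    proof (rule partial_deriv_bound)
      show "(\<lambda>s. f (x + s *\<^sub>R b)) differentiable (at 0)" for x by (rule d[OF b])
      fix s assume s: "s \<in> closed_segment 0 h"
      have "coord_between x y (X + s *\<^sub>R b)"
        unfolding coord_between_def
      proof
        fix c :: 'a assume c: "c \<in> Basis"
        show "min (x \<bullet> c) (y \<bullet> c) \<le> (X + s *\<^sub>R b) \<bullet> c \<and> (X + s *\<^sub>R b) \<bullet> c \<le> max (x \<bullet> c) (y \<bullet> c)"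
          using s insert.hyps X[OF c] b c
          by (auto simp: inner_add_left inner_Basis h_def closed_segment_eq_real_ivl inner_diff_left min_def max_def split: if_splits)
      qed
      then show "norm (partial_deriv b f (X + s *\<^sub>R b)) \<le> L" by (rule L[OF b])
    qed
    then have 1: "norm (f (X + h *\<^sub>R b) - f X) \<le> L * \<bar>h\<bar>" by simp
    have eq: "x + (\<Sum>b\<in>insert b B. ((y - x) \<bullet> b) *\<^sub>R b) = X + h *\<^sub>R b"
      using insert.hyps by (simp add: X_def h_def add_ac)
    have "norm (f (X + h *\<^sub>R b) - f x) \<le> norm (f (X + h *\<^sub>R b) - f X) + norm (f X - f x)"
      by (metis diff_add_cancel diff_add_eq norm_triangle_ineq add_diff_eq)
    also have "\<dots> \<le> L * \<bar>h\<bar> + L * (\<Sum>b\<in>B. \<bar>(y - x) \<bullet> b\<bar>)"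
      using 1 insert.IH B unfolding X_def by (intro add_mono) auto
    finally show ?case
      unfolding eq using insert.hyps by (simp add: h_def distrib_left)
  qed simp
  from this[of Basis] show ?thesis by (simp add: euclidean_representation)
qed

definition wt :: "'a::real_normed_vector \<times> 'a \<Rightarrow> real" where
  "wt z = 1 + norm (fst z) + norm (snd z)"

lemma wt_ge_1: "wt z \<ge> 1"
  by (simp add: wt_def)

text \<open>Moving one coordinate at a time, the path between two dilates of \<open>(\<xi>, \<eta>)\<close> with factors at
  least \<open>1\<close> never comes closer to the origin than \<open>(\<xi>, \<eta>)\<close>, so decay of the partial derivatives
  alone controls the difference and no total derivative is needed.\<close>

lemma wt_coord_between:
  fixes \<xi> \<eta> :: "'a::euclidean_space"
  assumes st: "s \<ge> 1" "s' \<ge> 1" "t \<ge> 1" "t' \<ge> 1"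
    and z: "coord_between (s *\<^sub>R \<xi>, s' *\<^sub>R \<eta>) (t *\<^sub>R \<xi>, t' *\<^sub>R \<eta>) z"
  shows "wt (\<xi>, \<eta>) \<le> wt z"
proof -
  \<comment> \<open>In each coordinate both dilates lie on the same side of 0 as c and at least as
    far out, so every value between them does too.\<close>
  have r: "\<bar>c\<bar> \<le> \<bar>v\<bar>" if "min (s * c) (t * c) \<le> v" "v \<le> max (s * c) (t * c)" "s \<ge> 1" "t \<ge> 1" for s t c v :: real
  proof (cases "c \<ge> 0")
    case True
    then have "c \<le> s * c" "c \<le> t * c" using that mult_right_mono[of 1 s c] mult_right_mono[of 1 t c] by auto
    then have "c \<le> min (s * c) (t * c)" by simp
    with that True show ?thesis by linarith
  next
    case False
    then have "c \<ge> s * c" "c \<ge> t * c"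
      using that mult_right_mono_neg[of 1 s c] mult_right_mono_neg[of 1 t c] by auto
    then have "max (s * c) (t * c) \<le> c" by simp
    with that False show ?thesis by linarith
  qed
  have "norm \<xi> \<le> norm (fst z)"
  proof (rule norm_le_componentwise)
    fix b :: 'a assume b: "b \<in> Basis"
    then have "(b, 0) \<in> (Basis :: ('a \<times> 'a) set)" by (simp add: Basis_prod_def)
    then have "min (s * (\<xi> \<bullet> b)) (t * (\<xi> \<bullet> b)) \<le> fst z \<bullet> b \<and> fst z \<bullet> b \<le> max (s * (\<xi> \<bullet> b)) (t * (\<xi> \<bullet> b))"
      using z unfolding coord_between_def by (auto simp: inner_prod_def)
    then show "\<bar>\<xi> \<bullet> b\<bar> \<le> \<bar>fst z \<bullet> b\<bar>" using r st by blast
  qed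
  moreover have "norm \<eta> \<le> norm (snd z)"
  proof (rule norm_le_componentwise)
    fix b :: 'a assume b: "b \<in> Basis"
    then have "(0, b) \<in> (Basis :: ('a \<times> 'a) set)" by (simp add: Basis_prod_def)
    then have "min (s' * (\<eta> \<bullet> b)) (t' * (\<eta> \<bullet> b)) \<le> snd z \<bullet> b \<and> snd z \<bullet> b \<le> max (s' * (\<eta> \<bullet> b)) (t' * (\<eta> \<bullet> b))"
      using z unfolding coord_between_def by (auto simp: inner_prod_def)
    then show "\<bar>\<eta> \<bullet> b\<bar> \<le> \<bar>snd z \<bullet> b\<bar>" using r st by blast
  qed
  ultimately show ?thesis by (simp add: wt_def)
qed

lemma admissible_pos: "admissible a k (m :: 'a::euclidean_space \<times> 'a \<Rightarrow> complex) \<Longrightarrow> a > 0"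
  unfolding admissible_def by (smt (verit) divide_nonneg_nonneg of_nat_0_le_iff)

text \<open>There are finitely many coordinate lists of length at most k, so the sum of the absolute
  values of their constants serves for all of them.\<close>

lemma admissible_uniform:
  assumes "admissible a k m"
  obtains C where "C \<ge> 0"
    "\<And>bs z. set bs \<subseteq> Basis \<Longrightarrow> length bs \<le> k \<Longrightarrow> norm (fold partial_deriv bs m z) \<le> C * wt z powr (- a)"
proof -
  define S where "S = {bs. set bs \<subseteq> (Basis :: ('a \<times> 'a) set) \<and> length bs \<le> k}"
  have S: "finite S" unfolding S_def by (intro finite_lists_length_le) simp
  have "\<forall>bs\<in>S. \<exists>C. \<forall>z. norm (fold partial_deriv bs m z) \<le> C * wt z powr (- a)"
    using assms unfolding admissible_def S_def wt_def by (auto simp: split_paired_all)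
  then obtain C where C: "\<And>bs z. bs \<in> S \<Longrightarrow> norm (fold partial_deriv bs m z) \<le> C bs * wt z powr (- a)"
    by metis
  define D where "D = (\<Sum>bs\<in>S. \<bar>C bs\<bar>)"
  have "norm (fold partial_deriv bs m z) \<le> D * wt z powr (- a)" if "bs \<in> S" for bs z
  proof -
    have "C bs \<le> \<bar>C bs\<bar>" by simp
    also have "\<dots> \<le> D" unfolding D_def using S that by (intro member_le_sum) auto
    finally have "C bs * wt z powr (- a) \<le> D * wt z powr (- a)" by (intro mult_right_mono) auto
    with C[OF that, of z] show ?thesis by linarith
  qed
  moreover have "D \<ge> 0" unfolding D_def by (intro sum_nonneg) auto
  ultimately show ?thesis using that unfolding S_def by auto
qed

lemma sum_abs_inner_le: "(\<Sum>b\<in>Basis. \<bar>v \<bullet> b\<bar>) \<le> real DIM('b) * norm (v :: 'b::euclidean_space)"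
  using sum_bounded_above[of Basis "\<lambda>b. \<bar>v \<bullet> b\<bar>" "norm v"] by (simp add: Basis_le_norm)

lemma scaled_difference_sum:
  fixes \<xi> \<eta> :: "'a::euclidean_space"
  shows "(\<Sum>b\<in>Basis. \<bar>((t *\<^sub>R \<xi>, t' *\<^sub>R \<eta>) - (s *\<^sub>R \<xi>, s' *\<^sub>R \<eta>)) \<bullet> b\<bar>)
     \<le> real DIM('a \<times> 'a) * wt (\<xi>, \<eta>) * (\<bar>t - s\<bar> + \<bar>t' - s'\<bar>)"
proof -
  have "norm ((t *\<^sub>R \<xi>, t' *\<^sub>R \<eta>) - (s *\<^sub>R \<xi>, s' *\<^sub>R \<eta>)) = norm ((t - s) *\<^sub>R \<xi>, (t' - s') *\<^sub>R \<eta>)"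
    by (simp add: scaleR_diff_left)
  also have "\<dots> \<le> \<bar>t - s\<bar> * norm \<xi> + \<bar>t' - s'\<bar> * norm \<eta>"
    using norm_Pair_le[of "(t - s) *\<^sub>R \<xi>" "(t' - s') *\<^sub>R \<eta>"] by simp
  also have "\<dots> \<le> \<bar>t - s\<bar> * wt (\<xi>, \<eta>) + \<bar>t' - s'\<bar> * wt (\<xi>, \<eta>)"
    by (intro add_mono mult_left_mono) (auto simp: wt_def)
  finally have "norm ((t *\<^sub>R \<xi>, t' *\<^sub>R \<eta>) - (s *\<^sub>R \<xi>, s' *\<^sub>R \<eta>)) \<le> wt (\<xi>, \<eta>) * (\<bar>t - s\<bar> + \<bar>t' - s'\<bar>)"
    by (simp add: algebra_simps)
  then have "real DIM('a \<times> 'a) * norm ((t *\<^sub>R \<xi>, t' *\<^sub>R \<eta>) - (s *\<^sub>R \<xi>, s' *\<^sub>R \<eta>))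
      \<le> real DIM('a \<times> 'a) * (wt (\<xi>, \<eta>) * (\<bar>t - s\<bar> + \<bar>t' - s'\<bar>))"
    by (rule mult_left_mono) simp
  from order_trans[OF sum_abs_inner_le this] show ?thesis by (simp only: mult.assoc)
qed

lemma scaled_difference:
  fixes f :: "'a::euclidean_space \<times> 'a \<Rightarrow> complex"
  assumes d: "\<And>b x. b \<in> Basis \<Longrightarrow> (\<lambda>s. f (x + s *\<^sub>R b)) differentiable (at 0)"
    and L: "\<And>b z. b \<in> Basis \<Longrightarrow> norm (partial_deriv b f z) \<le> C * wt z powr (- a)"
    and a: "a \<ge> 0" and C: "C \<ge> 0" and st: "s \<ge> 1" "s' \<ge> 1" "t \<ge> 1" "t' \<ge> 1"
  shows "norm (f (t *\<^sub>R \<xi>, t' *\<^sub>R \<eta>) - f (s *\<^sub>R \<xi>, s' *\<^sub>R \<eta>))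
     \<le> C * real DIM('a \<times> 'a) * wt (\<xi>, \<eta>) powr (- a) * (wt (\<xi>, \<eta>) * (\<bar>t - s\<bar> + \<bar>t' - s'\<bar>))"
proof -
  have "norm (f (t *\<^sub>R \<xi>, t' *\<^sub>R \<eta>) - f (s *\<^sub>R \<xi>, s' *\<^sub>R \<eta>))
     \<le> C * wt (\<xi>, \<eta>) powr (- a) * (\<Sum>b\<in>Basis. \<bar>((t *\<^sub>R \<xi>, t' *\<^sub>R \<eta>) - (s *\<^sub>R \<xi>, s' *\<^sub>R \<eta>)) \<bullet> b\<bar>)"
  proof (rule coord_path_bound[OF d])
    fix b z :: "'a \<times> 'a"
    assume b: "b \<in> Basis" and z: "coord_between (s *\<^sub>R \<xi>, s' *\<^sub>R \<eta>) (t *\<^sub>R \<xi>, t' *\<^sub>R \<eta>) z"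
    have "wt z powr (- a) \<le> wt (\<xi>, \<eta>) powr (- a)"
      using wt_coord_between[OF st z] wt_ge_1[of "(\<xi>, \<eta>)"] a by (intro powr_mono2') auto
    with L[OF b, of z] C show "norm (partial_deriv b f z) \<le> C * wt (\<xi>, \<eta>) powr (- a)"
      by (meson mult_left_mono order_trans)
  qed
  also have "\<dots> \<le> C * wt (\<xi>, \<eta>) powr (- a) * (real DIM('a \<times> 'a) * wt (\<xi>, \<eta>) * (\<bar>t - s\<bar> + \<bar>t' - s'\<bar>))"
    using C by (intro mult_left_mono scaled_difference_sum) auto
  finally show ?thesis by (simp add: mult_ac)
qed

text \<open>The mixed difference is the increment in the first parameter of g(z) = f(z + c) - f(z).
  The partial derivatives of g are themselves increments of partial derivatives of f, so the path
  bound is used twice and second derivatives appear.\<close>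

lemma scaled_mixed_difference:
  fixes f :: "'a::euclidean_space \<times> 'a \<Rightarrow> complex"
  assumes d: "\<And>b x. b \<in> Basis \<Longrightarrow> (\<lambda>s. f (x + s *\<^sub>R b)) differentiable (at 0)"
    and d2: "\<And>b c x. b \<in> Basis \<Longrightarrow> c \<in> Basis \<Longrightarrow> (\<lambda>s. partial_deriv b f (x + s *\<^sub>R c)) differentiable (at 0)"
    and L: "\<And>b c z. b \<in> Basis \<Longrightarrow> c \<in> Basis \<Longrightarrow> norm (partial_deriv c (partial_deriv b f) z) \<le> C * wt z powr (- a)"
    and a: "a \<ge> 0" and C: "C \<ge> 0" and st: "s \<ge> 1" "s' \<ge> 1" "t \<ge> 1" "t' \<ge> 1"
  shows "norm ((f (t *\<^sub>R \<xi>, t' *\<^sub>R \<eta>) - f (t *\<^sub>R \<xi>, s' *\<^sub>R \<eta>)) - (f (s *\<^sub>R \<xi>, t' *\<^sub>R \<eta>) - f (s *\<^sub>R \<xi>, s' *\<^sub>R \<eta>)))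
     \<le> C * (real DIM('a \<times> 'a))\<^sup>2 * wt (\<xi>, \<eta>) powr (- a) * (wt (\<xi>, \<eta>) * \<bar>t - s\<bar>) * (wt (\<xi>, \<eta>) * \<bar>t' - s'\<bar>)"
proof -
  define W where "W = wt (\<xi>, \<eta>)"
  define D where "D = real DIM('a \<times> 'a)"
  have W: "W \<ge> 1" unfolding W_def by (rule wt_ge_1)
  have D: "D \<ge> 0" unfolding D_def by simp
  \<comment> \<open>The shift that changes the second factor from s' to t'; it is the same at every
    value of the first factor.\<close>
  define c where "c = (0::'a, (t' - s') *\<^sub>R \<eta>)"
  define g where "g = (\<lambda>z. f (z + c) - f z)"
  have g: "((\<lambda>s. g (x + s *\<^sub>R b)) has_vector_derivative partial_deriv b f (x + c) - partial_deriv b f x) (at 0)"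
    if b: "b \<in> Basis" for b x
    using has_vector_derivative_diff[OF partial_deriv_has_vector_derivative[OF d[OF b], of "x + c" 0]
        partial_deriv_has_vector_derivative[OF d[OF b], of x 0]]
    by (simp add: g_def add_ac)
  have "norm (g (t *\<^sub>R \<xi>, s' *\<^sub>R \<eta>) - g (s *\<^sub>R \<xi>, s' *\<^sub>R \<eta>))
      \<le> C * W powr (- a) * (D * W * \<bar>t' - s'\<bar>) * (\<Sum>b\<in>Basis. \<bar>((t *\<^sub>R \<xi>, s' *\<^sub>R \<eta>) - (s *\<^sub>R \<xi>, s' *\<^sub>R \<eta>)) \<bullet> b\<bar>)"
  proof (rule coord_path_bound)
    fix b x :: "'a \<times> 'a"
    assume b: "b \<in> Basis"
    show "(\<lambda>s. g (x + s *\<^sub>R b)) differentiable (at 0)"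
      using g[OF b] by (rule differentiableI_vector)
  next
    fix b z :: "'a \<times> 'a"
    assume b: "b \<in> Basis" and z: "coord_between (s *\<^sub>R \<xi>, s' *\<^sub>R \<eta>) (t *\<^sub>R \<xi>, s' *\<^sub>R \<eta>) z"
    have pd: "partial_deriv b g z = partial_deriv b f (z + c) - partial_deriv b f z"
      unfolding partial_deriv_def[of b g] by (rule vector_derivative_at[OF g[OF b]])
    have "norm (partial_deriv b f (z + c) - partial_deriv b f z) \<le> C * W powr (- a) * (\<Sum>b\<in>Basis. \<bar>(z + c - z) \<bullet> b\<bar>)"
    proof (rule coord_path_bound)
      fix e v :: "'a \<times> 'a"
      assume e: "e \<in> Basis" and v: "coord_between z (z + c) v"
      \<comment> \<open>The inner box is a translate in the second component of a point of the outer
        one, so both lie in the full box between the extreme dilates, where the weight is controlled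
        from below.\<close>
      have "coord_between (s *\<^sub>R \<xi>, s' *\<^sub>R \<eta>) (t *\<^sub>R \<xi>, t' *\<^sub>R \<eta>) v"
        unfolding coord_between_def
      proof
        fix u :: "'a \<times> 'a" assume u: "u \<in> Basis"
        have zz: "min ((s *\<^sub>R \<xi>, s' *\<^sub>R \<eta>) \<bullet> u) ((t *\<^sub>R \<xi>, s' *\<^sub>R \<eta>) \<bullet> u) \<le> z \<bullet> u"
            "z \<bullet> u \<le> max ((s *\<^sub>R \<xi>, s' *\<^sub>R \<eta>) \<bullet> u) ((t *\<^sub>R \<xi>, s' *\<^sub>R \<eta>) \<bullet> u)"
          using z u unfolding coord_between_def by auto
        have vv: "min (z \<bullet> u) ((z + c) \<bullet> u) \<le> v \<bullet> u" "v \<bullet> u \<le> max (z \<bullet> u) ((z + c) \<bullet> u)"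
          using v u unfolding coord_between_def by auto
        consider w where "u = (w, 0)" | w where "u = (0, w)"
          using u by (auto simp: Basis_prod_def)
        then show "min ((s *\<^sub>R \<xi>, s' *\<^sub>R \<eta>) \<bullet> u) ((t *\<^sub>R \<xi>, t' *\<^sub>R \<eta>) \<bullet> u) \<le> v \<bullet> u \<and>
            v \<bullet> u \<le> max ((s *\<^sub>R \<xi>, s' *\<^sub>R \<eta>) \<bullet> u) ((t *\<^sub>R \<xi>, t' *\<^sub>R \<eta>) \<bullet> u)"
        proof cases
          case 1
          then show ?thesis using zz vv by (simp add: c_def inner_add_left)
        next
          case 2
          then show ?thesis using zz vv by (simp add: c_def inner_add_left algebra_simps)
        qed
      qed
      from wt_coord_between[OF st this] have "wt v powr (- a) \<le> W powr (- a)"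
        unfolding W_def using wt_ge_1[of "(\<xi>, \<eta>)"] a by (intro powr_mono2') auto
      with L[OF b e, of v] C show "norm (partial_deriv e (partial_deriv b f) v) \<le> C * W powr (- a)"
        by (meson mult_left_mono order_trans)
    qed (rule d2[OF b])
    also have "(\<Sum>b\<in>Basis. \<bar>(z + c - z) \<bullet> b\<bar>) = (\<Sum>b\<in>Basis. \<bar>((s *\<^sub>R \<xi>, t' *\<^sub>R \<eta>) - (s *\<^sub>R \<xi>, s' *\<^sub>R \<eta>)) \<bullet> b\<bar>)"
      by (simp add: c_def scaleR_diff_left)
    also have "C * W powr (- a) * \<dots> \<le> C * W powr (- a) * (D * W * \<bar>t' - s'\<bar>)"
      using C scaled_difference_sum[of s \<xi> t' \<eta> s s'] unfolding D_def W_def by (intro mult_left_mono) auto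
    finally show "norm (partial_deriv b g z) \<le> C * W powr (- a) * (D * W * \<bar>t' - s'\<bar>)"
      unfolding pd .
  qed
  also have "\<dots> \<le> C * W powr (- a) * (D * W * \<bar>t' - s'\<bar>) * (D * W * \<bar>t - s\<bar>)"
    using C D W scaled_difference_sum[of t \<xi> s' \<eta> s s'] unfolding D_def W_def
    by (intro mult_left_mono) auto
  finally have "norm (g (t *\<^sub>R \<xi>, s' *\<^sub>R \<eta>) - g (s *\<^sub>R \<xi>, s' *\<^sub>R \<eta>))
      \<le> C * W powr (- a) * (D * W * \<bar>t' - s'\<bar>) * (D * W * \<bar>t - s\<bar>)" .
  moreover have "g (r *\<^sub>R \<xi>, s' *\<^sub>R \<eta>) = f (r *\<^sub>R \<xi>, t' *\<^sub>R \<eta>) - f (r *\<^sub>R \<xi>, s' *\<^sub>R \<eta>)" for r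
    by (simp add: g_def c_def scaleR_diff_left)
  ultimately show ?thesis
    unfolding D_def W_def by (simp add: power2_eq_square mult_ac)
qed

text \<open>min 1 y \<le> y^\<theta> for exponents in [0, 1]. For y \<le> 1 the bound with y is
  used, otherwise the trivial one.\<close>

lemma interpolate_min:
  fixes v A y \<theta> :: real
  assumes "A \<ge> 0" "v \<le> A" "v \<le> A * y" "y \<ge> 0" "0 \<le> \<theta>" "\<theta> \<le> 1"
  shows "v \<le> A * y powr \<theta>"
proof (cases "y = 0")
  case False
  show ?thesis
  proof (cases "y \<le> 1")
    case True
    have "y powr 1 \<le> y powr \<theta>" using True False assms by (intro powr_mono') auto
    with False assms have "A * y \<le> A * y powr \<theta>" by (intro mult_left_mono) auto
    with assms show ?thesis by linarith
  next
    case False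
    have "1 \<le> y powr \<theta>" using False assms by (intro ge_one_powr_ge_zero) auto
    with assms have "A * 1 \<le> A * y powr \<theta>" by (intro mult_left_mono) auto
    with assms show ?thesis by linarith
  qed
qed (use assms in auto)

text \<open>Interpolating in y, once without and once with the factor y', supplies the two bounds
  needed for interpolating in y'.\<close>

lemma interpolate_min2:
  fixes v A y y' \<theta> \<theta>' :: real
  assumes "A \<ge> 0" "v \<le> A" "v \<le> A * y" "v \<le> A * y'" "v \<le> A * y * y'" "y \<ge> 0" "y' \<ge> 0"
    "0 \<le> \<theta>" "\<theta> \<le> 1" "0 \<le> \<theta>'" "\<theta>' \<le> 1"
  shows "v \<le> A * y powr \<theta> * y' powr \<theta>'"
proof (rule interpolate_min)
  show "v \<le> A * y powr \<theta>" using assms by (intro interpolate_min) auto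
  have "v \<le> (A * y') * y powr \<theta>"
    using assms by (intro interpolate_min) (auto simp: mult_ac)
  then show "v \<le> A * y powr \<theta> * y'" by (simp add: mult_ac)
qed (use assms in auto)

subsection \<open>Dyadic chaining\<close>

text \<open>The chaining approximations of \<open>t\<close> are the dyadic points \<open>cell k t / 2 ^ k\<close>, which need not lie in
  the index set but stay in \<open>{1..2}\<close>. Since \<open>cell k t div 2\<close> is the cell of level \<open>k - 1\<close>, the
  increment of level \<open>k\<close> depends on \<open>t\<close> only through \<open>cell k t\<close>.\<close>

definition cell :: "nat \<Rightarrow> real \<Rightarrow> nat" where
  "cell k t = nat \<lfloor>2 ^ k * t\<rfloor>"

text \<open>A functional of \<phi>, so that increments in two variables can be nested. Level 0 keeps
  the value itself, which makes the increments along a chain telescope to \<phi> at the finest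
  dyadic point.\<close>

definition dyadic_incr :: "nat \<Rightarrow> nat \<Rightarrow> (real \<Rightarrow> complex) \<Rightarrow> complex" where
  "dyadic_incr k q \<phi> = (if k = 0 then \<phi> (real q) else \<phi> (real q / 2 ^ k) - \<phi> (real (q div 2) / 2 ^ (k - 1)))"

lemma cell_div_2:
  assumes "t \<ge> 0"
  shows "cell (Suc k) t div 2 = cell k t"
proof -
  have "\<lfloor>2 ^ k * t\<rfloor> = \<lfloor>2 ^ Suc k * t / real_of_int 2\<rfloor>" by simp
  also have "\<dots> = \<lfloor>2 ^ Suc k * t\<rfloor> div 2" by (rule floor_divide_real_eq_div) simp
  finally show ?thesis unfolding cell_def using assms by (simp add: nat_div_distrib)
qed

lemma cell_bounds:
  assumes "t \<ge> 0"
  shows "real (cell k t) / 2 ^ k \<le> t" "t < real (cell k t) / 2 ^ k + 1 / 2 ^ k"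
proof -
  have eq: "real (cell k t) = of_int \<lfloor>2 ^ k * t\<rfloor>" unfolding cell_def using assms by simp
  have "real (cell k t) \<le> 2 ^ k * t" "2 ^ k * t < real (cell k t) + 1"
    unfolding eq by linarith+
  then show "real (cell k t) / 2 ^ k \<le> t" "t < real (cell k t) / 2 ^ k + 1 / 2 ^ k"
    by (simp_all add: field_simps)
qed

lemma cell_range:
  assumes "t \<in> {1..2}"
  shows "cell k t \<in> {2 ^ k..2 * 2 ^ k}"
proof -
  have "(2::real) ^ k * 1 \<le> 2 ^ k * t" "2 ^ k * t \<le> 2 ^ k * 2"
    using assms by (intro mult_left_mono; simp)+
  then have "\<lfloor>(2::real) ^ k\<rfloor> \<le> \<lfloor>2 ^ k * t\<rfloor>" "\<lfloor>2 ^ k * t\<rfloor> \<le> \<lfloor>(2::real) ^ k * 2\<rfloor>"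
    by (intro floor_mono; simp)+
  moreover have "\<lfloor>(2::real) ^ k\<rfloor> = 2 ^ k" "\<lfloor>(2::real) ^ k * 2\<rfloor> = 2 ^ k * 2"
    by (metis floor_of_int of_int_power of_int_numeral, metis floor_of_int of_int_power of_int_numeral of_int_mult)
  ultimately have "2 ^ k \<le> \<lfloor>2 ^ k * t\<rfloor>" "\<lfloor>2 ^ k * t\<rfloor> \<le> 2 ^ k * 2" by simp_all
  then show ?thesis
    unfolding cell_def by (auto simp: le_nat_iff nat_le_iff mult.commute)
qed

lemma cell_grid:
  assumes "q \<in> {2 ^ k..2 * 2 ^ k}"
  shows "real q / 2 ^ k \<in> {1..2}"
proof -
  have "real (2 ^ k) \<le> real q" "real q \<le> real (2 * 2 ^ k)"
    using assms by (simp_all only: of_nat_le_iff atLeastAtMost_iff)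
  then show ?thesis by (simp add: field_simps)
qed

lemma cell_tendsto:
  assumes "t \<ge> 0"
  shows "(\<lambda>k. real (cell k t) / 2 ^ k) \<longlonglongrightarrow> t"
proof (rule tendsto_sandwich[of "\<lambda>k. t - (1 / 2) ^ k" _ _ "\<lambda>_. t"])
  have "(\<lambda>k. t - (1 / 2) ^ k) \<longlonglongrightarrow> t - 0"
    by (intro tendsto_intros LIMSEQ_power_zero) auto
  then show "(\<lambda>k. t - (1 / 2) ^ k) \<longlonglongrightarrow> t" by simp
  show "eventually (\<lambda>k. t - (1 / 2) ^ k \<le> real (cell k t) / 2 ^ k) sequentially"
    using cell_bounds(2)[OF assms] by (intro always_eventually allI) (smt (verit) power_one_over)
  show "eventually (\<lambda>k. real (cell k t) / 2 ^ k \<le> t) sequentially"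
    using cell_bounds(1)[OF assms] by simp
qed simp

lemma dyadic_incr_telescope:
  assumes "t \<ge> 0"
  shows "(\<Sum>k\<le>n. dyadic_incr k (cell k t) \<phi>) = \<phi> (real (cell n t) / 2 ^ n)"
  by (induction n) (use cell_div_2[OF assms] in \<open>auto simp: dyadic_incr_def\<close>)

text \<open>Cauchy-Schwarz against the summable weights r^(-k), whose total is r/(r-1). The price
  r^k on level k is later paid from the geometric gain of that level.\<close>

lemma norm_sum_squared_le:
  fixes d :: "nat \<Rightarrow> complex" and r :: real
  assumes r: "r > 1"
  shows "(norm (\<Sum>k\<le>n. d k))\<^sup>2 \<le> r / (r - 1) * (\<Sum>k\<le>n. r ^ k * (norm (d k))\<^sup>2)"
proof -
  have "(norm (\<Sum>k\<le>n. d k))\<^sup>2 \<le> (\<Sum>k\<le>n. norm (d k))\<^sup>2"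
    by (intro power_mono norm_sum) auto
  also have "(\<Sum>k\<le>n. norm (d k)) = (\<Sum>k\<le>n. sqrt ((1 / r) ^ k) * (sqrt (r ^ k) * norm (d k)))"
    using r by (intro sum.cong refl) (simp add: real_sqrt_mult[symmetric] mult.assoc[symmetric] power_mult_distrib[symmetric])
  also have "\<dots>\<^sup>2 \<le> (\<Sum>k\<le>n. (sqrt ((1 / r) ^ k))\<^sup>2) * (\<Sum>k\<le>n. (sqrt (r ^ k) * norm (d k))\<^sup>2)"
    by (rule Cauchy_Schwarz_ineq_sum)
  also have "(\<Sum>k\<le>n. (sqrt ((1 / r) ^ k))\<^sup>2) = (\<Sum>k\<le>n. (1 / r) ^ k)"
    using r by simp
  also have "(\<Sum>k\<le>n. (sqrt (r ^ k) * norm (d k))\<^sup>2) = (\<Sum>k\<le>n. r ^ k * (norm (d k))\<^sup>2)"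
    using r by (simp add: power_mult_distrib)
  also have "(\<Sum>k\<le>n. (1 / r) ^ k) \<le> (\<Sum>k. (1 / r) ^ k)"
    using r by (intro sum_le_suminf summable_geometric) auto
  also have "(\<Sum>k. (1 / r) ^ k) = r / (r - 1)"
    using r by (subst suminf_geometric) (auto simp: field_simps)
  finally show ?thesis
    using r by (simp add: mult_right_mono sum_nonneg)
qed

text \<open>The partial sums telescope to \<phi> at the dyadic approximations of t; the bound is
  uniform in n and passes to the limit.\<close>

lemma chaining:
  fixes \<phi> :: "real \<Rightarrow> complex"
  assumes r: "r > 1" and t: "t \<ge> 0"
    and lim: "(\<lambda>n. \<phi> (real (cell n t) / 2 ^ n)) \<longlonglongrightarrow> \<phi> t"
  shows "ennreal ((norm (\<phi> t))\<^sup>2) \<le>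
     ennreal (r / (r - 1)) * (\<Sum>k. ennreal (r ^ k) * ennreal ((norm (dyadic_incr k (cell k t) \<phi>))\<^sup>2))"
proof (rule LIMSEQ_le_const2)
  show "(\<lambda>n. ennreal ((norm (\<phi> (real (cell n t) / 2 ^ n)))\<^sup>2)) \<longlonglongrightarrow> ennreal ((norm (\<phi> t))\<^sup>2)"
    by (intro tendsto_ennrealI tendsto_power tendsto_norm lim)
  have "ennreal ((norm (\<phi> (real (cell n t) / 2 ^ n)))\<^sup>2) \<le>
     ennreal (r / (r - 1)) * (\<Sum>k. ennreal (r ^ k) * ennreal ((norm (dyadic_incr k (cell k t) \<phi>))\<^sup>2))" for n
  proof -
    have "ennreal ((norm (\<phi> (real (cell n t) / 2 ^ n)))\<^sup>2)
        \<le> ennreal (r / (r - 1) * (\<Sum>k\<le>n. r ^ k * (norm (dyadic_incr k (cell k t) \<phi>))\<^sup>2))"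
      unfolding dyadic_incr_telescope[OF t, symmetric] by (intro ennreal_leI norm_sum_squared_le r)
    also have "\<dots> = ennreal (r / (r - 1)) * (\<Sum>k\<le>n. ennreal (r ^ k * (norm (dyadic_incr k (cell k t) \<phi>))\<^sup>2))"
      using r by (subst ennreal_mult) (auto simp: sum_nonneg sum_ennreal)
    also have "(\<Sum>k\<le>n. ennreal (r ^ k * (norm (dyadic_incr k (cell k t) \<phi>))\<^sup>2))
        = (\<Sum>k\<le>n. ennreal (r ^ k) * ennreal ((norm (dyadic_incr k (cell k t) \<phi>))\<^sup>2))"
      using r by (intro sum.cong refl ennreal_mult) auto
    also have "\<dots> \<le> (\<Sum>k. ennreal (r ^ k) * ennreal ((norm (dyadic_incr k (cell k t) \<phi>))\<^sup>2))"
      by (intro sum_le_suminf) auto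
    finally show ?thesis by (simp add: mult_left_mono)
  qed
  then show "\<exists>N. \<forall>n\<ge>N. ennreal ((norm (\<phi> (real (cell n t) / 2 ^ n)))\<^sup>2) \<le>
     ennreal (r / (r - 1)) * (\<Sum>k. ennreal (r ^ k) * ennreal ((norm (dyadic_incr k (cell k t) \<phi>))\<^sup>2))"
    by blast
qed

subsection \<open>Counting dyadic cells\<close>

lemma finite_cells: "E \<subseteq> {1..2} \<Longrightarrow> finite (cell k ` E)"
  by (rule finite_subset[of _ "{2 ^ k..2 * 2 ^ k}"]) (use cell_range in auto)

lemma card_cells_le: 
  assumes "E \<subseteq> {1..2}"
  shows "card (cell k ` E) \<le> 2 * 2 ^ k"
proof -
  have "card (cell k ` E) \<le> card {2 ^ k..2 * 2 ^ k :: nat}"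
    using assms cell_range by (intro card_mono) auto
  also have "\<dots> \<le> 2 * 2 ^ k" by simp
  finally show ?thesis .
qed

text \<open>\<open>LEAST\<close> says something only if a finite cover exists; the occupied dyadic
  points provide one.\<close>

lemma covering_number_attained:
  assumes "E \<subseteq> {1..2}"
  obtains A where "finite A" "card A = covering_number E (1 / 2 ^ k)" "E \<subseteq> (\<Union>a\<in>A. {a..a + 1 / 2 ^ k})"
proof -
  define A where "A = (\<lambda>q. real q / 2 ^ k) ` cell k ` E"
  have "E \<subseteq> (\<Union>a\<in>A. {a..a + 1 / 2 ^ k})"
  proof
    fix t assume t: "t \<in> E"
    then have "t \<ge> 0" using assms by auto
    from cell_bounds[OF this, of k] t show "t \<in> (\<Union>a\<in>A. {a..a + 1 / 2 ^ k})"
      by (auto simp: A_def intro!: bexI[of _ t])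
  qed
  moreover have "finite A" using finite_cells[OF assms] by (simp add: A_def)
  ultimately have "\<exists>n A. finite A \<and> card A = n \<and> E \<subseteq> (\<Union>a\<in>A. {a..a + 1 / 2 ^ k})" by blast
  from LeastI_ex[OF this] that show ?thesis unfolding covering_number_def by blast
qed

text \<open>A closed interval of length 2^(-k) meets at most two consecutive cells of level
  k.\<close>

lemma card_cells_le_covering_number:
  assumes "E \<subseteq> {1..2}"
  shows "card (cell k ` E) \<le> 2 * covering_number E (1 / 2 ^ k)"
proof -
  obtain A where A: "finite A" "card A = covering_number E (1 / 2 ^ k)" "E \<subseteq> (\<Union>a\<in>A. {a..a + 1 / 2 ^ k})"
    using covering_number_attained[OF assms] .
  have "cell k ` E \<subseteq> (\<Union>a\<in>A. {nat \<lfloor>2 ^ k * a\<rfloor>, nat (\<lfloor>2 ^ k * a\<rfloor> + 1)})"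
  proof clarify
    fix t assume "t \<in> E"
    then obtain a where a: "a \<in> A" "a \<le> t" "t \<le> a + 1 / 2 ^ k" using A(3) by auto
    have "2 ^ k * a \<le> 2 ^ k * t" using a by simp
    moreover have "2 ^ k * t \<le> 2 ^ k * (a + 1 / 2 ^ k)" using a by (intro mult_left_mono) auto
    then have "2 ^ k * t \<le> 2 ^ k * a + 1" by (simp add: distrib_left)
    ultimately have "\<lfloor>2 ^ k * t\<rfloor> = \<lfloor>2 ^ k * a\<rfloor> \<or> \<lfloor>2 ^ k * t\<rfloor> = \<lfloor>2 ^ k * a\<rfloor> + 1"
      by linarith
    then show "cell k t \<in> (\<Union>a\<in>A. {nat \<lfloor>2 ^ k * a\<rfloor>, nat (\<lfloor>2 ^ k * a\<rfloor> + 1)})"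
      using a(1) unfolding cell_def by auto
  qed
  then have "card (cell k ` E) \<le> card (\<Union>a\<in>A. {nat \<lfloor>2 ^ k * a\<rfloor>, nat (\<lfloor>2 ^ k * a\<rfloor> + 1)})"
    using A(1) by (intro card_mono) auto
  also have "\<dots> \<le> (\<Sum>a\<in>A. card {nat \<lfloor>2 ^ k * a\<rfloor>, nat (\<lfloor>2 ^ k * a\<rfloor> + 1)})"
    by (rule card_UN_le[OF A(1)])
  also have "\<dots> \<le> (\<Sum>a\<in>A. 2)"
    by (intro sum_mono) (auto simp: card_insert_if)
  finally show ?thesis using A(2) by simp
qed

lemma minkowski_dim_nonneg:
  assumes "E \<noteq> {}" and dim: "upper_minkowski_dim E = ereal \<beta>"
  shows "\<beta> \<ge> 0"
proof -
  have "eventually (\<lambda>\<delta>::real. \<delta> \<in> {0<..<1}) (at_right 0)"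
    by (rule eventually_at_right_real) simp
  then have "eventually (\<lambda>\<delta>. 0 \<le> ereal (ln (real (covering_number E \<delta>)) / ln (1 / \<delta>))) (at_right 0)"
  proof eventually_elim
    case (elim \<delta>)
    \<comment> \<open>For n = 0 this rests on the convention ln 0 = 0.\<close>
    have "ln (real n) \<ge> 0" for n :: nat by (cases n) auto
    moreover have "ln (1 / \<delta>) \<ge> 0" using elim by (intro ln_ge_zero) auto
    ultimately show ?case by simp
  qed
  then have "0 \<le> upper_minkowski_dim E"
    unfolding upper_minkowski_dim_def by (intro le_Limsup) (simp_all add: trivial_limit_at_right_real)
  then show ?thesis using dim by simp
qed

text \<open>The upper dimension controls covering numbers at all sufficiently small scales. The
  minimum with 1 reflects the trivial count of cells in [1, 2].\<close>

lemma card_cells_minkowski: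
  assumes E: "E \<subseteq> {1..2}" "E \<noteq> {}" and dim: "upper_minkowski_dim E = ereal \<beta>" and e: "e > 0"
  obtains c where "c \<ge> 0" "\<And>k. real (card (cell k ` E)) \<le> c * 2 powr (real k * min (\<beta> + e) 1)"
proof -
  define N where "N = (\<lambda>k. covering_number E (1 / 2 ^ k))"
  have "Limsup (at_right 0) (\<lambda>\<delta>. ereal (ln (real (covering_number E \<delta>)) / ln (1 / \<delta>))) < ereal (\<beta> + e)"
    using dim e unfolding upper_minkowski_dim_def by simp
  from Limsup_lessD[OF this]
  have "eventually (\<lambda>\<delta>. ln (real (covering_number E \<delta>)) / ln (1 / \<delta>) < \<beta> + e) (at_right 0)" by simp
  then obtain d where d: "d > 0" "\<And>\<delta>. 0 < \<delta> \<Longrightarrow> \<delta> < d \<Longrightarrow> ln (real (covering_number E \<delta>)) / ln (1 / \<delta>) < \<beta> + e"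
    unfolding eventually_at_right_field by auto
  obtain k0 where k0: "(1 / 2 :: real) ^ k0 < d" using real_arch_pow_inv[OF d(1), of "1 / 2"] by auto
  have Nk: "real (N k) \<le> 2 powr (k * (\<beta> + e))" if k: "k \<ge> k0 + 1" for k
  proof (cases "N k = 0")
    case False
    have "(1 / 2 :: real) ^ k \<le> (1 / 2) ^ k0" using k by (intro power_decreasing) auto
    with k0 have "1 / 2 ^ k < d" by (simp add: power_one_over)
    then have "ln (real (N k)) / ln (1 / (1 / 2 ^ k)) < \<beta> + e"
      unfolding N_def by (intro d(2)) auto
    then have "ln (real (N k)) / (real k * ln 2) < \<beta> + e" by (simp add: ln_realpow)
    then have "ln (real (N k)) < real k * (\<beta> + e) * ln 2"
      using k by (simp add: field_simps)
    then have "real (N k) \<le> exp (real k * (\<beta> + e) * ln 2)"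
      using False by (metis exp_le_cancel_iff exp_ln less_eq_real_def of_nat_0_less_iff neq0_conv)
    then show ?thesis by (simp add: powr_def)
  qed simp
  \<comment> \<open>The finitely many coarse levels, about which the limsup is silent, are absorbed
    into the constant.\<close>
  define C where "C = 1 + (\<Sum>j<k0 + 1. real (N j) / 2 powr (j * (\<beta> + e)))"
  have C: "C \<ge> 1" unfolding C_def by (simp add: sum_nonneg)
  have NC: "real (N k) \<le> C * 2 powr (k * (\<beta> + e))" for k
  proof (cases "k \<ge> k0 + 1")
    case True
    have "1 * 2 powr (k * (\<beta> + e)) \<le> C * 2 powr (k * (\<beta> + e))"
      using C by (intro mult_right_mono) auto
    with Nk[OF True] show ?thesis by linarith
  next
    case False
    then have "real (N k) / 2 powr (k * (\<beta> + e)) \<le> (\<Sum>j<k0 + 1. real (N j) / 2 powr (j * (\<beta> + e)))"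
      by (intro member_le_sum) auto
    then have "real (N k) / 2 powr (k * (\<beta> + e)) \<le> C" unfolding C_def by simp
    then show ?thesis by (simp add: divide_le_eq)
  qed
  \<comment> \<open>One constant for both cases: 2 C from the covering number, 2 from the trivial
    count.\<close>
  have "real (card (cell k ` E)) \<le> (2 * C + 2) * 2 powr (real k * min (\<beta> + e) 1)" for k
  proof (cases "\<beta> + e \<le> 1")
    case True
    have "real (card (cell k ` E)) \<le> 2 * real (N k)"
      using card_cells_le_covering_number[OF E(1), of k] unfolding N_def
      by (metis of_nat_le_iff of_nat_mult of_nat_numeral)
    also have "\<dots> \<le> 2 * (C * 2 powr (k * (\<beta> + e)))" using NC by (intro mult_left_mono) auto
    also have "\<dots> \<le> (2 * C + 2) * 2 powr (k * (\<beta> + e))" by (simp add: algebra_simps)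
    finally show ?thesis using True by (simp add: min_def)
  next
    case False
    have "real (card (cell k ` E)) \<le> real (2 * 2 ^ k)"
      using card_cells_le[OF E(1), of k] by (simp only: of_nat_le_iff)
    also have "\<dots> = 2 * 2 powr (real k)" by (simp add: powr_realpow)
    also have "\<dots> \<le> (2 * C + 2) * 2 powr (real k)" using C by (intro mult_right_mono) auto
    finally show ?thesis using False by (simp add: min_def)
  qed
  then show ?thesis using that[of "2 * C + 2"] C by auto
qed

subsection \<open>Maximal estimates for families of multipliers\<close>

text \<open>\<open>C\<close> depends on neither the multiplier nor the functions; the multiplier
  enters through \<open>B\<close> alone. All increments of all levels can therefore share the
  constant.\<close>

lemma bilinear_estimate:
  fixes p q b :: real
  assumes p: "1 < p" "p \<le> 2" and q: "1 < q" "q \<le> 2"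
    and b: "b > DIM('a::euclidean_space) * (1 / p + 1 / q - 1 / 2)"
  obtains C where "C \<ge> 0" and
    "\<And>(f :: 'a \<Rightarrow> complex) g M B. f \<in> test_functions \<Longrightarrow> g \<in> test_functions \<Longrightarrow>
       M \<in> borel_measurable borel \<Longrightarrow> (\<And>z. norm (M z) \<le> B * wt z powr (- b)) \<Longrightarrow>
       (\<integral>\<^sup>+x. ennreal ((norm (bilinear_op M (fourier f) (fourier g) x))\<^sup>2) \<partial>lborel)
         \<le> ennreal (C * B\<^sup>2 * ((LINT x|lborel. norm (f x) powr p) powr (2 / p) *
                               (LINT x|lborel. norm (g x) powr q) powr (2 / q)))"
proof -
  define d where "d = real DIM('a)"
  \<comment> \<open>A quarter of the slack: one \<open>e\<close> raises each of \<sigma>1, \<sigma>2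
    above its threshold, and the other two leave b - \<sigma>1 - \<sigma>2 = d/2 + 2 e, enough for
    the weight of Cauchy-Schwarz to be square integrable.\<close>
  define e where "e = (b - d * (1 / p + 1 / q - 1 / 2)) / 4"
  have e: "e > 0" using b by (simp add: e_def d_def)
  define \<sigma>1 where "\<sigma>1 = d * (1 / p - 1 / 2) + e"
  define \<sigma>2 where "\<sigma>2 = d * (1 / q - 1 / 2) + e"
  have d0: "d > 0" by (simp add: d_def)
  have "d * (1 / p - 1 / 2) \<ge> 0" "d * (1 / q - 1 / 2) \<ge> 0"
    using p q d0 by (intro mult_nonneg_nonneg; simp add: field_simps)+
  with e have \<sigma>0: "\<sigma>1 \<ge> 0" "\<sigma>2 \<ge> 0" by (simp_all add: \<sigma>1_def \<sigma>2_def)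
  have "b - \<sigma>1 - \<sigma>2 = d / 2 + 2 * e"
  proof -
    have "b - (d * (P - 1 / 2) + (b - d * (P + Q - 1 / 2)) / 4) - (d * (Q - 1 / 2) + (b - d * (P + Q - 1 / 2)) / 4)
        = d / 2 + 2 * ((b - d * (P + Q - 1 / 2)) / 4)" for P Q :: real
      by (simp add: field_simps)
    then show ?thesis unfolding \<sigma>1_def \<sigma>2_def e_def by blast
  qed
  then have b_eq: "b = \<sigma>1 + \<sigma>2 + d / 2 + 2 * e" by simp
  have bs1: "2 * (b - \<sigma>1 - \<sigma>2) > d" using e by (simp add: b_eq)
  have bs2: "b \<ge> \<sigma>1 + \<sigma>2" using e d0 by (simp add: b_eq)
  note bs = bs1 bs2
  obtain C1 where C1: "C1 \<ge> 0"
    "\<And>f :: 'a \<Rightarrow> complex. integrable lborel f \<Longrightarrow> integrable lborel (\<lambda>x. norm (f x) powr p) \<Longrightarrow>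
       (\<integral>\<^sup>+\<xi>. ennreal ((norm (fourier f \<xi>) * (1 + norm \<xi>) powr (- \<sigma>1))\<^sup>2) \<partial>lborel)
         \<le> ennreal (C1 * (LINT x|lborel. norm (f x) powr p) powr (2 / p))"
    using fourier_weighted_L2[of p \<sigma>1, where 'a = 'a] p e unfolding \<sigma>1_def d_def by auto
  obtain C2 where C2: "C2 \<ge> 0"
    "\<And>f :: 'a \<Rightarrow> complex. integrable lborel f \<Longrightarrow> integrable lborel (\<lambda>x. norm (f x) powr q) \<Longrightarrow>
       (\<integral>\<^sup>+\<xi>. ennreal ((norm (fourier f \<xi>) * (1 + norm \<xi>) powr (- \<sigma>2))\<^sup>2) \<partial>lborel)
         \<le> ennreal (C2 * (LINT x|lborel. norm (f x) powr q) powr (2 / q))"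
    using fourier_weighted_L2[of q \<sigma>2, where 'a = 'a] q e unfolding \<sigma>2_def d_def by auto
  define I where "I = (\<integral>\<^sup>+\<xi>. ennreal ((1 + norm (\<xi>::'a)) powr (- 2 * (b - \<sigma>1 - \<sigma>2))) \<partial>lborel)"
  have "I < \<infinity>"
    using nn_integral_weight[where 'a = 'a, of "2 * (b - \<sigma>1 - \<sigma>2)"] bs unfolding I_def d_def by simp
  then obtain K where K: "K \<ge> 0" "I = ennreal K" by (cases I) auto
  have "(\<integral>\<^sup>+x. ennreal ((norm (bilinear_op M (fourier f) (fourier g) x))\<^sup>2) \<partial>lborel)
         \<le> ennreal (K * C1 * C2 * B\<^sup>2 * ((LINT x|lborel. norm (f x) powr p) powr (2 / p) *
                               (LINT x|lborel. norm (g x) powr q) powr (2 / q)))"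
    if f: "f \<in> test_functions" and g: "g \<in> test_functions" and M: "M \<in> borel_measurable borel"
      and B: "\<And>z. norm (M z) \<le> B * wt z powr (- b)" for f g :: "'a \<Rightarrow> complex" and M B
  proof -
    define Af where "Af = (LINT x|lborel. norm (f x) powr p) powr (2 / p)"
    define Ag where "Ag = (LINT x|lborel. norm (g x) powr q) powr (2 / q)"
    have A0: "Af \<ge> 0" "Ag \<ge> 0" by (simp_all add: Af_def Ag_def)
    have "(\<integral>\<^sup>+x. ennreal ((norm (bilinear_op M (fourier f) (fourier g) x))\<^sup>2) \<partial>lborel)
       \<le> ennreal (B\<^sup>2) * I *
        ((\<integral>\<^sup>+\<xi>. ennreal ((norm (fourier f \<xi>) * (1 + norm \<xi>) powr (- \<sigma>1))\<^sup>2) \<partial>lborel) *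
         (\<integral>\<^sup>+\<xi>. ennreal ((norm (fourier g \<xi>) * (1 + norm \<xi>) powr (- \<sigma>2))\<^sup>2) \<partial>lborel))"
      unfolding I_def
      by (rule bilinear_op_L2) (use f g M B[unfolded wt_def] \<sigma>0 bs fourier_test_function_integrable in auto)
    also have "\<dots> \<le> ennreal (B\<^sup>2) * ennreal K * (ennreal (C1 * Af) * ennreal (C2 * Ag))"
      unfolding K(2) Af_def Ag_def
      using f g p q by (intro mult_mono C1 C2 test_function_integrable test_function_powr_integrable) auto
    also have "\<dots> = ennreal (K * C1 * C2 * B\<^sup>2 * (Af * Ag))"
      using K C1(1) C2(1) A0 by (simp add: ennreal_mult[symmetric] mult_ac)
    finally show ?thesis by (simp add: Af_def Ag_def)
  qed
  then show ?thesis using that[of "K * C1 * C2"] K C1(1) C2(1) by auto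
qed

section \<open>Linearity and continuity of the bilinear operator\<close>

lemma bilinear_op_integrable:
  fixes F G :: "'a::euclidean_space \<Rightarrow> complex"
  assumes F: "integrable lborel F" and G: "integrable lborel G"
    and M: "M \<in> borel_measurable borel" "\<And>z. norm (M z) \<le> B"
  shows "integrable lborel (\<lambda>z. F (fst z) * G (snd z) * M z * echar (x \<bullet> (fst z + snd z)))"
proof (rule Bochner_Integration.integrable_bound)
  have [measurable]: "F \<in> borel_measurable borel" "G \<in> borel_measurable borel"
    using F G borel_measurable_integrable by fastforce+
  have [measurable]: "M \<in> borel_measurable (borel \<Otimes>\<^sub>M borel)" using M by (simp add: borel_prod)
  show "integrable lborel (\<lambda>z::'a \<times> 'a. of_real B * (F (fst z) * G (snd z)))"
    by (intro integrable_mult_right integrable_lborel_tensor F G)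
  show "AE z in lborel. norm (F (fst z) * G (snd z) * M z * echar (x \<bullet> (fst z + snd z)))
      \<le> norm (of_real B * (F (fst z) * G (snd z)))"
    using M(2) order_trans[OF norm_ge_zero M(2)]
    by (intro AE_I2) (simp add: norm_mult mult.commute mult_left_mono mult_right_mono)
  show "(\<lambda>z. F (fst z) * G (snd z) * M z * echar (x \<bullet> (fst z + snd z))) \<in> borel_measurable lborel"
    unfolding measurable_lborel2 borel_prod[symmetric] by measurable
qed

lemma bilinear_op_diff:
  fixes F G :: "'a::euclidean_space \<Rightarrow> complex"
  assumes F: "integrable lborel F" and G: "integrable lborel G"
    and M: "M \<in> borel_measurable borel" "\<And>z. norm (M z) \<le> B"
    and M': "M' \<in> borel_measurable borel" "\<And>z. norm (M' z) \<le> B'"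
  shows "bilinear_op (\<lambda>z. M z - M' z) F G x = bilinear_op M F G x - bilinear_op M' F G x"
proof -
  have "bilinear_op (\<lambda>z. M z - M' z) F G x =
      (LINT z|lborel. F (fst z) * G (snd z) * M z * echar (x \<bullet> (fst z + snd z))
        - F (fst z) * G (snd z) * M' z * echar (x \<bullet> (fst z + snd z)))"
    unfolding bilinear_op_def by (simp only: left_diff_distrib right_diff_distrib)
  also have "\<dots> = bilinear_op M F G x - bilinear_op M' F G x"
    unfolding bilinear_op_def
    by (intro Bochner_Integration.integral_diff bilinear_op_integrable[OF F G M] bilinear_op_integrable[OF F G M'])
  finally show ?thesis .
qed

text \<open>Multiplier and point move together: a constant multiplier yields continuity in x, a
  constant point yields convergence along the dyadic approximations.\<close>

lemma bilinear_op_tendsto: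
  fixes F G :: "'a::euclidean_space \<Rightarrow> complex"
  assumes F: "integrable lborel F" and G: "integrable lborel G"
    and M: "\<And>n. M n \<in> borel_measurable borel" "\<And>n z. norm (M n z) \<le> B"
    and L: "L \<in> borel_measurable borel" "\<And>z. (\<lambda>n. M n z) \<longlonglongrightarrow> L z"
    and x: "X \<longlonglongrightarrow> x"
  shows "(\<lambda>n. bilinear_op (M n) F G (X n)) \<longlonglongrightarrow> bilinear_op L F G x"
  unfolding bilinear_op_def
proof (rule integral_dominated_convergence[where w = "\<lambda>z. B * norm (F (fst z) * G (snd z))"])
  have LB: "norm (L z) \<le> B" for z
    by (rule LIMSEQ_le_const2[OF tendsto_norm[OF L(2)[of z]]]) (use M in auto)
  show "(\<lambda>z. F (fst z) * G (snd z) * L z * echar (x \<bullet> (fst z + snd z))) \<in> borel_measurable lborel"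
    using bilinear_op_integrable[OF F G L(1) LB] by (rule borel_measurable_integrable)
  show "(\<lambda>z. F (fst z) * G (snd z) * M n z * echar (X n \<bullet> (fst z + snd z))) \<in> borel_measurable lborel" for n
    using bilinear_op_integrable[OF F G M(1) M(2)] by (rule borel_measurable_integrable)
  show "integrable lborel (\<lambda>z::'a \<times> 'a. B * norm (F (fst z) * G (snd z)))"
    by (intro integrable_mult_right integrable_norm integrable_lborel_tensor F G)
  have e: "(\<lambda>n. echar (X n \<bullet> v)) \<longlonglongrightarrow> echar (x \<bullet> v)" for v
    unfolding echar_def by (intro tendsto_intros x)
  show "AE z in lborel. (\<lambda>n. F (fst z) * G (snd z) * M n z * echar (X n \<bullet> (fst z + snd z)))
      \<longlonglongrightarrow> F (fst z) * G (snd z) * L z * echar (x \<bullet> (fst z + snd z))"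
    by (intro AE_I2 tendsto_intros e L)
  show "AE z in lborel. norm (F (fst z) * G (snd z) * M n z * echar (X n \<bullet> (fst z + snd z)))
      \<le> B * norm (F (fst z) * G (snd z))" for n
    using M(2)[of n] by (intro AE_I2) (simp add: norm_mult mult.commute mult_left_mono mult_right_mono)
qed

lemma bilinear_op_continuous:
  fixes F G :: "'a::euclidean_space \<Rightarrow> complex"
  assumes "integrable lborel F" "integrable lborel G"
    and M: "M \<in> borel_measurable borel" "\<And>z. norm (M z) \<le> B"
  shows "continuous_on UNIV (bilinear_op M F G)"
  unfolding continuous_on_sequentially comp_def
  using assms by (auto intro!: bilinear_op_tendsto)

section \<open>Families of multipliers and their dyadic increments\<close>

text \<open>Collects what chaining uses about the dilates of m, so that both maximal operators are
  instances. Parameters range over [1, 2] because the dyadic approximations may leave the index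
  sets.\<close>

definition decaying_family ::
  "real \<Rightarrow> real \<Rightarrow> (real \<Rightarrow> real \<Rightarrow> 'a::euclidean_space \<times> 'a \<Rightarrow> complex) \<Rightarrow> bool" where
  "decaying_family a N M \<longleftrightarrow>
    (\<forall>s\<in>{1..2}. \<forall>s'\<in>{1..2}. M s s' \<in> borel_measurable borel \<and>
      (\<forall>z. norm (M s s' z) \<le> N * wt z powr (- a)) \<and>
      (\<forall>t\<in>{1..2}. \<forall>z. norm (M t s' z - M s s' z) \<le> N * wt z powr (- a) * (wt z * \<bar>t - s\<bar>)) \<and>
      (\<forall>t'\<in>{1..2}. \<forall>z. norm (M s t' z - M s s' z) \<le> N * wt z powr (- a) * (wt z * \<bar>t' - s'\<bar>)) \<and>
      (\<forall>t\<in>{1..2}. \<forall>t'\<in>{1..2}. \<forall>z. norm ((M t t' z - M t s' z) - (M s t' z - M s s' z))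
          \<le> N * wt z powr (- a) * (wt z * \<bar>t - s\<bar>) * (wt z * \<bar>t' - s'\<bar>)))"

lemma dyadic_incr_cases:
  assumes "q \<in> {2 ^ k..2 * 2 ^ k}"
  obtains s where "s \<in> {1..2}" "k = 0" "\<And>\<phi>. dyadic_incr k q \<phi> = \<phi> s"
  | s s0 where "s \<in> {1..2}" "s0 \<in> {1..2}" "\<bar>s - s0\<bar> \<le> 1 / 2 ^ k" "\<And>\<phi>. dyadic_incr k q \<phi> = \<phi> s - \<phi> s0"
proof (cases k)
  case 0
  then show ?thesis using that(1)[of "real q"] cell_grid[OF assms] by (auto simp: dyadic_incr_def)
next
  case (Suc j)
  have "q div 2 \<in> {2 ^ j..2 * 2 ^ j}" using assms Suc by auto
  then have "real (q div 2) / 2 ^ j \<in> {1..2}" by (rule cell_grid)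
  moreover have "\<bar>real q / 2 ^ k - real (q div 2) / 2 ^ j\<bar> \<le> 1 / 2 ^ k"
  proof -
    have "real q = 2 * real (q div 2) + real (q mod 2)"
      by (metis mult_div_mod_eq of_nat_add of_nat_mult of_nat_numeral)
    then have "real q / 2 ^ k - real (q div 2) / 2 ^ j = real (q mod 2) / 2 ^ k"
      unfolding Suc by (simp add: field_simps)
    moreover have "real (q mod 2) \<le> 1" by simp
    ultimately show ?thesis by (simp add: divide_right_mono)
  qed
  ultimately show ?thesis
    using that(2)[of "real q / 2 ^ k" "real (q div 2) / 2 ^ j"] cell_grid[OF assms] Suc
    by (auto simp: dyadic_incr_def)
qed

definition double_incr ::
  "(real \<Rightarrow> real \<Rightarrow> 'z \<Rightarrow> complex) \<Rightarrow> nat \<Rightarrow> nat \<Rightarrow> nat \<Rightarrow> nat \<Rightarrow> 'z \<Rightarrow> complex" where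
  "double_incr M k q l r z = dyadic_incr l r (\<lambda>s'. dyadic_incr k q (\<lambda>s. M s s' z))"

lemma decaying_family_N:
  fixes M :: "real \<Rightarrow> real \<Rightarrow> 'a::euclidean_space \<times> 'a \<Rightarrow> complex"
  assumes "decaying_family a N M"
  shows "N \<ge> 0"
proof -
  have "norm (M s s z) \<le> N * wt z powr (- a)" if "s \<in> {1..2}" for s z
    using assms that unfolding decaying_family_def by blast
  from this[of 1 0] have "norm (M 1 1 0) \<le> N * wt (0 :: 'a \<times> 'a) powr (- a)" by simp
  then have "norm (M 1 1 0) \<le> N" by (simp add: wt_def)
  then show ?thesis by (rule order_trans[OF norm_ge_zero])
qed

lemma decaying_family_bounded:
  assumes M: "decaying_family a N M" and a: "a \<ge> 0" and s: "s \<in> {1..2}" "s' \<in> {1..2}"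
  shows "norm (M s s' z) \<le> N"
proof -
  have "norm (M s s' z) \<le> N * wt z powr (- a)"
    using M s unfolding decaying_family_def by blast
  also have "\<dots> \<le> N * 1"
    using decaying_family_N[OF M] powr_mono2'[of "- a" 1 "wt z"] a wt_ge_1[of z] by (intro mult_left_mono) auto
  finally show ?thesis by simp
qed

text \<open>Four estimates are available: size, a difference in either parameter, and the mixed
  difference. Interpolation converts them into independent gains \<theta> and \<theta>', paid for by
  \<theta> + \<theta>' powers of the weight.\<close>

lemma double_incr_bound:
  assumes M: "decaying_family a N M"
    and q: "q \<in> {2 ^ k..2 * 2 ^ k}" and r: "r \<in> {2 ^ l..2 * 2 ^ l}"
    and \<theta>: "0 \<le> \<theta>" "\<theta> \<le> 1" and \<theta>': "0 \<le> \<theta>'" "\<theta>' \<le> 1"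
  shows "norm (double_incr M k q l r z)
     \<le> 4 * N * 2 powr (- real k * \<theta>) * 2 powr (- real l * \<theta>') * wt z powr (- (a - \<theta> - \<theta>'))"
proof -
  define W where "W = wt z"
  define A where "A = N * W powr (- a)"
  define y where "y = W * (1 / 2 ^ k)"
  define y' where "y' = W * (1 / 2 ^ l)"
  define v where "v = norm (double_incr M k q l r z)"
  have W: "W \<ge> 1" by (simp add: W_def wt_ge_1)
  have N: "N \<ge> 0" by (rule decaying_family_N[OF M])
  have A: "A \<ge> 0" using N by (simp add: A_def)
  have y: "y \<ge> 0" "y' \<ge> 0" using W by (simp_all add: y_def y'_def)
  have b1: "norm (M s s' z) \<le> A" if "s \<in> {1..2}" "s' \<in> {1..2}" for s s'
    using M that unfolding decaying_family_def A_def W_def by blast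
  have b2: "norm (M t s' z - M s s' z) \<le> A * y"
    if "s \<in> {1..2}" "s' \<in> {1..2}" "t \<in> {1..2}" "\<bar>t - s\<bar> \<le> 1 / 2 ^ k" for s s' t
  proof -
    have "norm (M t s' z - M s s' z) \<le> A * (W * \<bar>t - s\<bar>)"
      using M that(1-3) unfolding decaying_family_def A_def W_def by blast
    also have "\<dots> \<le> A * y" unfolding y_def using A W that by (intro mult_left_mono) auto
    finally show ?thesis .
  qed
  have b3: "norm (M s t' z - M s s' z) \<le> A * y'"
    if "s \<in> {1..2}" "s' \<in> {1..2}" "t' \<in> {1..2}" "\<bar>t' - s'\<bar> \<le> 1 / 2 ^ l" for s s' t'
  proof -
    have "norm (M s t' z - M s s' z) \<le> A * (W * \<bar>t' - s'\<bar>)"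
      using M that(1-3) unfolding decaying_family_def A_def W_def by blast
    also have "\<dots> \<le> A * y'" unfolding y'_def using A W that by (intro mult_left_mono) auto
    finally show ?thesis .
  qed
  have b4: "norm ((M t t' z - M t s' z) - (M s t' z - M s s' z)) \<le> A * y * y'"
    if "s \<in> {1..2}" "s' \<in> {1..2}" "t \<in> {1..2}" "t' \<in> {1..2}" "\<bar>t - s\<bar> \<le> 1 / 2 ^ k" "\<bar>t' - s'\<bar> \<le> 1 / 2 ^ l" for s s' t t'
  proof -
    have "norm ((M t t' z - M t s' z) - (M s t' z - M s s' z)) \<le> A * (W * \<bar>t - s\<bar>) * (W * \<bar>t' - s'\<bar>)"
      using M that(1-4) unfolding decaying_family_def A_def W_def by blast
    also have "\<dots> \<le> A * y * y'"
      unfolding y_def y'_def using A W that by (intro mult_mono mult_left_mono) auto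
    finally show ?thesis .
  qed
  have nn: "A * y \<ge> 0" "A * y' \<ge> 0" "A * y * y' \<ge> 0" using A y by auto
  have inc: "X \<le> X * Y" if "X \<ge> 0" "Y \<ge> 1" for X Y :: real
    using mult_left_mono[OF that(2,1)] by simp
  \<comment> \<open>The 4 counts the terms of a mixed difference. At level 0 there is no difference
    to exploit, but then y = W \<ge> 1, so the bounds containing y follow from those without it;
    likewise for y'.\<close>
  have "v \<le> 4 * A \<and> v \<le> 4 * A * y \<and> v \<le> 4 * A * y' \<and> v \<le> 4 * A * y * y'"
  proof (rule dyadic_incr_cases[OF q]; rule dyadic_incr_cases[OF r])
    fix s s' assume st: "s \<in> {1..2}" "k = 0" "\<And>\<phi>. dyadic_incr k q \<phi> = \<phi> s"
      "s' \<in> {1..2}" "l = 0" "\<And>\<phi>. dyadic_incr l r \<phi> = \<phi> s'"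
    have veq: "v = norm (M s s' z)" unfolding v_def double_incr_def st(3,6) ..
    have "v \<le> A" unfolding veq using b1 st by auto
    moreover have "y \<ge> 1" "y' \<ge> 1" using W st by (auto simp: y_def y'_def)
    ultimately show ?thesis
      using inc[of A y] inc[of A y'] inc[of "A * y" y'] A nn by linarith
  next
    fix s s' s0' assume st: "s \<in> {1..2}" "k = 0" "\<And>\<phi>. dyadic_incr k q \<phi> = \<phi> s"
      "s' \<in> {1..2}" "s0' \<in> {1..2}" "\<bar>s' - s0'\<bar> \<le> 1 / 2 ^ l" "\<And>\<phi>. dyadic_incr l r \<phi> = \<phi> s' - \<phi> s0'"
    have veq: "v = norm (M s s' z - M s s0' z)" unfolding v_def double_incr_def st(3,7) ..
    have "v \<le> 2 * A"
      using norm_triangle_ineq4[of "M s s' z" "M s s0' z"] b1[of s s'] b1[of s s0'] st unfolding veq by auto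
    moreover have "v \<le> A * y'" unfolding veq using b3 st by auto
    moreover have "y \<ge> 1" using W st by (auto simp: y_def)
    ultimately show ?thesis
      using inc[of A y] inc[of "A * y'" y] A nn by (auto simp: mult_ac)
  next
    fix s s0 s' assume st: "s \<in> {1..2}" "s0 \<in> {1..2}" "\<bar>s - s0\<bar> \<le> 1 / 2 ^ k" "\<And>\<phi>. dyadic_incr k q \<phi> = \<phi> s - \<phi> s0"
      "s' \<in> {1..2}" "l = 0" "\<And>\<phi>. dyadic_incr l r \<phi> = \<phi> s'"
    have veq: "v = norm (M s s' z - M s0 s' z)" unfolding v_def double_incr_def st(4,7) ..
    have "v \<le> 2 * A"
      using norm_triangle_ineq4[of "M s s' z" "M s0 s' z"] b1[of s s'] b1[of s0 s'] st unfolding veq by auto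
    moreover have "v \<le> A * y" unfolding veq using b2 st by auto
    moreover have "y' \<ge> 1" using W st by (auto simp: y'_def)
    ultimately show ?thesis
      using inc[of A y'] inc[of "A * y" y'] A nn by (auto simp: mult_ac)
  next
    fix s s0 s' s0' assume st: "s \<in> {1..2}" "s0 \<in> {1..2}" "\<bar>s - s0\<bar> \<le> 1 / 2 ^ k" "\<And>\<phi>. dyadic_incr k q \<phi> = \<phi> s - \<phi> s0"
      "s' \<in> {1..2}" "s0' \<in> {1..2}" "\<bar>s' - s0'\<bar> \<le> 1 / 2 ^ l" "\<And>\<phi>. dyadic_incr l r \<phi> = \<phi> s' - \<phi> s0'"
    have veq: "v = norm ((M s s' z - M s0 s' z) - (M s s0' z - M s0 s0' z))"
      unfolding v_def double_incr_def st(4,8) ..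
    have veq2: "v = norm ((M s s' z - M s s0' z) - (M s0 s' z - M s0 s0' z))"
      unfolding veq by (simp add: algebra_simps)
    have v1: "v \<le> 2 * (A * y)"
      using norm_triangle_ineq4[of "M s s' z - M s0 s' z" "M s s0' z - M s0 s0' z"]
        b2[of s0 s' s] b2[of s0 s0' s] st unfolding veq by auto
    have v2: "v \<le> 2 * (A * y')"
      using norm_triangle_ineq4[of "M s s' z - M s s0' z" "M s0 s' z - M s0 s0' z"]
        b3[of s s0' s'] b3[of s0 s0' s'] st unfolding veq2 by auto
    have v3: "v \<le> A * y * y'" unfolding veq2 using b4 st by auto
    have "v \<le> norm (M s s' z) + norm (M s0 s' z) + (norm (M s s0' z) + norm (M s0 s0' z))"
      unfolding veq
      by (rule order_trans[OF norm_triangle_ineq4]) (intro add_mono norm_triangle_ineq4)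
    then have "v \<le> 4 * A" using b1[of s s'] b1[of s0 s'] b1[of s s0'] b1[of s0 s0'] st by auto
    with v1 v2 v3 nn show ?thesis by linarith
  qed
  then have "v \<le> 4 * A * y powr \<theta> * y' powr \<theta>'"
    using A y \<theta> \<theta>' by (intro interpolate_min2) auto
  also have "y powr \<theta> = W powr \<theta> * 2 powr (- real k * \<theta>)"
    using W by (simp add: y_def powr_mult powr_divide powr_realpow[symmetric] powr_powr powr_minus_divide)
  also have "y' powr \<theta>' = W powr \<theta>' * 2 powr (- real l * \<theta>')"
    using W by (simp add: y'_def powr_mult powr_divide powr_realpow[symmetric] powr_powr powr_minus_divide)
  also have "4 * A * (W powr \<theta> * 2 powr (- real k * \<theta>)) * (W powr \<theta>' * 2 powr (- real l * \<theta>'))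
     = 4 * N * 2 powr (- real k * \<theta>) * 2 powr (- real l * \<theta>') * (W powr (- a) * W powr \<theta> * W powr \<theta>')"
    by (simp add: A_def mult_ac)
  also have "W powr (- a) * W powr \<theta> * W powr \<theta>' = W powr (- (a - \<theta> - \<theta>'))"
    using W by (simp add: powr_add[symmetric] algebra_simps)
  finally show ?thesis unfolding v_def W_def .
qed

lemma double_incr_measurable:
  assumes "decaying_family a N M"
    and q: "q \<in> {2 ^ k..2 * 2 ^ k}" and r: "r \<in> {2 ^ l..2 * 2 ^ l}"
  shows "double_incr M k q l r \<in> borel_measurable borel"
proof -
  have "M s s' \<in> borel_measurable borel" if "s \<in> {1..2}" "s' \<in> {1..2}" for s s'
    using assms(1) that unfolding decaying_family_def by blast
  then have [measurable]: "(\<lambda>z. M s s' z) \<in> borel_measurable borel" if "s \<in> {1..2}" "s' \<in> {1..2}" for s s'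
    using that by blast
  show ?thesis
    by (rule dyadic_incr_cases[OF q]; rule dyadic_incr_cases[OF r])
       (simp_all add: double_incr_def[abs_def])
qed

text \<open>Linearity in the multiplier: chaining increments of the operator values are operator
  values of increments, to which the L^2 estimate applies.\<close>

lemma double_incr_bilinear_op:
  fixes F G :: "'a::euclidean_space \<Rightarrow> complex"
  assumes F: "integrable lborel F" and G: "integrable lborel G"
    and M: "decaying_family a N M" and a: "a \<ge> 0"
    and q: "q \<in> {2 ^ k..2 * 2 ^ k}" and r: "r \<in> {2 ^ l..2 * 2 ^ l}"
  shows "dyadic_incr l r (\<lambda>s'. dyadic_incr k q (\<lambda>s. bilinear_op (M s s') F G x))
      = bilinear_op (double_incr M k q l r) F G x"
proof -
  have m: "M s s' \<in> borel_measurable borel" if "s \<in> {1..2}" "s' \<in> {1..2}" for s s'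
    using M that unfolding decaying_family_def by blast
  note b = decaying_family_bounded[OF M a]
  have b2: "norm (M s s' z - M t s' z) \<le> 2 * N" if "s \<in> {1..2}" "s' \<in> {1..2}" "t \<in> {1..2}" for s s' t z
    using norm_triangle_ineq4[of "M s s' z" "M t s' z"] b[OF that(1,2), of z] b[OF that(3,2), of z] by linarith
  note simps = double_incr_def[abs_def] bilinear_op_diff[OF F G m b m b]
  show ?thesis
  proof (rule dyadic_incr_cases[OF q]; rule dyadic_incr_cases[OF r])
    fix s s0 s' s0' assume st: "s \<in> {1..2}" "s0 \<in> {1..2}" "\<And>\<phi>. dyadic_incr k q \<phi> = \<phi> s - \<phi> s0"
      "s' \<in> {1..2}" "s0' \<in> {1..2}" "\<And>\<phi>. dyadic_incr l r \<phi> = \<phi> s' - \<phi> s0'"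
    show ?thesis
      unfolding simps(1) st
      by (subst bilinear_op_diff[OF F G _ b2 _ b2])
         (use st m b in \<open>auto simp: bilinear_op_diff[OF F G m b m b]\<close>)
  qed (auto simp: simps)
qed

section \<open>Suprema, norms and measurability\<close>

lemma ennreal_powr_Sup_le:
  assumes "\<And>u. u \<in> U \<Longrightarrow> \<exists>y\<ge>0. u = ennreal y \<and> ennreal (y\<^sup>2) \<le> S"
  shows "ennreal_powr (Sup U) 2 \<le> S"
proof (cases S)
  case (real s)
  have "Sup U \<le> ennreal (sqrt s)"
  proof (rule Sup_least)
    fix u assume "u \<in> U"
    then obtain y where y: "y \<ge> 0" "u = ennreal y" "ennreal (y\<^sup>2) \<le> S" using assms by blast
    then have "y\<^sup>2 \<le> s" using real by (simp add: ennreal_le_iff)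
    then show "u \<le> ennreal (sqrt s)" using y by (simp add: ennreal_leI real_le_rsqrt)
  qed
  then obtain w where w: "w \<ge> 0" "Sup U = ennreal w" "w \<le> sqrt s"
    by (cases "Sup U") (use real in \<open>auto simp: ennreal_le_iff top_unique\<close>)
  have "w\<^sup>2 \<le> (sqrt s)\<^sup>2" using w by (intro power_mono) auto
  then show ?thesis using w real by (simp add: ennreal_powr_def powr_numeral ennreal_leI)
qed simp

lemma ennreal_powr_ennreal: "y \<ge> 0 \<Longrightarrow> ennreal_powr (ennreal y) p = ennreal (y powr p)"
  by (simp add: ennreal_powr_def)

lemma ennreal_powr_mono_real:
  assumes "u \<le> ennreal y" "y \<ge> 0" "p \<ge> 0"
  shows "ennreal_powr u p \<le> ennreal (y powr p)"
proof -
  obtain v where "v \<ge> 0" "u = ennreal v" "v \<le> y"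
    using assms by (cases u) (auto simp: ennreal_le_iff top_unique)
  then show ?thesis using assms by (simp add: ennreal_powr_ennreal ennreal_leI powr_mono2)
qed

lemma Lp_norm_test_function:
  assumes "f \<in> test_functions" "p > 0"
  shows "Lp_norm p (\<lambda>x. ennreal (norm (f x))) = ennreal ((LINT x|lborel. norm (f x) powr p) powr (1 / p))"
proof -
  have "(\<integral>\<^sup>+x. ennreal (norm (f x) powr p) \<partial>lborel) = ennreal (LINT x|lborel. norm (f x) powr p)"
    using test_function_powr_integrable[OF assms] by (intro nn_integral_eq_integral) auto
  then show ?thesis by (simp add: Lp_norm_def ennreal_powr_ennreal)
qed

text \<open>The supremum may be uncountable, but each member is continuous in x, so superlevel sets
  are unions of open sets.\<close>

lemma maximal_measurable:
  fixes F G :: "'a::euclidean_space \<Rightarrow> complex"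
  assumes F: "integrable lborel F" and G: "integrable lborel G"
    and M: "decaying_family a N M" and a: "a \<ge> 0" and E: "E1 \<subseteq> {1..2}" "E2 \<subseteq> {1..2}"
  shows "(\<lambda>x. SUP t1\<in>E1. SUP t2\<in>E2. ennreal (norm (bilinear_op (M t1 t2) F G x))) \<in> borel_measurable lborel"
proof (rule borel_measurableI_greater)
  fix y :: ennreal
  have c: "continuous_on UNIV (bilinear_op (M s s') F G)" if "s \<in> {1..2}" "s' \<in> {1..2}" for s s'
  proof (rule bilinear_op_continuous[OF F G])
    show "M s s' \<in> borel_measurable borel"
      using M that unfolding decaying_family_def by blast
    show "norm (M s s' z) \<le> N" for z
      by (rule decaying_family_bounded[OF M a that])
  qed
  have "{x. y < (SUP t1\<in>E1. SUP t2\<in>E2. ennreal (norm (bilinear_op (M t1 t2) F G x)))}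
     = (\<Union>t1\<in>E1. \<Union>t2\<in>E2. (\<lambda>x. ennreal (norm (bilinear_op (M t1 t2) F G x))) -` {y<..})"
    by (auto simp: less_SUP_iff)
  also have "open \<dots>"
    by (intro open_UN ballI open_vimage continuous_on_ennreal continuous_on_norm c) (use E in auto)
  finally show "{x \<in> space lborel. y < (SUP t1\<in>E1. SUP t2\<in>E2. ennreal (norm (bilinear_op (M t1 t2) F G x)))} \<in> sets lborel"
    by simp
qed

lemma decaying_family_tendsto:
  assumes M: "decaying_family a N M"
    and t: "t \<in> {1..2}" "s \<in> {1..2}" "\<And>n. T n \<in> {1..2}" "T \<longlonglongrightarrow> t"
  shows "(\<lambda>n. M (T n) s z) \<longlonglongrightarrow> M t s z" "(\<lambda>n. M s (T n) z) \<longlonglongrightarrow> M s t z"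
proof -
  have lim: "(\<lambda>n. N * wt z powr (- a) * (wt z * \<bar>T n - t\<bar>)) \<longlonglongrightarrow> 0"
    using tendsto_mult_right_zero[OF tendsto_mult_right_zero[OF tendsto_rabs_zero[OF LIM_zero[OF t(4)]]]] .
  have "norm (M (T n) s z - M t s z) \<le> N * wt z powr (- a) * (wt z * \<bar>T n - t\<bar>)" for n
    using M t(1-2) t(3)[of n] unfolding decaying_family_def by blast
  then have "(\<lambda>n. M (T n) s z - M t s z) \<longlonglongrightarrow> 0"
    by (intro Lim_null_comparison[OF _ lim] always_eventually allI)
  then show "(\<lambda>n. M (T n) s z) \<longlonglongrightarrow> M t s z" by (rule LIM_zero_cancel)
  have "norm (M s (T n) z - M s t z) \<le> N * wt z powr (- a) * (wt z * \<bar>T n - t\<bar>)" for n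
    using M t(1-2) t(3)[of n] unfolding decaying_family_def by blast
  then have "(\<lambda>n. M s (T n) z - M s t z) \<longlonglongrightarrow> 0"
    by (intro Lim_null_comparison[OF _ lim] always_eventually allI)
  then show "(\<lambda>n. M s (T n) z) \<longlonglongrightarrow> M s t z" by (rule LIM_zero_cancel)
qed

text \<open>Chain in t1 with t2 fixed, then chain every increment in t2. Replacing the one relevant
  cell of each level by the sum over all occupied cells removes t1 and t2 from the right side, so it
  bounds the supremum.\<close>

lemma double_chaining:
  fixes F G :: "'a::euclidean_space \<Rightarrow> complex"
  assumes F: "integrable lborel F" and G: "integrable lborel G"
    and M: "decaying_family a N M" and a: "a \<ge> 0" and E: "E1 \<subseteq> {1..2}" "E2 \<subseteq> {1..2}"
    and r: "r > 1" and t: "t1 \<in> E1" "t2 \<in> E2"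
  defines "c \<equiv> ennreal (r / (r - 1))"
  shows "ennreal ((norm (bilinear_op (M t1 t2) F G x))\<^sup>2) \<le>
    c * (\<Sum>k. ennreal (r ^ k) * (c * (\<Sum>l. ennreal (r ^ l) *
      (\<Sum>i\<in>cell k ` E1. \<Sum>j\<in>cell l ` E2. ennreal ((norm (bilinear_op (double_incr M k i l j) F G x))\<^sup>2)))))"
proof -
  define \<Phi> where "\<Phi> = (\<lambda>s s'. bilinear_op (M s s') F G x)"
  have m: "M s s' \<in> borel_measurable borel" if "s \<in> {1..2}" "s' \<in> {1..2}" for s s'
    using M that unfolding decaying_family_def by blast
  have tt: "t1 \<in> {1..2}" "t2 \<in> {1..2}" using t E by auto
  have grid: "real (cell n u) / 2 ^ n \<in> {1..2}" if "u \<in> {1..2}" for n u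
    using cell_grid[OF cell_range[OF that]] .
  have L: "(\<lambda>n. \<Phi> (real (cell n t1) / 2 ^ n) s) \<longlonglongrightarrow> \<Phi> t1 s" if "s \<in> {1..2}" for s
    unfolding \<Phi>_def
    using tt that by (intro bilinear_op_tendsto[OF F G, where B = N] m grid decaying_family_bounded[OF M a]
      decaying_family_tendsto[OF M] cell_tendsto tendsto_const) auto
  have R: "(\<lambda>n. \<Phi> s (real (cell n t2) / 2 ^ n)) \<longlonglongrightarrow> \<Phi> s t2" if "s \<in> {1..2}" for s
    unfolding \<Phi>_def
    using tt that by (intro bilinear_op_tendsto[OF F G, where B = N] m grid decaying_family_bounded[OF M a]
      decaying_family_tendsto[OF M] cell_tendsto tendsto_const) auto
  have inner: "ennreal ((norm (dyadic_incr k (cell k t1) (\<lambda>s. \<Phi> s t2)))\<^sup>2) \<le>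
     c * (\<Sum>l. ennreal (r ^ l) *
      (\<Sum>i\<in>cell k ` E1. \<Sum>j\<in>cell l ` E2. ennreal ((norm (bilinear_op (double_incr M k i l j) F G x))\<^sup>2)))" for k
  proof -
    define \<psi> where "\<psi> = (\<lambda>s'. dyadic_incr k (cell k t1) (\<lambda>s. \<Phi> s s'))"
    have "(\<lambda>n. \<psi> (real (cell n t2) / 2 ^ n)) \<longlonglongrightarrow> \<psi> t2"
      unfolding \<psi>_def
      by (rule dyadic_incr_cases[OF cell_range[OF tt(1), of k]]) (auto intro!: R tendsto_intros)
    from chaining[OF r _ this] tt
    have "ennreal ((norm (\<psi> t2))\<^sup>2) \<le> c * (\<Sum>l. ennreal (r ^ l) * ennreal ((norm (dyadic_incr l (cell l t2) \<psi>))\<^sup>2))"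
      unfolding c_def by auto
    also have "\<dots> \<le> c * (\<Sum>l. ennreal (r ^ l) *
      (\<Sum>i\<in>cell k ` E1. \<Sum>j\<in>cell l ` E2. ennreal ((norm (bilinear_op (double_incr M k i l j) F G x))\<^sup>2)))"
    proof (intro mult_left_mono suminf_le)
      fix l
      have "dyadic_incr l (cell l t2) \<psi> = bilinear_op (double_incr M k (cell k t1) l (cell l t2)) F G x"
        unfolding \<psi>_def \<Phi>_def by (rule double_incr_bilinear_op[OF F G M a cell_range[OF tt(1)] cell_range[OF tt(2)]])
      then have "ennreal ((norm (dyadic_incr l (cell l t2) \<psi>))\<^sup>2)
          = ennreal ((norm (bilinear_op (double_incr M k (cell k t1) l (cell l t2)) F G x))\<^sup>2)" by simp
      also have "\<dots> \<le> (\<Sum>j\<in>cell l ` E2. ennreal ((norm (bilinear_op (double_incr M k (cell k t1) l j) F G x))\<^sup>2))"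
        using t finite_cells[OF E(2)] by (intro member_le_sum) auto
      also have "\<dots> \<le> (\<Sum>i\<in>cell k ` E1. \<Sum>j\<in>cell l ` E2. ennreal ((norm (bilinear_op (double_incr M k i l j) F G x))\<^sup>2))"
        using t finite_cells[OF E(1)]
        by (intro member_le_sum[where f = "\<lambda>i. \<Sum>j\<in>cell l ` E2. ennreal ((norm (bilinear_op (double_incr M k i l j) F G x))\<^sup>2)"]) auto
      finally show "ennreal ((norm (dyadic_incr l (cell l t2) \<psi>))\<^sup>2)
        \<le> (\<Sum>i\<in>cell k ` E1. \<Sum>j\<in>cell l ` E2. ennreal ((norm (bilinear_op (double_incr M k i l j) F G x))\<^sup>2))" .
    qed auto
    finally show ?thesis by (simp add: \<psi>_def)
  qed
  have "ennreal ((norm (\<Phi> t1 t2))\<^sup>2) \<le> c * (\<Sum>k. ennreal (r ^ k) * ennreal ((norm (dyadic_incr k (cell k t1) (\<lambda>s. \<Phi> s t2)))\<^sup>2))"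
    unfolding c_def using L[OF tt(2)] tt by (intro chaining r) auto
  also have "\<dots> \<le> c * (\<Sum>k. ennreal (r ^ k) * (c * (\<Sum>l. ennreal (r ^ l) *
      (\<Sum>i\<in>cell k ` E1. \<Sum>j\<in>cell l ` E2. ennreal ((norm (bilinear_op (double_incr M k i l j) F G x))\<^sup>2)))))"
    by (intro mult_left_mono suminf_le inner) auto
  finally show ?thesis by (simp add: \<Phi>_def)
qed

lemma suminf_geometric_ennreal:
  assumes "0 \<le> D" "0 \<le> \<rho>" "\<rho> < 1"
  shows "(\<Sum>k. ennreal (D * \<rho> ^ k)) = ennreal (D / (1 - \<rho>))"
proof -
  have "(\<Sum>k. ennreal (D * \<rho> ^ k)) = ennreal (\<Sum>k. D * \<rho> ^ k)"
    using assms by (intro suminf_ennreal2) (auto intro!: summable_mult)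
  also have "(\<Sum>k. D * \<rho> ^ k) = D / (1 - \<rho>)"
    using assms by (subst suminf_mult) (auto simp: suminf_geometric)
  finally show ?thesis .
qed

text \<open>Levels k and l contribute about 2^(2 \<gamma>1 k + 2 \<gamma>2 l) cells, each with
  squared norm of order 2^(-2 \<theta>1 k - 2 \<theta>2 l), times the chaining weight r^(k+l). The
  integral is thus a product of two geometric series.\<close>

theorem maximal_family_bound:
  fixes M :: "real \<Rightarrow> real \<Rightarrow> 'a::euclidean_space \<times> 'a \<Rightarrow> complex" and p q :: real
  assumes M: "decaying_family a N M" and a: "a \<ge> 0" and E: "E1 \<subseteq> {1..2}" "E2 \<subseteq> {1..2}"
    and \<theta>1: "0 \<le> \<gamma>1" "\<gamma>1 < \<theta>1" "\<theta>1 \<le> 1" and \<theta>2: "0 \<le> \<gamma>2" "\<gamma>2 < \<theta>2" "\<theta>2 \<le> 1"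
    and c1: "c1 \<ge> 0" "\<And>k. real (card (cell k ` E1)) \<le> c1 * 2 powr (2 * \<gamma>1 * real k)"
    and c2: "c2 \<ge> 0" "\<And>k. real (card (cell k ` E2)) \<le> c2 * 2 powr (2 * \<gamma>2 * real k)"
    and p: "1 < p" "p \<le> 2" and q: "1 < q" "q \<le> 2"
    and b: "a - \<theta>1 - \<theta>2 > DIM('a) * (1 / p + 1 / q - 1 / 2)"
  shows "bounded_Lp_Lq_Lr p q 2
    (\<lambda>f g x. SUP t1\<in>E1. SUP t2\<in>E2. ennreal (norm (bilinear_op (M t1 t2) (fourier f) (fourier g) x)))"
proof -
  obtain C where C: "C \<ge> 0"
    "\<And>(f :: 'a \<Rightarrow> complex) g M B. f \<in> test_functions \<Longrightarrow> g \<in> test_functions \<Longrightarrow>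
       M \<in> borel_measurable borel \<Longrightarrow> (\<And>z. norm (M z) \<le> B * wt z powr (- (a - \<theta>1 - \<theta>2))) \<Longrightarrow>
       (\<integral>\<^sup>+x. ennreal ((norm (bilinear_op M (fourier f) (fourier g) x))\<^sup>2) \<partial>lborel)
         \<le> ennreal (C * B\<^sup>2 * ((LINT x|lborel. norm (f x) powr p) powr (2 / p) *
                               (LINT x|lborel. norm (g x) powr q) powr (2 / q)))"
    using bilinear_estimate[OF p q b] by blast
  \<comment> \<open>Small enough for both parameters: r 2^(2 \<gamma> - 2 \<theta>) \<le>
    2^(-(\<theta> - \<gamma>)) < 1 in either case.\<close>
  define r where "r = 2 powr min (\<theta>1 - \<gamma>1) (\<theta>2 - \<gamma>2)"
  have r: "r > 1" using \<theta>1 \<theta>2 powr_less_mono[of 0 "min (\<theta>1 - \<gamma>1) (\<theta>2 - \<gamma>2)" 2] by (simp add: r_def)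
  define c where "c = r / (r - 1)"
  have c: "c \<ge> 0" using r by (simp add: c_def)
  define \<rho>1 where "\<rho>1 = r * 2 powr (2 * \<gamma>1 - 2 * \<theta>1)"
  define \<rho>2 where "\<rho>2 = r * 2 powr (2 * \<gamma>2 - 2 * \<theta>2)"
  have \<rho>: "0 \<le> \<rho>1" "\<rho>1 < 1" "0 \<le> \<rho>2" "\<rho>2 < 1"
  proof -
    have "\<rho>1 = 2 powr (min (\<theta>1 - \<gamma>1) (\<theta>2 - \<gamma>2) + (2 * \<gamma>1 - 2 * \<theta>1))"
      by (simp only: \<rho>1_def r_def powr_add)
    also have "\<dots> < 2 powr 0" using \<theta>1 by (intro powr_less_mono) auto
    finally show "\<rho>1 < 1" by simp
    have "\<rho>2 = 2 powr (min (\<theta>1 - \<gamma>1) (\<theta>2 - \<gamma>2) + (2 * \<gamma>2 - 2 * \<theta>2))"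
      by (simp only: \<rho>2_def r_def powr_add)
    also have "\<dots> < 2 powr 0" using \<theta>2 by (intro powr_less_mono) auto
    finally show "\<rho>2 < 1" by simp
  qed (use r in \<open>auto simp: \<rho>1_def \<rho>2_def\<close>)
  define K where "K = c * (c * (c1 * c2 * C * (4 * N)\<^sup>2)) / (1 - \<rho>2) / (1 - \<rho>1)"
  have K: "K \<ge> 0" using c c1 c2 C \<rho> by (simp add: K_def)
  have main: "(\<lambda>x. SUP t1\<in>E1. SUP t2\<in>E2. ennreal (norm (bilinear_op (M t1 t2) (fourier f) (fourier g) x))) \<in> borel_measurable lborel
    \<and> Lp_norm 2 (\<lambda>x. SUP t1\<in>E1. SUP t2\<in>E2. ennreal (norm (bilinear_op (M t1 t2) (fourier f) (fourier g) x)))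
       \<le> ennreal (sqrt K) * Lp_norm p (\<lambda>x. ennreal (norm (f x))) * Lp_norm q (\<lambda>x. ennreal (norm (g x)))"
    if f: "f \<in> test_functions" and g: "g \<in> test_functions" for f g :: "'a \<Rightarrow> complex"
  proof
    define F where "F = fourier f"
    define G where "G = fourier g"
    have F: "integrable lborel F" and G: "integrable lborel G"
      unfolding F_def G_def by (intro fourier_test_function_integrable f g)+
    define u where "u = (\<lambda>x. SUP t1\<in>E1. SUP t2\<in>E2. ennreal (norm (bilinear_op (M t1 t2) F G x)))"
    show "(\<lambda>x. SUP t1\<in>E1. SUP t2\<in>E2. ennreal (norm (bilinear_op (M t1 t2) (fourier f) (fourier g) x))) \<in> borel_measurable lborel"
      using maximal_measurable[OF F G M a E] unfolding F_def G_def .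
    define Af where "Af = (LINT x|lborel. norm (f x) powr p)"
    define Ag where "Ag = (LINT x|lborel. norm (g x) powr q)"
    have A0: "Af \<ge> 0" "Ag \<ge> 0" unfolding Af_def Ag_def by simp_all
    define J where "J = Af powr (2 / p) * Ag powr (2 / q)"
    have J: "J \<ge> 0" by (simp add: J_def)
    define Bn where "Bn = (\<lambda>k i l j x. ennreal ((norm (bilinear_op (double_incr M k i l j) F G x))\<^sup>2))"
    define S where "S = (\<lambda>x. ennreal c * (\<Sum>k. ennreal (r ^ k) * (ennreal c * (\<Sum>l. ennreal (r ^ l) *
      (\<Sum>i\<in>cell k ` E1. \<Sum>j\<in>cell l ` E2. Bn k i l j x)))))"
    have cr: "i \<in> {2 ^ k..2 * 2 ^ k}" if "i \<in> cell k ` E1" for i k using that cell_range E by blast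
    have cr': "i \<in> {2 ^ k..2 * 2 ^ k}" if "i \<in> cell k ` E2" for i k using that cell_range E by blast
    have dm: "double_incr M k i l j \<in> borel_measurable borel" if "i \<in> cell k ` E1" "j \<in> cell l ` E2" for k i l j
      by (rule double_incr_measurable[OF M cr[OF that(1)] cr'[OF that(2)]])
    have db: "norm (double_incr M k i l j z)
        \<le> 4 * N * 2 powr (- real k * \<theta>1) * 2 powr (- real l * \<theta>2) * wt z powr (- (a - \<theta>1 - \<theta>2))"
      if "i \<in> cell k ` E1" "j \<in> cell l ` E2" for k i l j z
      using \<theta>1 \<theta>2 by (intro double_incr_bound[OF M cr[OF that(1)] cr'[OF that(2)]]) auto
    have Bm [measurable]: "Bn k i l j \<in> borel_measurable borel" if "i \<in> cell k ` E1" "j \<in> cell l ` E2" for k i l j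
    proof -
      \<comment> \<open>The increment bound with both gains set to 0; boundedness is enough for
        continuity in x.\<close>
      have "norm (double_incr M k i l j z) \<le> 4 * N" for z
      proof -
        have "norm (double_incr M k i l j z) \<le> 4 * N * 2 powr (- real k * 0) * 2 powr (- real l * 0) * wt z powr (- (a - 0 - 0))"
          by (intro double_incr_bound[OF M cr[OF that(1)] cr'[OF that(2)]]) auto
        moreover have "N * wt z powr (- a) \<le> N * 1"
          using decaying_family_N[OF M] powr_mono2'[of "- a" 1 "wt z"] a wt_ge_1[of z] by (intro mult_left_mono) auto
        ultimately show ?thesis by simp
      qed
      from bilinear_op_continuous[OF F G dm[OF that] this]
      have "bilinear_op (double_incr M k i l j) F G \<in> borel_measurable borel"
        by (rule borel_measurable_continuous_onI)
      then show ?thesis unfolding Bn_def by measurable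
    qed
    have Bi: "(\<integral>\<^sup>+x. Bn k i l j x \<partial>lborel)
        \<le> ennreal (C * (4 * N * 2 powr (- real k * \<theta>1) * 2 powr (- real l * \<theta>2))\<^sup>2 * J)"
      if "i \<in> cell k ` E1" "j \<in> cell l ` E2" for k i l j
      unfolding Bn_def F_def G_def J_def Af_def Ag_def
      by (rule C(2)[OF f g dm[OF that] db[OF that]])
    have inn: "ennreal (r ^ k) * (ennreal (r ^ l) * (\<Sum>i\<in>cell k ` E1. \<Sum>j\<in>cell l ` E2. \<integral>\<^sup>+x. Bn k i l j x \<partial>lborel))
       \<le> ennreal (c1 * c2 * C * (4 * N)\<^sup>2 * J * \<rho>1 ^ k * \<rho>2 ^ l)" for k l
    proof -
      define X where "X = C * (4 * N * 2 powr (- real k * \<theta>1) * 2 powr (- real l * \<theta>2))\<^sup>2 * J"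
      have X: "X \<ge> 0" using C J by (simp add: X_def)
      have "(\<Sum>i\<in>cell k ` E1. \<Sum>j\<in>cell l ` E2. \<integral>\<^sup>+x. Bn k i l j x \<partial>lborel)
         \<le> (\<Sum>i\<in>cell k ` E1. \<Sum>j\<in>cell l ` E2. ennreal X)"
        unfolding X_def by (intro sum_mono Bi)
      also have "\<dots> = ennreal (real (card (cell k ` E1)) * real (card (cell l ` E2)) * X)"
        using X by (simp add: ennreal_mult ennreal_of_nat_eq_real_of_nat mult.assoc)
      also have "\<dots> \<le> ennreal ((c1 * 2 powr (2 * \<gamma>1 * real k)) * (c2 * 2 powr (2 * \<gamma>2 * real l)) * X)"
        using c1 c2 X by (intro ennreal_leI mult_mono) auto
      finally have "ennreal (r ^ k) * (ennreal (r ^ l) * (\<Sum>i\<in>cell k ` E1. \<Sum>j\<in>cell l ` E2. \<integral>\<^sup>+x. Bn k i l j x \<partial>lborel))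
        \<le> ennreal (r ^ k) * (ennreal (r ^ l) * ennreal ((c1 * 2 powr (2 * \<gamma>1 * real k)) * (c2 * 2 powr (2 * \<gamma>2 * real l)) * X))"
        by (intro mult_left_mono) auto
      also have "\<dots> = ennreal (r ^ k * (r ^ l * ((c1 * 2 powr (2 * \<gamma>1 * real k)) * (c2 * 2 powr (2 * \<gamma>2 * real l)) * X)))"
        using r c1 c2 X by (simp add: ennreal_mult[symmetric])
      also have "r ^ k * (r ^ l * ((c1 * 2 powr (2 * \<gamma>1 * real k)) * (c2 * 2 powr (2 * \<gamma>2 * real l)) * X))
         = c1 * c2 * C * (4 * N)\<^sup>2 * J * \<rho>1 ^ k * \<rho>2 ^ l"
      proof -
        have 1: "\<rho>1 ^ k = r ^ k * (2 powr (2 * \<gamma>1 * real k) * (2 powr (- real k * \<theta>1))\<^sup>2)"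
          by (simp add: \<rho>1_def power_mult_distrib powr_power powr_add[symmetric] algebra_simps)
        have 2: "\<rho>2 ^ l = r ^ l * (2 powr (2 * \<gamma>2 * real l) * (2 powr (- real l * \<theta>2))\<^sup>2)"
          by (simp add: \<rho>2_def power_mult_distrib powr_power powr_add[symmetric] algebra_simps)
        show ?thesis unfolding 1 2 X_def by (simp add: power_mult_distrib mult_ac)
      qed
      finally show ?thesis .
    qed
    have "(\<integral>\<^sup>+x. S x \<partial>lborel) = ennreal c * (\<Sum>k. ennreal (r ^ k) * (ennreal c * (\<Sum>l. ennreal (r ^ l) *
      (\<Sum>i\<in>cell k ` E1. \<Sum>j\<in>cell l ` E2. \<integral>\<^sup>+x. Bn k i l j x \<partial>lborel))))"
      unfolding S_def
      by (simp add: nn_integral_cmult nn_integral_suminf nn_integral_sum)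
    also have "\<dots> = ennreal c * (ennreal c * (\<Sum>k. \<Sum>l. ennreal (r ^ k) * (ennreal (r ^ l) *
      (\<Sum>i\<in>cell k ` E1. \<Sum>j\<in>cell l ` E2. \<integral>\<^sup>+x. Bn k i l j x \<partial>lborel))))"
      by (simp add: mult.left_commute)
    also have "\<dots> \<le> ennreal c * (ennreal c * (\<Sum>k. \<Sum>l. ennreal (c1 * c2 * C * (4 * N)\<^sup>2 * J * \<rho>1 ^ k * \<rho>2 ^ l)))"
      by (intro mult_left_mono suminf_le inn) auto
    also have "(\<Sum>k. \<Sum>l. ennreal (c1 * c2 * C * (4 * N)\<^sup>2 * J * \<rho>1 ^ k * \<rho>2 ^ l))
        = (\<Sum>k. ennreal (c1 * c2 * C * (4 * N)\<^sup>2 * J / (1 - \<rho>2) * \<rho>1 ^ k))"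
    proof (intro suminf_cong)
      fix k
      have "(\<Sum>l. ennreal ((c1 * c2 * C * (4 * N)\<^sup>2 * J * \<rho>1 ^ k) * \<rho>2 ^ l))
          = ennreal ((c1 * c2 * C * (4 * N)\<^sup>2 * J * \<rho>1 ^ k) / (1 - \<rho>2))"
        using c1 c2 C J \<rho> by (intro suminf_geometric_ennreal) auto
      then show "(\<Sum>l. ennreal (c1 * c2 * C * (4 * N)\<^sup>2 * J * \<rho>1 ^ k * \<rho>2 ^ l))
          = ennreal (c1 * c2 * C * (4 * N)\<^sup>2 * J / (1 - \<rho>2) * \<rho>1 ^ k)" by simp
    qed
    also have "\<dots> = ennreal (c1 * c2 * C * (4 * N)\<^sup>2 * J / (1 - \<rho>2) / (1 - \<rho>1))"
      using c1 c2 C J \<rho> by (intro suminf_geometric_ennreal) auto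
    also have "ennreal c * (ennreal c * \<dots>) = ennreal (K * J)"
      using c1 c2 C J \<rho> c by (simp add: K_def ennreal_mult[symmetric])
    finally have SI: "(\<integral>\<^sup>+x. S x \<partial>lborel) \<le> ennreal (K * J)" .
    have uS: "ennreal_powr (u x) 2 \<le> S x" for x
    proof -
      \<comment> \<open>A single supremum over pairs, the form to which
        \<open>ennreal_powr_Sup_le\<close> applies.\<close>
      have ux: "u x = Sup ((\<lambda>(t1, t2). ennreal (norm (bilinear_op (M t1 t2) F G x))) ` (E1 \<times> E2))"
        unfolding u_def by (rule antisym) (auto intro!: SUP_least SUP_upper2 Sup_least)
      show ?thesis
        unfolding ux
      proof (rule ennreal_powr_Sup_le)
        fix v assume "v \<in> (\<lambda>(t1, t2). ennreal (norm (bilinear_op (M t1 t2) F G x))) ` (E1 \<times> E2)"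
        then obtain t1 t2 where t: "t1 \<in> E1" "t2 \<in> E2" "v = ennreal (norm (bilinear_op (M t1 t2) F G x))" by auto
        from double_chaining[OF F G M a E r t(1,2), of x] t(3)
        show "\<exists>y\<ge>0. v = ennreal y \<and> ennreal (y\<^sup>2) \<le> S x"
          unfolding S_def Bn_def c_def by (intro exI[of _ "norm (bilinear_op (M t1 t2) F G x)"]) auto
      qed
    qed
    have "(\<integral>\<^sup>+x. ennreal_powr (u x) 2 \<partial>lborel) \<le> (\<integral>\<^sup>+x. S x \<partial>lborel)"
      by (intro nn_integral_mono uS)
    also note SI
    finally have "Lp_norm 2 u \<le> ennreal ((K * J) powr (1 / 2))"
      unfolding Lp_norm_def using K J by (intro ennreal_powr_mono_real) auto
    also have "(K * J) powr (1 / 2) = sqrt K * Af powr (1 / p) * Ag powr (1 / q)"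
      using K A0 by (simp add: J_def powr_mult powr_powr powr_half_sqrt[symmetric])
    also have "ennreal (sqrt K * Af powr (1 / p) * Ag powr (1 / q))
        = ennreal (sqrt K) * Lp_norm p (\<lambda>x. ennreal (norm (f x))) * Lp_norm q (\<lambda>x. ennreal (norm (g x)))"
      using p q K f g by (simp add: Lp_norm_test_function ennreal_mult Af_def Ag_def)
    finally show "Lp_norm 2 (\<lambda>x. SUP t1\<in>E1. SUP t2\<in>E2. ennreal (norm (bilinear_op (M t1 t2) (fourier f) (fourier g) x)))
       \<le> ennreal (sqrt K) * Lp_norm p (\<lambda>x. ennreal (norm (f x))) * Lp_norm q (\<lambda>x. ennreal (norm (g x)))"
      unfolding u_def F_def G_def .
  qed
  then show ?thesis unfolding bounded_Lp_Lq_Lr_def by blast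
qed

text \<open>The cap \<open>\<theta> \<le> 1\<close> is what \<open>interpolate_min\<close> needs; it costs nothing because at most \<open>2 * 2 ^ k\<close>
  cells of level \<open>k\<close> exist.\<close>

definition cell_exponent :: "real set \<Rightarrow> real \<Rightarrow> bool" where
  "cell_exponent E \<beta> \<longleftrightarrow> (\<forall>e>0. \<exists>\<gamma> \<theta> c. 0 \<le> \<gamma> \<and> \<gamma> < \<theta> \<and> \<theta> \<le> 1 \<and> \<theta> \<le> \<beta> / 2 + e \<and> c \<ge> 0 \<and>
     (\<forall>k. real (card (cell k ` E)) \<le> c * 2 powr (2 * \<gamma> * real k)))"

lemma cell_exponent_minkowski:
  assumes E: "E \<subseteq> {1..2}" "E \<noteq> {}" and dim: "upper_minkowski_dim E = ereal \<beta>"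
  shows "cell_exponent E \<beta>"
  unfolding cell_exponent_def
proof (intro allI impI)
  fix e :: real assume e: "e > 0"
  have \<beta>: "\<beta> \<ge> 0" by (rule minkowski_dim_nonneg[OF E(2) dim])
  obtain c where c: "c \<ge> 0" "\<And>k. real (card (cell k ` E)) \<le> c * 2 powr (real k * min (\<beta> + e) 1)"
    using card_cells_minkowski[OF E dim e] by blast
  define \<gamma> where "\<gamma> = min (\<beta> + e) 1 / 2"
  have eq: "real k * min (\<beta> + e) 1 = 2 * \<gamma> * real k" for k by (simp add: \<gamma>_def)
  \<comment> \<open>The witness is \<theta> = \<gamma> + min e 1 / 2. Since \<gamma> \<le> 1/2 and
    \<gamma> \<le> (\<beta> + e)/2, both upper bounds on \<theta> hold.\<close>
  have "0 \<le> \<gamma>" "\<gamma> < \<gamma> + min e 1 / 2" "\<gamma> + min e 1 / 2 \<le> 1" "\<gamma> + min e 1 / 2 \<le> \<beta> / 2 + e"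
    using e \<beta> by (auto simp: \<gamma>_def min_def field_simps)
  with c[unfolded eq] show "\<exists>\<gamma> \<theta> c. 0 \<le> \<gamma> \<and> \<gamma> < \<theta> \<and> \<theta> \<le> 1 \<and> \<theta> \<le> \<beta> / 2 + e \<and> c \<ge> 0 \<and>
     (\<forall>k. real (card (cell k ` E)) \<le> c * 2 powr (2 * \<gamma> * real k))" by blast
qed

text \<open>One cell per level; this covers the dummy second parameter of the one-parameter
  operator.\<close>

lemma cell_exponent_singleton: "cell_exponent {t} 0"
  unfolding cell_exponent_def
proof (intro allI impI)
  fix e :: real assume e: "e > 0"
  show "\<exists>\<gamma> \<theta> c. 0 \<le> \<gamma> \<and> \<gamma> < \<theta> \<and> \<theta> \<le> 1 \<and> \<theta> \<le> 0 / 2 + e \<and> c \<ge> 0 \<and>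
     (\<forall>k. real (card (cell k ` {t})) \<le> c * 2 powr (2 * \<gamma> * real k))"
    by (rule exI[of _ 0], rule exI[of _ "min e 1"], rule exI[of _ 1]) (use e in auto)
qed

lemma maximal_family_bound_exponent:
  fixes M :: "real \<Rightarrow> real \<Rightarrow> 'a::euclidean_space \<times> 'a \<Rightarrow> complex" and p q :: real
  assumes M: "decaying_family a N M" and a: "a \<ge> 0" and E: "E1 \<subseteq> {1..2}" "E2 \<subseteq> {1..2}"
    and \<beta>: "cell_exponent E1 \<beta>1" "cell_exponent E2 \<beta>2"
    and p: "1 < p" "p \<le> 2" and q: "1 < q" "q \<le> 2"
    and b: "1 / p + 1 / q < 1 / 2 + (2 * a - \<beta>1 - \<beta>2) / (2 * DIM('a))"
  shows "bounded_Lp_Lq_Lr p q 2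
    (\<lambda>f g x. SUP t1\<in>E1. SUP t2\<in>E2. ennreal (norm (bilinear_op (M t1 t2) (fourier f) (fourier g) x)))"
proof -
  define d where "d = real DIM('a)"
  have d: "d > 0" by (simp add: d_def)
  define X where "X = d * (1 / p + 1 / q - 1 / 2)"
  \<comment> \<open>A quarter of the slack: the two exponents \<theta>1, \<theta>2 may overshoot by
    \<open>e\<close> each, and 2 e remain for the strict inequality.\<close>
  define e where "e = (a - (\<beta>1 + \<beta>2) / 2 - X) / 4"
  have "d * (1 / p + 1 / q) < d * (1 / 2 + (2 * a - \<beta>1 - \<beta>2) / (2 * d))"
    using b d unfolding d_def by (intro mult_strict_left_mono) auto
  also have "\<dots> = d / 2 + a - (\<beta>1 + \<beta>2) / 2" using d by (simp add: field_simps)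
  finally have e: "e > 0" by (simp add: e_def X_def right_diff_distrib)
  obtain \<gamma>1 \<theta>1 c1 where 1: "0 \<le> \<gamma>1" "\<gamma>1 < \<theta>1" "\<theta>1 \<le> 1" "\<theta>1 \<le> \<beta>1 / 2 + e" "c1 \<ge> 0"
     "\<And>k. real (card (cell k ` E1)) \<le> c1 * 2 powr (2 * \<gamma>1 * real k)"
    using \<beta>(1) e unfolding cell_exponent_def by blast
  obtain \<gamma>2 \<theta>2 c2 where 2: "0 \<le> \<gamma>2" "\<gamma>2 < \<theta>2" "\<theta>2 \<le> 1" "\<theta>2 \<le> \<beta>2 / 2 + e" "c2 \<ge> 0"
     "\<And>k. real (card (cell k ` E2)) \<le> c2 * 2 powr (2 * \<gamma>2 * real k)"
    using \<beta>(2) e unfolding cell_exponent_def by blast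
  have "4 * e = a - (\<beta>1 + \<beta>2) / 2 - X" by (simp add: e_def)
  with 1(4) 2(4) e have "a - \<theta>1 - \<theta>2 > X" by argo
  then show ?thesis
    unfolding d_def X_def
    by (intro maximal_family_bound[OF M a E 1(1-3) 2(1-3) 1(5-6) 2(5-6) p q]) auto
qed

subsection \<open>The two maximal operators\<close>

lemma admissible_measurable:
  assumes "admissible a k m"
  shows "(\<lambda>z. m (s *\<^sub>R fst z, s' *\<^sub>R snd z)) \<in> borel_measurable borel"
proof (rule borel_measurable_continuous_onI)
  have "continuous_on UNIV m"
    using assms unfolding admissible_def by (cases k) auto
  then show "continuous_on UNIV (\<lambda>z. m (s *\<^sub>R fst z, s' *\<^sub>R snd z))"
    by (rule continuous_on_compose2) (auto intro!: continuous_intros)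
qed

lemma dilation_weight:
  fixes z :: "'a::euclidean_space \<times> 'a"
  assumes "s \<ge> 1" "s' \<ge> 1" "a \<ge> 0"
  shows "wt (s *\<^sub>R fst z, s' *\<^sub>R snd z) powr (- a) \<le> wt z powr (- a)"
proof -
  have "1 * norm (fst z) \<le> s * norm (fst z)" "1 * norm (snd z) \<le> s' * norm (snd z)"
    using assms by (intro mult_right_mono; simp)+
  then have "wt z \<le> wt (s *\<^sub>R fst z, s' *\<^sub>R snd z)" using assms by (simp add: wt_def)
  then show ?thesis using assms wt_ge_1[of z] by (intro powr_mono2') auto
qed

text \<open>The one-parameter operator is the two-parameter one with second index set \<open>{1}\<close> and a family
  that ignores its second argument.\<close>

lemma decaying_family_one:
  fixes m :: "'a::euclidean_space \<times> 'a \<Rightarrow> complex"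
  assumes m: "admissible a 1 m"
  shows "\<exists>N. decaying_family a N (\<lambda>s s' z. m (s *\<^sub>R fst z, s *\<^sub>R snd z))"
proof -
  define D where "D = real DIM('a \<times> 'a)"
  have D: "D \<ge> 0" by (simp add: D_def)
  have a: "a \<ge> 0" using admissible_pos[OF m] by simp
  obtain C where C: "C \<ge> 0"
    "\<And>bs z. set bs \<subseteq> Basis \<Longrightarrow> length bs \<le> 1 \<Longrightarrow> norm (fold partial_deriv bs m z) \<le> C * wt z powr (- a)"
    using admissible_uniform[OF m] by blast
  have "C_k (Suc 0) m" using m unfolding admissible_def One_nat_def by blast
  then have d: "(\<lambda>s. m (x + s *\<^sub>R b)) differentiable (at 0)" if "b \<in> Basis" for b x
    using that by (simp del: split_paired_All)
  have L0: "norm (m z) \<le> C * wt z powr (- a)" for z using C(2)[of "[]" z] by simp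
  have L1: "norm (partial_deriv b m z) \<le> C * wt z powr (- a)" if "b \<in> Basis" for b z
    using C(2)[of "[b]" z] that by simp
  \<comment> \<open>Both components are dilated by the same factor, so |t - s| is counted
    twice.\<close>
  define N where "N = C * (1 + 2 * D)"
  have N: "C \<le> N" "C * D * 2 \<le> N" "N \<ge> 0" using C(1) D by (auto simp: N_def algebra_simps)
  have 1: "norm (m (s *\<^sub>R fst z, s *\<^sub>R snd z)) \<le> N * wt z powr (- a)" if "s \<in> {1..2}" for s z
  proof -
    have "norm (m (s *\<^sub>R fst z, s *\<^sub>R snd z)) \<le> C * wt (s *\<^sub>R fst z, s *\<^sub>R snd z) powr (- a)" by (rule L0)
    also have "\<dots> \<le> N * wt z powr (- a)"
      using that C(1) N a by (intro mult_mono dilation_weight) auto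
    finally show ?thesis .
  qed
  have 2: "norm (m (t *\<^sub>R fst z, t *\<^sub>R snd z) - m (s *\<^sub>R fst z, s *\<^sub>R snd z)) \<le> N * wt z powr (- a) * (wt z * \<bar>t - s\<bar>)"
    if "s \<in> {1..2}" "t \<in> {1..2}" for s t z
  proof -
    have "norm (m (t *\<^sub>R fst z, t *\<^sub>R snd z) - m (s *\<^sub>R fst z, s *\<^sub>R snd z))
        \<le> C * D * wt (fst z, snd z) powr (- a) * (wt (fst z, snd z) * (\<bar>t - s\<bar> + \<bar>t - s\<bar>))"
      unfolding D_def using that a C(1) by (intro scaled_difference d L1) auto
    also have "\<dots> = (C * D * 2) * (wt z powr (- a) * (wt z * \<bar>t - s\<bar>))" by simp
    also have "\<dots> \<le> N * (wt z powr (- a) * (wt z * \<bar>t - s\<bar>))"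
      using N wt_ge_1[of z] by (intro mult_right_mono) auto
    finally show ?thesis by (simp add: mult.assoc)
  qed
  \<comment> \<open>Differences in the ignored argument, and the mixed ones, are 0; there only the
    sign of the right side has to be checked.\<close>
  have W: "0 \<le> wt z" for z :: "'a \<times> 'a" using wt_ge_1[of z] by linarith
  have "decaying_family a N (\<lambda>s s' z. m (s *\<^sub>R fst z, s *\<^sub>R snd z))"
    unfolding decaying_family_def
    by (intro ballI conjI allI admissible_measurable[OF m] 1 2) (use N W in auto)
  then show ?thesis by blast
qed

text \<open>Size and first differences use derivatives of order at most 1; order 2 enters through
  the mixed difference.\<close>

lemma decaying_family_two:
  fixes m :: "'a::euclidean_space \<times> 'a \<Rightarrow> complex"
  assumes m: "admissible a 2 m"
  shows "\<exists>N. decaying_family a N (\<lambda>s s' z. m (s *\<^sub>R fst z, s' *\<^sub>R snd z))"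
proof -
  define D where "D = real DIM('a \<times> 'a)"
  have D: "D \<ge> 0" by (simp add: D_def)
  have a: "a \<ge> 0" using admissible_pos[OF m] by simp
  obtain C where C: "C \<ge> 0"
    "\<And>bs z. set bs \<subseteq> Basis \<Longrightarrow> length bs \<le> 2 \<Longrightarrow> norm (fold partial_deriv bs m z) \<le> C * wt z powr (- a)"
    using admissible_uniform[OF m] by blast
  have Ck: "C_k (Suc (Suc 0)) m" using m unfolding admissible_def numeral_2_eq_2 by blast
  have d: "(\<lambda>s. m (x + s *\<^sub>R b)) differentiable (at 0)" if "b \<in> Basis" for b x
    using that Ck by (simp del: split_paired_All)
  have d2: "(\<lambda>s. partial_deriv b m (x + s *\<^sub>R c)) differentiable (at 0)" if "b \<in> Basis" "c \<in> Basis" for b c x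
    using that Ck by (simp del: split_paired_All)
  have L0: "norm (m z) \<le> C * wt z powr (- a)" for z using C(2)[of "[]" z] by simp
  have L1: "norm (partial_deriv b m z) \<le> C * wt z powr (- a)" if "b \<in> Basis" for b z
    using C(2)[of "[b]" z] that by simp
  have L2: "norm (partial_deriv c (partial_deriv b m) z) \<le> C * wt z powr (- a)" if "b \<in> Basis" "c \<in> Basis" for b c z
    using C(2)[of "[b, c]" z] that by simp
  define N where "N = C * (1 + D + D\<^sup>2)"
  have CD: "C * D \<ge> 0" "C * D\<^sup>2 \<ge> 0" using C(1) D by simp_all
  then have N: "C \<le> N" "C * D \<le> N" "C * D\<^sup>2 \<le> N" "N \<ge> 0" using C(1) by (auto simp: N_def algebra_simps)
  have 1: "norm (m (s *\<^sub>R fst z, s' *\<^sub>R snd z)) \<le> N * wt z powr (- a)" if "s \<in> {1..2}" "s' \<in> {1..2}" for s s' z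
  proof -
    have "norm (m (s *\<^sub>R fst z, s' *\<^sub>R snd z)) \<le> C * wt (s *\<^sub>R fst z, s' *\<^sub>R snd z) powr (- a)" by (rule L0)
    also have "\<dots> \<le> N * wt z powr (- a)"
      using that C(1) N a by (intro mult_mono dilation_weight) auto
    finally show ?thesis .
  qed
  have 2: "norm (m (t *\<^sub>R fst z, t' *\<^sub>R snd z) - m (s *\<^sub>R fst z, s' *\<^sub>R snd z))
      \<le> N * wt z powr (- a) * (wt z * (\<bar>t - s\<bar> + \<bar>t' - s'\<bar>))"
    if "s \<in> {1..2}" "t \<in> {1..2}" "s' \<in> {1..2}" "t' \<in> {1..2}" for s t s' t' z
  proof -
    have "norm (m (t *\<^sub>R fst z, t' *\<^sub>R snd z) - m (s *\<^sub>R fst z, s' *\<^sub>R snd z))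
        \<le> C * D * wt (fst z, snd z) powr (- a) * (wt (fst z, snd z) * (\<bar>t - s\<bar> + \<bar>t' - s'\<bar>))"
      unfolding D_def using that a C(1) by (intro scaled_difference d L1) auto
    also have "\<dots> \<le> N * wt (fst z, snd z) powr (- a) * (wt (fst z, snd z) * (\<bar>t - s\<bar> + \<bar>t' - s'\<bar>))"
      using N wt_ge_1[of z] by (intro mult_right_mono) auto
    finally show ?thesis by simp
  qed
  have 3: "norm ((m (t *\<^sub>R fst z, t' *\<^sub>R snd z) - m (t *\<^sub>R fst z, s' *\<^sub>R snd z)) - (m (s *\<^sub>R fst z, t' *\<^sub>R snd z) - m (s *\<^sub>R fst z, s' *\<^sub>R snd z)))
      \<le> N * wt z powr (- a) * (wt z * \<bar>t - s\<bar>) * (wt z * \<bar>t' - s'\<bar>)"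
    if "s \<in> {1..2}" "t \<in> {1..2}" "s' \<in> {1..2}" "t' \<in> {1..2}" for s t s' t' z
  proof -
    have "norm ((m (t *\<^sub>R fst z, t' *\<^sub>R snd z) - m (t *\<^sub>R fst z, s' *\<^sub>R snd z)) - (m (s *\<^sub>R fst z, t' *\<^sub>R snd z) - m (s *\<^sub>R fst z, s' *\<^sub>R snd z)))
        \<le> C * D\<^sup>2 * wt (fst z, snd z) powr (- a) * (wt (fst z, snd z) * \<bar>t - s\<bar>) * (wt (fst z, snd z) * \<bar>t' - s'\<bar>)"
      unfolding D_def using that a C(1) by (intro scaled_mixed_difference d d2 L2) auto
    also have "\<dots> \<le> N * wt (fst z, snd z) powr (- a) * (wt (fst z, snd z) * \<bar>t - s\<bar>) * (wt (fst z, snd z) * \<bar>t' - s'\<bar>)"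
      using N wt_ge_1[of z] by (intro mult_right_mono) auto
    finally show ?thesis by simp
  qed
  have 21: "norm (m (t *\<^sub>R fst z, s' *\<^sub>R snd z) - m (s *\<^sub>R fst z, s' *\<^sub>R snd z))
      \<le> N * wt z powr (- a) * (wt z * \<bar>t - s\<bar>)"
    if "s \<in> {1..2}" "t \<in> {1..2}" "s' \<in> {1..2}" for s t s' z
    using 2[OF that that(3), of z] by simp
  have 22: "norm (m (s *\<^sub>R fst z, t' *\<^sub>R snd z) - m (s *\<^sub>R fst z, s' *\<^sub>R snd z))
      \<le> N * wt z powr (- a) * (wt z * \<bar>t' - s'\<bar>)"
    if "s \<in> {1..2}" "s' \<in> {1..2}" "t' \<in> {1..2}" for s t' s' z
    using 2[OF that(1,1,2,3), of z] by simp
  have "decaying_family a N (\<lambda>s s' z. m (s *\<^sub>R fst z, s' *\<^sub>R snd z))"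
    unfolding decaying_family_def
    by (intro ballI conjI allI admissible_measurable[OF m] 1 21 22 3)
  then show ?thesis by blast
qed

lemma maximal_op_bounded:
  fixes m :: "'a::euclidean_space \<times> 'a \<Rightarrow> complex"
  assumes E: "E \<subseteq> {1..2}" "E \<noteq> {}" and dim: "upper_minkowski_dim E = ereal \<beta>"
    and m: "admissible a 1 m" and p: "1 < p" "p \<le> 2" and q: "1 < q" "q \<le> 2"
    and b: "1 / p + 1 / q < 1 / 2 + (2 * a - \<beta>) / (2 * DIM('a))"
  shows "bounded_Lp_Lq_Lr p q 2 (maximal_op m E)"
proof -
  obtain N where N: "decaying_family a N (\<lambda>s s' z. m (s *\<^sub>R fst z, s *\<^sub>R snd z))"
    using decaying_family_one[OF m] by blast
  have "maximal_op m E = (\<lambda>f g x. SUP t1\<in>E. SUP t2\<in>{1::real}.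
      ennreal (norm (bilinear_op (\<lambda>z. m (t1 *\<^sub>R fst z, t1 *\<^sub>R snd z)) (fourier f) (fourier g) x)))"
    by (simp add: fun_eq_iff maximal_op_def bilinear_mult_eq)
  moreover have "bounded_Lp_Lq_Lr p q 2 (\<lambda>f g x. SUP t1\<in>E. SUP t2\<in>{1::real}.
      ennreal (norm (bilinear_op (\<lambda>z. m (t1 *\<^sub>R fst z, t1 *\<^sub>R snd z)) (fourier f) (fourier g) x)))"
    using admissible_pos[OF m] b
    by (intro maximal_family_bound_exponent[OF N _ E(1) _ cell_exponent_minkowski[OF E dim] cell_exponent_singleton p q]) auto
  ultimately show ?thesis by simp
qed

lemma biparam_maximal_op_bounded:
  fixes m :: "'a::euclidean_space \<times> 'a \<Rightarrow> complex"
  assumes E1: "E1 \<subseteq> {1..2}" "E1 \<noteq> {}" and dim1: "upper_minkowski_dim E1 = ereal \<beta>1"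
    and E2: "E2 \<subseteq> {1..2}" "E2 \<noteq> {}" and dim2: "upper_minkowski_dim E2 = ereal \<beta>2"
    and m: "admissible a 2 m" and p: "1 < p" "p \<le> 2" and q: "1 < q" "q \<le> 2"
    and b: "1 / p + 1 / q < 1 / 2 + (2 * a - \<beta>1 - \<beta>2) / (2 * DIM('a))"
  shows "bounded_Lp_Lq_Lr p q 2 (biparam_maximal_op m E1 E2)"
proof -
  obtain N where N: "decaying_family a N (\<lambda>s s' z. m (s *\<^sub>R fst z, s' *\<^sub>R snd z))"
    using decaying_family_two[OF m] by blast
  have "biparam_maximal_op m E1 E2 = (\<lambda>f g x. SUP t1\<in>E1. SUP t2\<in>E2.
      ennreal (norm (bilinear_op (\<lambda>z. m (t1 *\<^sub>R fst z, t2 *\<^sub>R snd z)) (fourier f) (fourier g) x)))"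
    by (simp add: fun_eq_iff biparam_maximal_op_def bilinear_mult_eq)
  moreover have "bounded_Lp_Lq_Lr p q 2 (\<lambda>f g x. SUP t1\<in>E1. SUP t2\<in>E2.
      ennreal (norm (bilinear_op (\<lambda>z. m (t1 *\<^sub>R fst z, t2 *\<^sub>R snd z)) (fourier f) (fourier g) x)))"
    using admissible_pos[OF m] b
    by (intro maximal_family_bound_exponent[OF N _ E1(1) E2(1) cell_exponent_minkowski[OF E1 dim1]
          cell_exponent_minkowski[OF E2 dim2] p q]) auto
  ultimately show ?thesis by simp
qed

section \<open>Ranges of exponents and conclusion\<close>

text \<open>The two regimes lead to the same inequalities. If 2 a \<le> 2 d + \<beta>, the lower
  bound 2 d / (2 a - \<beta>) is at least 1; otherwise (2 a - \<beta>) / (2 d) exceeds 1 and 3/2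
  lies below the general bound.\<close>

lemma exponent_range:
  fixes a \<beta> d p q :: real
  assumes d: "d > 0" and gap: "2 * a > d + \<beta>"
    and r: "(2 * a \<le> 2 * d + \<beta> \<and> 2 * d / (2 * a - \<beta>) < p \<and> 2 * d / (2 * a - \<beta>) < q \<and>
               1 / p + 1 / q < 1 / 2 + (2 * a - \<beta>) / (2 * d))
      \<or> (2 * a > 2 * d + \<beta> \<and> 1 < p \<and> 1 < q \<and> 1 / p + 1 / q < 3 / 2)"
  shows "1 < p" "1 < q" "1 / p + 1 / q < 1 / 2 + (2 * a - \<beta>) / (2 * d)"
proof -
  have "1 < p \<and> 1 < q \<and> 1 / p + 1 / q < 1 / 2 + (2 * a - \<beta>) / (2 * d)"
    using r
  proof
    assume h: "2 * a \<le> 2 * d + \<beta> \<and> 2 * d / (2 * a - \<beta>) < p \<and> 2 * d / (2 * a - \<beta>) < q \<and>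
               1 / p + 1 / q < 1 / 2 + (2 * a - \<beta>) / (2 * d)"
    then have "1 \<le> 2 * d / (2 * a - \<beta>)" using gap d by (simp add: le_divide_eq)
    with h show ?thesis by linarith
  next
    assume h: "2 * a > 2 * d + \<beta> \<and> 1 < p \<and> 1 < q \<and> 1 / p + 1 / q < 3 / 2"
    then have "1 \<le> (2 * a - \<beta>) / (2 * d)" using d by (simp add: le_divide_eq)
    with h show ?thesis by linarith
  qed
  then show "1 < p" "1 < q" "1 / p + 1 / q < 1 / 2 + (2 * a - \<beta>) / (2 * d)" by auto
qed

theorem proposition6p2:
  fixes E E1 E2 :: "real set" and \<beta> \<beta>1 \<beta>2 a :: real
    and m :: "'a::euclidean_space \<times> 'a \<Rightarrow> complex"
  assumes "E \<subseteq> {1..2}" "E1 \<subseteq> {1..2}" "E2 \<subseteq> {1..2}"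
    and "E \<noteq> {}" "E1 \<noteq> {}" "E2 \<noteq> {}"
    and "upper_minkowski_dim E = ereal \<beta>"
    and "upper_minkowski_dim E1 = ereal \<beta>1"
    and "upper_minkowski_dim E2 = ereal \<beta>2"
  defines "d \<equiv> real DIM('a)"
  shows
    "(admissible a 1 m \<and> 2 * a > d + \<beta> \<longrightarrow>
        (2 * a \<le> 2 * d + \<beta> \<longrightarrow>
          (\<forall>p q. 2 * d / (2 * a - \<beta>) < p \<and> p \<le> 2 \<and> 2 * d / (2 * a - \<beta>) < q \<and> q \<le> 2 \<and>
             1 / p + 1 / q < 1 / 2 + (2 * a - \<beta>) / (2 * d) \<longrightarrow>
             bounded_Lp_Lq_Lr p q 2 (maximal_op m E))) \<and>
        (2 * a > 2 * d + \<beta> \<longrightarrow>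
          (\<forall>p q. 1 < p \<and> p \<le> 2 \<and> 1 < q \<and> q \<le> 2 \<and> 1 / p + 1 / q < 3 / 2 \<longrightarrow>
             bounded_Lp_Lq_Lr p q 2 (maximal_op m E))))
   \<and> (admissible a 2 m \<and> 2 * a > d + \<beta>1 + \<beta>2 \<longrightarrow>
        (2 * a \<le> 2 * d + \<beta>1 + \<beta>2 \<longrightarrow>
          (\<forall>p q. 2 * d / (2 * a - \<beta>1 - \<beta>2) < p \<and> p \<le> 2 \<and>
             2 * d / (2 * a - \<beta>1 - \<beta>2) < q \<and> q \<le> 2 \<and>
             1 / p + 1 / q < 1 / 2 + (2 * a - \<beta>1 - \<beta>2) / (2 * d) \<longrightarrow>
             bounded_Lp_Lq_Lr p q 2 (biparam_maximal_op m E1 E2))) \<and>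
        (2 * a > 2 * d + \<beta>1 + \<beta>2 \<longrightarrow>
          (\<forall>p q. 1 < p \<and> p \<le> 2 \<and> 1 < q \<and> q \<le> 2 \<and> 1 / p + 1 / q < 3 / 2 \<longrightarrow>
             bounded_Lp_Lq_Lr p q 2 (biparam_maximal_op m E1 E2))))"
proof -
  have d: "d > 0" by (simp add: d_def)
  have one: "bounded_Lp_Lq_Lr p q 2 (maximal_op m E)"
    if m: "admissible a 1 m" and gap: "2 * a > d + \<beta>" and p: "p \<le> 2" and q: "q \<le> 2"
      and r: "(2 * a \<le> 2 * d + \<beta> \<and> 2 * d / (2 * a - \<beta>) < p \<and> 2 * d / (2 * a - \<beta>) < q \<and>
               1 / p + 1 / q < 1 / 2 + (2 * a - \<beta>) / (2 * d))
      \<or> (2 * a > 2 * d + \<beta> \<and> 1 < p \<and> 1 < q \<and> 1 / p + 1 / q < 3 / 2)" for p q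
    using exponent_range[OF d gap r] p q
    by (intro maximal_op_bounded[OF assms(1,4,7) m]) (simp_all add: d_def)
  \<comment> \<open>The sum \<beta>1 + \<beta>2 takes the place of \<beta>, so the same exponent
    arithmetic serves both halves.\<close>
  have two: "bounded_Lp_Lq_Lr p q 2 (biparam_maximal_op m E1 E2)"
    if m: "admissible a 2 m" and gap: "2 * a > d + (\<beta>1 + \<beta>2)" and p: "p \<le> 2" and q: "q \<le> 2"
      and r: "(2 * a \<le> 2 * d + (\<beta>1 + \<beta>2) \<and> 2 * d / (2 * a - (\<beta>1 + \<beta>2)) < p \<and> 2 * d / (2 * a - (\<beta>1 + \<beta>2)) < q \<and>
               1 / p + 1 / q < 1 / 2 + (2 * a - (\<beta>1 + \<beta>2)) / (2 * d))
      \<or> (2 * a > 2 * d + (\<beta>1 + \<beta>2) \<and> 1 < p \<and> 1 < q \<and> 1 / p + 1 / q < 3 / 2)" for p q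
    using exponent_range[OF d gap r] p q
    by (intro biparam_maximal_op_bounded[OF assms(2,5,8) assms(3,6,9) m]) (simp_all add: d_def diff_diff_eq)
  have eq: "2 * a - \<beta>1 - \<beta>2 = 2 * a - (\<beta>1 + \<beta>2)" by simp
  show ?thesis
    unfolding eq using one two by (simp add: add.assoc)
qed

end
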